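(* Let $\ell \ge 2$ and let $F$ be an $\ell$-graph. Let $F' \subseteq F$ be a strictly $\ell$-balanced subgraph such that $m_\ell(F') = m_\ell(F)$. Then there exists a constant $c > 0$ such that, for $p=p(n)$, with high probability $G \sim G^{(\ell)}(n,p)$ admits a $2$-bounded edge colouring without a rainbow copy of $F$, if one of the following holds: (i) $\ell = 2$, $F'$ contains a cycle, $F'$ is isomorphic neither to $K_3$ nor to $C_4$, and $p \le c n^{-1/m_2(F)}$; or (ii) $\ell = 2$, $F' \cong C_4$ and $p \ll n^{-1/m_2(C_4)}$; or (iii) $\ell \ge 3$, $r \ge \ell+1$ is an integer with $(\ell, r) \ne (3,4)$, $F' \cong K_r^{(\ell)}$ and $p \le c n^{-1/m_\ell(K_r^{(\ell)})}$.
   Context: An $\ell$-graph is an $\ell$-uniform hypergraph; $2$-graphs are graphs. $v(\cdot)$ and $e(\cdot)$ denote numbers of vertices and edges. $K_r^{(\ell)}$ is the complete $\ell$-graph on $r$ vertices, $K_3$ the triangle and $C_4$ the cycle on $4$ vertices. $G^{(\ell)}(n,p)$ is the random $\ell$-graph on $n$ vertices in which each $\ell$-subset of vertices is an edge independently with probability $p$. "With high probability" means with probability tending to $1$ as $n \to \infty$; $p \ll f(n)$ means $p = o(f(n))$. An edge colouring is $2$-bounded if each colour is used on at most $2$ edges. A copy of $F$ in $G$ is a subgraph isomorphic to $F$; it is rainbow if its edges have pairwise distinct colours. For an $\ell$-graph $G$ on at least $\ell+1$ vertices, $d_\ell(G) := (e(G)-1)/(v(G)-\ell)$ and $m_\ell(G)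 := \max\{d_\ell(J) : J \subseteq G,\ v(J) \ge \ell+1\}$. $G$ is strictly $\ell$-balanced if $m_\ell(G) = d_\ell(G)$ and $d_\ell(J) < m_\ell(G)$ for every proper subgraph $J \subsetneq G$ with $v(J) \ge \ell+1$. *)

theory Defs
  imports "HOL-Probability.Probability" "HOL-Library.Landau_Symbols"
begin

datatype 'a hgraph = HGraph (verts: "'a set") (edges: "'a set set")

definition lgraph :: "nat \<Rightarrow> 'a hgraph \<Rightarrow> bool" where
  "lgraph l G \<longleftrightarrow> finite (verts G) \<and> (\<forall>e\<in>edges G. e \<subseteq> verts G \<and> card e = l)"

(* The last conjunct makes J a hypergraph in its own right; it need not be spanning or induced. *)
definition subgraph :: "'a hgraph \<Rightarrow> 'a hgraph \<Rightarrow> bool" where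
  "subgraph J G \<longleftrightarrow> verts J \<subseteq> verts G \<and> edges J \<subseteq> edges G \<and> (\<forall>e\<in>edges J. e \<subseteq> verts J)"

definition isomorphic :: "'a hgraph \<Rightarrow> 'b hgraph \<Rightarrow> bool" where
  "isomorphic G H \<longleftrightarrow>
     (\<exists>f. bij_betw f (verts G) (verts H) \<and> edges H = (\<lambda>e. f ` e) ` edges G)"

definition is_copy :: "'a hgraph \<Rightarrow> 'b hgraph \<Rightarrow> 'b hgraph \<Rightarrow> bool" where
  "is_copy F G H \<longleftrightarrow> subgraph H G \<and> isomorphic F H"

definition complete_lgraph :: "nat \<Rightarrow> nat \<Rightarrow> nat hgraph" where
  "complete_lgraph l r = HGraph {..<r} {e. e \<subseteq> {..<r} \<and> card e = l}"

(* Only used for k \<ge> 3. *)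
definition cycle_graph :: "nat \<Rightarrow> nat hgraph" where
  "cycle_graph k = HGraph {..<k} ((\<lambda>i. {i, Suc i mod k}) ` {..<k})"

definition contains_cycle :: "'a hgraph \<Rightarrow> bool" where
  "contains_cycle G \<longleftrightarrow> (\<exists>k\<ge>3. \<exists>H. is_copy (cycle_graph k) G H)"

(* Real subtraction throughout: an edgeless G has negative density. *)
definition density :: "nat \<Rightarrow> 'a hgraph \<Rightarrow> real" where
  "density l G = (real (card (edges G)) - 1) / (real (card (verts G)) - real l)"

(* Meaningful only for a finite G with at least l + 1 vertices; otherwise the set under Max
   may be empty. *)
definition max_density :: "nat \<Rightarrow> 'a hgraph \<Rightarrow> real" where
  "max_density l G = Max (density l ` {J. subgraph J G \<and> l + 1 \<le> card (verts J)})"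

definition strictly_balanced :: "nat \<Rightarrow> 'a hgraph \<Rightarrow> bool" where
  "strictly_balanced l G \<longleftrightarrow>
     l + 1 \<le> card (verts G) \<and>
     max_density l G = density l G \<and>
     (\<forall>J. subgraph J G \<and> J \<noteq> G \<and> l + 1 \<le> card (verts J) \<longrightarrow> density l J < max_density l G)"

(* Colours are natural numbers, which is enough since G is finite. Only the values of the
   colouring on the edges of G matter. *)
definition two_bounded :: "'a hgraph \<Rightarrow> ('a set \<Rightarrow> nat) \<Rightarrow> bool" where
  "two_bounded G col \<longleftrightarrow> (\<forall>k. card {e \<in> edges G. col e = k} \<le> 2)"

definition rainbow :: "'a hgraph \<Rightarrow> ('a set \<Rightarrow> nat) \<Rightarrow> bool" where
  "rainbow H col \<longleftrightarrow> inj_on col (edges H)"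

definition has_rainbow_free_colouring :: "'a hgraph \<Rightarrow> 'b hgraph \<Rightarrow> bool" where
  "has_rainbow_free_colouring F G \<longleftrightarrow>
     (\<exists>col. two_bounded G col \<and> \<not> (\<exists>H. is_copy F G H \<and> rainbow H col))"

(* The Boolean function drawn by Pi_pmf is the indicator of the random edge set.
   For p outside [0,1], bernoulli_pmf clamps the parameter. *)
definition random_lgraph :: "nat \<Rightarrow> nat \<Rightarrow> real \<Rightarrow> nat hgraph pmf" where
  "random_lgraph l n p =
     map_pmf (\<lambda>f. HGraph {..<n} {e \<in> edges (complete_lgraph l n). f e})
       (Pi_pmf (edges (complete_lgraph l n)) False (\<lambda>_. bernoulli_pmf p))"

definition whp :: "(nat \<Rightarrow> 'a pmf) \<Rightarrow> ('a \<Rightarrow> bool) \<Rightarrow> bool" where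
  "whp M P \<longleftrightarrow> (\<lambda>n. measure_pmf.prob (M n) {x. P x}) \<longlonglongrightarrow> 1"

end

theory Submission
  imports Defs "HOL-Real_Asymp.Real_Asymp"
begin

text \<open>
  Write \<open>m = m\<^sub>l(F')\<close>. If \<open>G\<close> has no good colouring, it contains an edge-minimal such subgraph \<open>B\<close>; in \<open>B\<close>
  any two edges are separated by a copy of \<open>F'\<close>, and any nonempty proper set of edges is crossed by one.
  Hence \<open>B\<close> can be explored copy by copy: each new copy either meets the explored part in exactly one edge
  (a regular step) or meets it in more vertices (a degenerate step). A regular step multiplies the expected
  number of explored subgraphs by a constant times \<open>n\<^bsup>v-l\<^esup>p\<^bsup>e-1\<^esup>\<close>, which is small for a small constant \<open>c\<close>, and by
  strict balancedness a degenerate step gains a factor \<open>n\<^bsup>-\<epsilon>\<^esup>\<close> up to logarithms. Regular steps alone leave many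
  copies having two edges not yet separated, so with high probability the exploration ends after boundedly
  many steps. So \<open>B\<close> has bounded size, and a first moment bound shows that all its subgraphs have at most
  \<open>m\<close> edges per vertex (strictly fewer if \<open>p\<close> is of smaller order). It remains to colour such sparse \<open>B\<close>: for
  graphs by pairing up the edges at a vertex of small degree, or the edges leaving each vertex in an
  orientation of small outdegree; for cliques by giving each clique two edges of its own via Hall's theorem.
\<close>

text \<open>The delicate point is the number of choices in a regular step. Of the order of
  \<open>ln n\<close> steps are needed before a constant gain per step beats the \<open>n^v\<close>
  possible starting copies, so the explored part outgrows every constant. If a new copy could be
  attached at any explored edge, the factor per step would grow with it and no constant
  \<open>c\<close> would do. Prescribed copies do not run out early, because a copy attached along
  one edge stays unseparated: a potential that counts such copies rises in every regular step and
  falls by a bounded amount in a degenerate one. The excluded cases mark where an estimate loses its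
  slack. \<open>K_3\<close> has too few edges to keep two unseparated ones. For \<open>C_4\<close>,
  \<open>m\<close> is 3/2, and the minimum degree 3 obtained by pairing edges contradicts only a
  strict density bound. For \<open>(l, r) = (3, 4)\<close> the local clique count fails:
  \<open>K_4\<close> has six edges but four triangles.\<close>

definition uniform :: "nat \<Rightarrow> 'b set set \<Rightarrow> bool" where
  "uniform k L \<longleftrightarrow> finite L \<and> (\<forall>f\<in>L. finite f \<and> card f = k)"

definition deg :: "'b \<Rightarrow> 'b set set \<Rightarrow> nat" where
  "deg x L = card {f \<in> L. x \<in> f}"

lemma uniform_finite_Union: "uniform k L \<Longrightarrow> finite (\<Union>L)"
  unfolding uniform_def by auto

lemma uniform_subset: "uniform k L \<Longrightarrow> M \<subseteq> L \<Longrightarrow> uniform k M"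
  unfolding uniform_def by (auto intro: finite_subset)

lemma sum_deg:
  assumes "finite X" "finite L" "\<And>f. f \<in> L \<Longrightarrow> f \<subseteq> X \<and> card f = k"
  shows "(\<Sum>x\<in>X. deg x L) = k * card L"
proof -
  have "(\<Sum>x\<in>X. deg x L) = (\<Sum>x\<in>X. \<Sum>f\<in>L. if x \<in> f then 1 else 0)"
    unfolding deg_def using assms(2) by (intro sum.cong refl) (simp add: sum.If_cases Int_def)
  also have "\<dots> = (\<Sum>f\<in>L. \<Sum>x\<in>X. if x \<in> f then 1 else 0)" by (rule sum.swap)
  also have "\<dots> = (\<Sum>f\<in>L. k)"
  proof (rule sum.cong[OF refl])
    fix f assume "f \<in> L"
    then have "X \<inter> f = f" "card f = k" using assms(3) by auto
    then show "(\<Sum>x\<in>X. if x \<in> f then 1 else 0) = k"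
      using assms(1) by (simp add: sum.If_cases)
  qed
  finally show ?thesis by (simp add: mult.commute)
qed

lemma sum_deg_uniform: "uniform k L \<Longrightarrow> (\<Sum>x\<in>\<Union>L. deg x L) = k * card L"
  by (rule sum_deg) (auto simp: uniform_def)

lemma card_delete:
  assumes "finite L" shows "card {f \<in> L. x \<notin> f} + deg x L = card L"
proof -
  have "card ({f \<in> L. x \<notin> f} \<union> {f \<in> L. x \<in> f}) = card {f \<in> L. x \<notin> f} + deg x L"
    unfolding deg_def using assms by (intro card_Un_disjoint) auto
  moreover have "{f \<in> L. x \<notin> f} \<union> {f \<in> L. x \<in> f} = L" by auto
  ultimately show ?thesis by simp
qed

section \<open>Hall's theorem\<close>

text \<open>The Halmos-Vaughan induction. A tight nonempty proper subfamily is matched inside its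
  union \<open>U\<close>, and the rest keeps the condition after \<open>U\<close> is removed.
  Without one, every nonempty proper subfamily has a spare element, so one index may take any
  element of its set.\<close>

theorem hall_sdr:
  assumes "finite I" and "\<And>i. i \<in> I \<Longrightarrow> finite (A i)"
    and "\<And>J. J \<subseteq> I \<Longrightarrow> card J \<le> card (\<Union>(A ` J))"
  shows "\<exists>R. inj_on R I \<and> (\<forall>i\<in>I. R i \<in> A i)"
  using assms
proof (induction "card I" arbitrary: I A rule: less_induct)
  case less
  note fin = less.prems(1) and finA = less.prems(2) and hall = less.prems(3)
  show ?case
  proof (cases "I = {}")
    case False
    show ?thesis
    proof (cases "\<exists>J. J \<subset> I \<and> J \<noteq> {} \<and> card (\<Union>(A ` J)) = card J")
      case True
      then obtain J where J: "J \<subset> I" "J \<noteq> {}" "card (\<Union>(A ` J)) = card J" by blast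
      define U where "U = \<Union>(A ` J)"
      have finJ: "finite J" using J fin by (meson finite_subset psubset_imp_subset)
      have finU: "finite U" unfolding U_def using J finA finJ by auto
      have "\<exists>R. inj_on R J \<and> (\<forall>i\<in>J. R i \<in> A i)"
      proof (rule less.hyps)
        show "card J < card I" using J fin by (simp add: psubset_card_mono)
        show "finite J" by fact
        show "\<And>i. i \<in> J \<Longrightarrow> finite (A i)" using finA J by blast
        show "\<And>K. K \<subseteq> J \<Longrightarrow> card K \<le> card (\<Union>(A ` K))" using hall J by (meson order.trans psubset_imp_subset)
      qed
      then obtain R1 where R1: "inj_on R1 J" "\<forall>i\<in>J. R1 i \<in> A i" by blast
      have "\<exists>R. inj_on R (I - J) \<and> (\<forall>i\<in>I - J. R i \<in> A i - U)"
      proof (rule less.hyps)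
        show "card (I - J) < card I" using J fin
          by (intro psubset_card_mono) auto
        show "finite (I - J)" using fin by simp
        show "\<And>i. i \<in> I - J \<Longrightarrow> finite (A i - U)" using finA by simp
        fix K assume K: "K \<subseteq> I - J"
        have finK: "finite K" using K fin by (meson finite_Diff finite_subset)
        have "card K + card J = card (K \<union> J)"
          using K finK finJ by (subst card_Un_disjoint) auto
        also have "\<dots> \<le> card (\<Union>(A ` (K \<union> J)))" using hall[of "K \<union> J"] K J by blast
        also have "\<Union>(A ` (K \<union> J)) = (\<Union>i\<in>K. A i - U) \<union> U" unfolding U_def by auto
        also have "card \<dots> \<le> card (\<Union>i\<in>K. A i - U) + card U" by (rule card_Un_le)
        finally show "card K \<le> card (\<Union>i\<in>K. A i - U)" using J unfolding U_def by simp
      qed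
      then obtain R2 where R2: "inj_on R2 (I - J)" "\<forall>i\<in>I - J. R2 i \<in> A i - U" by blast
      define R where "R = (\<lambda>i. if i \<in> J then R1 i else R2 i)"
      have R_J: "R i = R1 i" "R i \<in> A i" "R i \<in> U" if "i \<in> J" for i
        using that R1(2) unfolding R_def U_def by auto
      have R_I: "R i = R2 i" "R i \<in> A i" "R i \<notin> U" if "i \<in> I" "i \<notin> J" for i
        using that R2(2) unfolding R_def by auto
      have "inj_on R I"
      proof (rule inj_onI)
        fix a b assume ab: "a \<in> I" "b \<in> I" "R a = R b"
        show "a = b"
        proof (cases "a \<in> J")
          case True
          then have "b \<in> J" using ab R_J(3)[of a] R_I(3)[of b] by auto
          then show ?thesis using True ab(3) R_J(1) inj_onD[OF R1(1)] by simp
        next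
          case False
          then have "b \<notin> J" using ab R_J(3)[of b] R_I(3)[of a] by auto
          then show ?thesis using False ab R_I(1) inj_onD[OF R2(1), of a b] by simp
        qed
      qed
      moreover have "\<forall>i\<in>I. R i \<in> A i" using R_J(2) R_I(2) by blast
      ultimately show ?thesis by blast
    next
      case noTight: False
      obtain i where i: "i \<in> I" using False by blast
      have "card {i} \<le> card (\<Union>(A ` {i}))" using hall[of "{i}"] i by simp
      then have "A i \<noteq> {}" by auto
      then obtain x where x: "x \<in> A i" by blast
      have "\<exists>R. inj_on R (I - {i}) \<and> (\<forall>j\<in>I - {i}. R j \<in> A j - {x})"
      proof (rule less.hyps)
        show "card (I - {i}) < card I" using fin i by (meson card_Diff1_less)
        show "finite (I - {i})" using fin by simp
        show "\<And>j. j \<in> I - {i} \<Longrightarrow> finite (A j - {x})" using finA by simp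
        fix K assume K: "K \<subseteq> I - {i}"
        have finK: "finite K" using K fin by (meson finite_Diff finite_subset)
        have eq: "(\<Union>j\<in>K. A j - {x}) = \<Union>(A ` K) - {x}" by auto
        show "card K \<le> card (\<Union>j\<in>K. A j - {x})"
        proof (cases "K = {}")
          case False
          have "K \<subset> I" using K i by blast
          then have "card (\<Union>(A ` K)) \<noteq> card K" using noTight False by blast
          moreover have "card K \<le> card (\<Union>(A ` K))" using hall K by blast
          ultimately have "card K < card (\<Union>(A ` K))" by simp
          then show ?thesis unfolding eq
            by (cases "x \<in> \<Union>(A ` K)") (auto simp: card_Diff_singleton_if)
        qed simp
      qed
      then obtain R where R: "inj_on R (I - {i})" "\<forall>j\<in>I - {i}. R j \<in> A j - {x}" by blast
      let ?R = "R(i := x)"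
      have "inj_on ?R I"
      proof (rule inj_onI)
        fix a b assume "a \<in> I" "b \<in> I" "?R a = ?R b"
        then show "a = b"
          using R(2) inj_onD[OF R(1), of a b] by (cases "a = i"; cases "b = i") auto
      qed
      moreover have "\<forall>j\<in>I. ?R j \<in> A j" using R x by auto
      ultimately show ?thesis by (intro exI[of _ ?R] conjI)
    qed
  qed auto
qed

section \<open>Counting cliques in sparse hypergraphs\<close>

definition cliques :: "nat \<Rightarrow> nat \<Rightarrow> 'b set set \<Rightarrow> 'b set set" where
  "cliques k s L = {W. W \<subseteq> \<Union>L \<and> card W = s \<and> (\<forall>f. f \<subseteq> W \<and> card f = k \<longrightarrow> f \<in> L)}"

definition link :: "'b \<Rightarrow> 'b set set \<Rightarrow> 'b set set" where
  "link x L = (\<lambda>f. f - {x}) ` {f \<in> L. x \<in> f}"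

lemma finite_cliques: "uniform k L \<Longrightarrow> finite (cliques k s L)"
  by (rule finite_subset[of _ "Pow (\<Union>L)"]) (auto simp: cliques_def uniform_finite_Union)

lemma sum_deg_cliques: "uniform k L \<Longrightarrow> (\<Sum>x\<in>\<Union>L. deg x (cliques k s L)) = s * card (cliques k s L)"
  by (rule sum_deg) (auto simp: uniform_finite_Union finite_cliques, auto simp: cliques_def)

lemma inj_on_remove: "(\<And>f. f \<in> A \<Longrightarrow> x \<in> f) \<Longrightarrow> inj_on (\<lambda>f. f - {x}) A"
  by (rule inj_onI) (metis insert_Diff)

lemma card_link: "card (link x L) = deg x L"
proof -
  have "inj_on (\<lambda>f. f - {x}) {f \<in> L. x \<in> f}"
    by (rule inj_on_remove) simp
  then show ?thesis unfolding link_def deg_def by (rule card_image)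
qed

lemma uniform_link: "uniform (Suc k) L \<Longrightarrow> uniform k (link x L)"
  unfolding uniform_def link_def by auto

lemma obtain_subset_containing:
  assumes "finite W" "y \<in> W" "1 \<le> k" "k \<le> card W"
  obtains f where "f \<subseteq> W" "y \<in> f" "card f = k"
proof -
  have "k - 1 \<le> card (W - {y})" using assms by simp
  then obtain g where g: "g \<subseteq> W - {y}" "card g = k - 1" "finite g"
    by (meson obtain_subset_with_card_n)
  have "card (insert y g) = k" using g assms(3) by (subst card_insert_disjoint) auto
  then show thesis using that[of "insert y g"] g assms(2) by auto
qed

lemma cliquesI:
  assumes "card W = s" "1 \<le> k" "k \<le> s" "\<And>f. f \<subseteq> W \<Longrightarrow> card f = k \<Longrightarrow> f \<in> L"
  shows "W \<in> cliques k s L"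
proof -
  have finW: "finite W" using assms by (intro card_ge_0_finite) simp
  have "W \<subseteq> \<Union>L"
  proof
    fix y assume y: "y \<in> W"
    obtain f where "f \<subseteq> W" "y \<in> f" "card f = k"
      using obtain_subset_containing[OF finW y assms(2)] assms(1,3) by auto
    then show "y \<in> \<Union>L" using assms(4) by blast
  qed
  then show ?thesis using assms(1,4) by (auto simp: cliques_def)
qed

text \<open>Removing \<open>x\<close> is injective on the cliques through \<open>x\<close> and
  lowers both the uniformity and the clique size by one; this drives the inductions on the
  uniformity.\<close>

lemma deg_cliques_le_link:
  assumes L: "uniform (Suc k) L" and "1 \<le> k" "k \<le> s"
  shows "deg x (cliques (Suc k) (Suc s) L) \<le> card (cliques k s (link x L))"
  unfolding deg_def
proof (rule card_inj_on_le)
  show "inj_on (\<lambda>W. W - {x}) {W \<in> cliques (Suc k) (Suc s) L. x \<in> W}"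
    by (rule inj_on_remove) simp
  show "finite (cliques k s (link x L))"
    using finite_cliques[OF uniform_link[OF L]] .
  show "(\<lambda>W. W - {x}) ` {W \<in> cliques (Suc k) (Suc s) L. x \<in> W} \<subseteq> cliques k s (link x L)"
  proof safe
    fix W assume W: "W \<in> cliques (Suc k) (Suc s) L" and xW: "x \<in> W"
    have finW: "finite W" using W by (intro card_ge_0_finite) (auto simp: cliques_def)
    have cW: "card (W - {x}) = s" using W xW finW by (auto simp: cliques_def)
    have mem: "f \<in> link x L" if f: "f \<subseteq> W - {x}" "card f = k" for f
    proof -
      have "finite f" using f finW by (meson finite_Diff finite_subset)
      then have "card (insert x f) = Suc k" using f by (subst card_insert_disjoint) auto
      moreover have "insert x f \<subseteq> W" using f xW by auto
      ultimately have "insert x f \<in> L" using W by (simp add: cliques_def)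
      moreover have "f = insert x f - {x}" using f by auto
      ultimately show ?thesis unfolding link_def by blast
    qed
    show "W - {x} \<in> cliques k s (link x L)" by (rule cliquesI[OF cW assms(2,3) mem])
  qed
qed

text \<open>The alternative to the link, useful when \<open>x\<close> has large degree: what is left
  of the clique lies in the hypergraph without \<open>x\<close>, which then has few edges.\<close>

lemma deg_cliques_le_delete:
  assumes L: "uniform k L" and "1 \<le> k" "k \<le> s"
  shows "deg x (cliques k (Suc s) L) \<le> card (cliques k s {f \<in> L. x \<notin> f})"
  unfolding deg_def
proof (rule card_inj_on_le)
  show "inj_on (\<lambda>W. W - {x}) {W \<in> cliques k (Suc s) L. x \<in> W}"
    by (rule inj_on_remove) simp
  show "finite (cliques k s {f \<in> L. x \<notin> f})"
    by (rule finite_cliques[of k]) (rule uniform_subset[OF L], auto)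
  show "(\<lambda>W. W - {x}) ` {W \<in> cliques k (Suc s) L. x \<in> W} \<subseteq> cliques k s {f \<in> L. x \<notin> f}"
  proof safe
    fix W assume W: "W \<in> cliques k (Suc s) L" and xW: "x \<in> W"
    have finW: "finite W" using W by (intro card_ge_0_finite) (auto simp: cliques_def)
    have cW: "card (W - {x}) = s" using W xW finW by (auto simp: cliques_def)
    have mem: "f \<in> {f \<in> L. x \<notin> f}" if f: "f \<subseteq> W - {x}" "card f = k" for f
      using W f by (auto simp: cliques_def)
    show "W - {x} \<in> cliques k s {f \<in> L. x \<notin> f}" by (rule cliquesI[OF cW assms(2,3) mem])
  qed
qed

lemma cliques_self_subset: "cliques k k L \<subseteq> L"
  unfolding cliques_def by auto

text \<open>A linear form of the Kruskal-Katona bound for small hypergraphs. Linearity in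
  \<open>card L\<close> is what survives summation over vertices, and the cap \<open>D\<close> is
  what keeps the ratio \<open>a\<close> small. The vertex type is fixed because no argument could
  carry a type variable.\<close>

definition clique_bound :: "nat \<Rightarrow> nat \<Rightarrow> real \<Rightarrow> bool" where
  "clique_bound k D a \<longleftrightarrow>
     (\<forall>L :: nat set set. uniform k L \<and> card L \<le> D \<longrightarrow> real (card (cliques k (Suc k) L)) \<le> a * real (card L))"

text \<open>In uniformity 1 every pair of vertices is a clique, so \<open>d\<close> edges give the
  ratio \<open>(d - 1) / 2\<close>.\<close>

lemma clique_bound_1:
  assumes "real D - 1 \<le> 2 * a"
  shows "clique_bound 1 D a"
  unfolding clique_bound_def
proof (intro allI impI, elim conjE)
  fix L :: "nat set set" assume L: "uniform 1 L" "card L \<le> D"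
  let ?X = "\<Union>L"
  have fin: "finite ?X" using uniform_finite_Union[OF L(1)] .
  have "sum (\<lambda>x. deg x L) ?X = card L" using sum_deg_uniform[OF L(1)] by simp
  moreover have "1 \<le> deg x L" if "x \<in> ?X" for x
    using that L(1) by (auto simp: deg_def uniform_def Suc_le_eq card_gt_0_iff)
  ultimately have cX: "card ?X \<le> card L"
    using sum_mono[of ?X "\<lambda>_. 1" "\<lambda>x. deg x L"] by simp
  have "card (cliques 1 (Suc 1) L) \<le> card {W. W \<subseteq> ?X \<and> card W = 2}"
    using fin by (intro card_mono) (auto simp: cliques_def)
  also have "\<dots> = card ?X choose 2" using n_subsets[OF fin] .
  finally have 1: "card (cliques 1 (Suc 1) L) \<le> card L choose 2"
    using binomial_right_mono[OF cX, of 2] by linarith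
  have "2 * (card L choose 2) = card L * (card L - 1)"
    unfolding choose_two by (rule dvd_mult_div_cancel) (cases "card L", auto)
  then have "2 * real (card L choose 2) = real (card L) * (real (card L) - 1)"
    by (cases "card L") (auto simp: of_nat_mult simp flip: of_nat_mult, simp add: algebra_simps flip: of_nat_mult)
  also have "\<dots> \<le> real (card L) * (2 * a)"
    using assms L(2) by (intro mult_left_mono) auto
  finally show "real (card (cliques 1 (Suc 1) L)) \<le> a * real (card L)"
    using 1 by (simp add: algebra_simps)
qed

text \<open>For a vertex of degree at most \<open>D\<close> the bound is applied to its link; for a vertex of larger
  degree the cliques through it are counted by their edges avoiding it.\<close>

lemma clique_bound_Suc:
  assumes P: "clique_bound k D a" and "1 \<le> k" "0 \<le> a" and D': "real D' \<le> (1 + a) * (real D + 1)"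
  shows "clique_bound (Suc k) D' (a * (real k + 1) / (real k + 2))"
  unfolding clique_bound_def
proof (intro allI impI, elim conjE)
  fix L :: "nat set set" assume L: "uniform (Suc k) L" "card L \<le> D'"
  let ?N = "cliques (Suc k) (Suc (Suc k)) L"
  have vert: "real (deg x ?N) \<le> a * real (deg x L)" for x
  proof (cases "deg x L \<le> D")
    case True
    have "real (deg x ?N) \<le> real (card (cliques k (Suc k) (link x L)))"
      using deg_cliques_le_link[OF L(1) \<open>1 \<le> k\<close>, of "Suc k" x] by simp
    also have "\<dots> \<le> a * real (card (link x L))"
      using P[unfolded clique_bound_def, rule_format, of "link x L"] uniform_link[OF L(1), of x] True
      by (simp add: card_link)
    finally show ?thesis by (simp add: card_link)
  next
    case False
    have "deg x ?N \<le> card (cliques (Suc k) (Suc k) {f \<in> L. x \<notin> f})"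
      using deg_cliques_le_delete[OF L(1), of "Suc k"] by simp
    also have "\<dots> \<le> card {f \<in> L. x \<notin> f}"
      using L by (intro card_mono cliques_self_subset) (auto simp: uniform_def)
    finally have "deg x ?N + deg x L \<le> card L"
      using card_delete[of L x] L by (simp add: uniform_def)
    then have "real (deg x ?N) + real (deg x L) \<le> real D'"
      using L(2) by linarith
    \<comment> \<open>The hypothesis on \<open>D'\<close> is made for this step: degree at least
      \<open>D + 1\<close> bounds all edges together by \<open>(1 + a) * deg x L\<close>.\<close>
    also have "\<dots> \<le> (1 + a) * (real D + 1)" by (rule D')
    also have "\<dots> \<le> (1 + a) * real (deg x L)"
      using False \<open>0 \<le> a\<close> by (intro mult_left_mono) auto
    finally show ?thesis by (simp add: algebra_simps)
  qed
  \<comment> \<open>Double counting: cliques have \<open>k + 2\<close> vertices and edges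
    \<open>k + 1\<close>, which produces the new ratio.\<close>
  have "real (Suc (Suc k) * card ?N) = (\<Sum>x\<in>\<Union>L. real (deg x ?N))"
    using sum_deg_cliques[OF L(1), of "Suc (Suc k)"] by (metis of_nat_sum)
  also have "\<dots> \<le> (\<Sum>x\<in>\<Union>L. a * real (deg x L))" by (rule sum_mono) (rule vert)
  also have "\<dots> = a * real (Suc k * card L)"
    using sum_deg_uniform[OF L(1)] by (metis of_nat_sum sum_distrib_left)
  finally have "real (card ?N) * (real k + 2) \<le> a * (real k + 1) * real (card L)"
    by (simp add: algebra_simps)
  then show "real (card ?N) \<le> a * (real k + 1) / (real k + 2) * real (card L)"
    by (simp add: field_simps)
qed

lemma clique_bound_mono: "clique_bound k D a \<Longrightarrow> D' \<le> D \<Longrightarrow> a \<le> a' \<Longrightarrow> clique_bound k D' a'"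
  unfolding clique_bound_def
  by (meson order.trans mult_right_mono of_nat_0_le_iff)

text \<open>Ratio 1 for at most three edges in uniformity 1 starts the recursion;
  \<open>(1 + 1) * 4 = 8\<close> and \<open>1 * 2 / 3\<close> give the constants here.\<close>

lemma clique_bound_2: "clique_bound 2 8 (2/3)"
  using clique_bound_Suc[OF clique_bound_1[of 3 1], of 8] by (simp add: numeral_2_eq_2)

lemma clique_bound_3: "clique_bound 3 15 (1/2)"
  using clique_bound_Suc[OF clique_bound_2, of 15] by simp

text \<open>Starting from the weaker ratio 5/4 trades ratio for range: 18 edges instead of 15, with
  5/8 instead of 1/2. The longer range yields ratio 1/2 up to 30 edges in uniformity 4, and it
  covers links with 16 edges, which \<open>clique_bound_3\<close> misses.\<close>

lemma clique_bound_3': "clique_bound 3 18 (5/8)"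
proof -
  have "clique_bound 2 9 (5/6)"
    using clique_bound_Suc[OF clique_bound_1[of 3 "5/4"], of 9] by (simp add: numeral_2_eq_2)
  from clique_bound_Suc[OF this, of 18] show ?thesis by simp
qed

lemma clique_bound_4: "clique_bound 4 30 (1/2)"
  using clique_bound_Suc[OF clique_bound_3', of 30] by simp

text \<open>The range \<open>(k + 1)^2\<close> is what the density condition allows for the links
  when \<open>r = l + 1\<close>. The recursion enlarges the range by a factor 3/2, faster than these
  squares grow.\<close>

lemma clique_bound_square:
  assumes "4 \<le> k" shows "clique_bound k ((k + 1)\<^sup>2) (1/2)"
  using assms
proof (induction rule: dec_induct)
  case base
  show ?case using clique_bound_mono[OF clique_bound_4] by simp
next
  case (step k)
  have "real ((Suc k + 1)\<^sup>2) \<le> (1 + 1/2) * (real ((k + 1)\<^sup>2) + 1)"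
  proof -
    have "4 * real k \<le> real k * real k" using step.hyps by (intro mult_right_mono) auto
    then have "0 \<le> real k * real k - 2 * real k - 2" using step.hyps by linarith
    then show ?thesis by (simp add: power2_eq_square algebra_simps)
  qed
  from clique_bound_Suc[OF step.IH _ _ this]
  have "clique_bound (Suc k) ((Suc k + 1)\<^sup>2) (1 / 2 * (real k + 1) / (real k + 2))"
    using step.hyps by simp
  then show ?case by (rule clique_bound_mono) (auto simp: field_simps)
qed

text \<open>Kruskal-Katona in Lovasz's form for integral \<open>y\<close>, with equality for the
  complete \<open>k\<close>-graph on \<open>y\<close> vertices. The recursion reproduces binomials
  because \<open>(z + 1) / (k + 1)\<close> is both \<open>1 + a\<close> and the quotient of
  \<open>Suc z choose Suc k\<close> by \<open>z choose k\<close>.\<close>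

lemma clique_bound_binomial:
  assumes "1 \<le> k" "k \<le> y" shows "clique_bound k (y choose k) ((real y - real k) / (real k + 1))"
  using assms
proof (induction k arbitrary: y rule: dec_induct)
  case base
  show ?case using clique_bound_1[of y "(real y - 1) / 2"] by simp
next
  case (step k)
  then obtain z where z: "y = Suc z" "k \<le> z" by (cases y) auto
  have IH: "clique_bound k (z choose k) ((real z - real k) / (real k + 1))"
    using step.IH z by simp
  have "real (Suc k * (Suc z choose Suc k)) = real (Suc z * (z choose k))"
    using Suc_times_binomial_eq[of z k] by (simp only: mult.commute)
  then have "real (Suc z choose Suc k) = (real z + 1) / (real k + 1) * real (z choose k)"
    by (simp add: field_simps)
  also have "\<dots> \<le> (real z + 1) / (real k + 1) * (real (z choose k) + 1)"
    by (intro mult_left_mono) auto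
  also have "(real z + 1) / (real k + 1) = 1 + (real z - real k) / (real k + 1)"
    by (simp add: field_simps)
  finally have "clique_bound (Suc k) (y choose Suc k)
      ((real z - real k) / (real k + 1) * (real k + 1) / (real k + 2))"
    using clique_bound_Suc[OF IH, of "y choose Suc k"] step.hyps z by simp
  then show ?case using z by (simp add: add.commute)
qed

section \<open>Larger cliques by iterating the one-vertex bounds\<close>

lemma uniform_cliques: "uniform k L \<Longrightarrow> 1 \<le> s \<Longrightarrow> uniform s (cliques k s L)"
  unfolding uniform_def[of s]
  by (auto simp: finite_cliques) (auto simp: cliques_def intro: card_ge_0_finite)

text \<open>Allows the one-vertex bound to be iterated: in the next round the
  \<open>s\<close>-cliques play the role of the edges.\<close>

lemma cliques_Suc_subset:
  assumes "1 \<le> k" "k \<le> s"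
  shows "cliques k (Suc s) L \<subseteq> cliques s (Suc s) (cliques k s L)"
proof
  fix W assume W: "W \<in> cliques k (Suc s) L"
  have cW: "card W = Suc s" using W by (simp add: cliques_def)
  have mem: "g \<in> cliques k s L" if "g \<subseteq> W" "card g = s" for g
    using that W by (auto simp: cliques_def)
  show "W \<in> cliques s (Suc s) (cliques k s L)"
    by (rule cliquesI[OF cW _ _ mem]) (use assms in auto)
qed

lemma binomial_Suc_absorb: "Suc j * (n choose Suc j) = (n - j) * (n choose j)"
  by (metis binomial_absorb_comp binomial_absorption)

lemma card_cliques_Suc:
  fixes L :: "nat set set"
  assumes "uniform k L" "1 \<le> k" "k \<le> s" "s \<le> y" "card (cliques k s L) \<le> y choose s"
  shows "Suc s * card (cliques k (Suc s) L) \<le> (y - s) * card (cliques k s L)"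
proof -
  have u: "uniform s (cliques k s L)" using uniform_cliques[OF assms(1), of s] assms by simp
  have "card (cliques k (Suc s) L) \<le> card (cliques s (Suc s) (cliques k s L))"
    using cliques_Suc_subset[OF assms(2,3)] finite_cliques[OF u] by (intro card_mono)
  also have "real \<dots> \<le> (real y - real s) / (real s + 1) * card (cliques k s L)"
    using clique_bound_binomial[of s y] u assms unfolding clique_bound_def by auto
  finally have "real (Suc s) * real (card (cliques k (Suc s) L)) \<le> (real y - real s) * real (card (cliques k s L))"
    by (simp add: field_simps)
  also have "real y - real s = real (y - s)" using assms by (simp add: of_nat_diff)
  finally show ?thesis by (metis of_nat_le_iff of_nat_mult)
qed

text \<open>The first half keeps the iteration inside the range of the one-vertex bound. The second
  bounds the ratio of cliques to edges by its value for the complete \<open>k\<close>-graph on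
  \<open>y\<close> vertices, in a form free of division.\<close>

lemma card_cliques_binomial:
  fixes L :: "nat set set"
  assumes L: "uniform k L" and k: "1 \<le> k" and le: "card L \<le> y choose k" and "k + j \<le> y"
  shows "card (cliques k (k + j) L) \<le> y choose (k + j) \<and>
    ((k + j) choose k) * card (cliques k (k + j) L) \<le> card L * ((y - k) choose j)"
  using \<open>k + j \<le> y\<close>
proof (induction j)
  case 0
  have "card (cliques k k L) \<le> card L"
    using L cliques_self_subset by (intro card_mono) (auto simp: uniform_def)
  then show ?case using le by simp
next
  case (Suc j)
  define N where "N = card (cliques k (k + j) L)"
  define N' where "N' = card (cliques k (k + Suc j) L)"
  have IH: "N \<le> y choose (k + j)" "((k + j) choose k) * N \<le> card L * ((y - k) choose j)"
    using Suc unfolding N_def by auto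
  have step: "Suc (k + j) * N' \<le> (y - (k + j)) * N"
    using card_cliques_Suc[OF L k, of "k + j" y] IH(1) Suc.prems unfolding N_def N'_def by simp
  have "Suc (k + j) * N' \<le> (y - (k + j)) * (y choose (k + j))"
    using step IH(1) by (meson le_trans mult_le_mono2)
  also have "\<dots> = Suc (k + j) * (y choose Suc (k + j))"
    by (simp only: binomial_Suc_absorb)
  finally have 1: "N' \<le> y choose (k + Suc j)" unfolding Suc_mult_le_cancel1 by simp
  have "Suc j * ((k + Suc j) choose k) = Suc (k + j) * ((k + j) choose k)"
    using binomial_absorb_comp[of "Suc (k + j)" k] by simp
  then have "Suc j * (((k + Suc j) choose k) * N') = ((k + j) choose k) * (Suc (k + j) * N')"
    by (metis mult.assoc mult.commute)
  also have "\<dots> \<le> ((k + j) choose k) * ((y - (k + j)) * N)" using step by (rule mult_le_mono2)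
  also have "\<dots> = (y - (k + j)) * (((k + j) choose k) * N)" by (simp add: ac_simps)
  also have "\<dots> \<le> (y - (k + j)) * (card L * ((y - k) choose j))" using IH(2) by (rule mult_le_mono2)
  also have "\<dots> = card L * ((y - k - j) * ((y - k) choose j))" by (simp add: ac_simps)
  also have "\<dots> = card L * (Suc j * ((y - k) choose Suc j))" by (simp only: binomial_Suc_absorb)
  also have "\<dots> = Suc j * (card L * ((y - k) choose Suc j))" by (simp only: ac_simps)
  finally have "((k + Suc j) choose k) * N' \<le> card L * ((y - k) choose Suc j)"
    using Suc_mult_le_cancel1 by blast
  with 1 show ?case unfolding N'_def by simp
qed

text \<open>With \<open>y = k + j + 2\<close> the ratio bound is
  \<open>((j + 2) choose j) / ((k + j) choose k)\<close>, which has to be at most 1/2. For (3, 2)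
  this would read \<open>12 \<le> 10\<close>.\<close>

lemma two_binomial_le:
  assumes "3 \<le> k" "2 \<le> j" "(k, j) \<noteq> (3, 2)"
  shows "2 * ((j + 2) choose j) \<le> (k + j) choose k"
proof -
  have c2: "2 * ((j + 2) choose 2) = (j + 2) * (j + 1)"
    using Suc_times_binomial_eq[of "j + 1" 1] by (simp add: numeral_2_eq_2)
  have c3: "3 * ((j + 3) choose 3) = (j + 3) * ((j + 2) choose 2)"
    using Suc_times_binomial_eq[of "j + 2" 2] by (simp add: numeral_3_eq_3 numeral_2_eq_2)
  have c4: "4 * ((j + 4) choose 4) = (j + 4) * ((j + 3) choose 3)"
    using Suc_times_binomial_eq[of "j + 3" 3] by (simp add: eval_nat_numeral)
  have sym: "(j + 2) choose j = (j + 2) choose 2" using binomial_symmetric[of j "j + 2"] by simp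
  show ?thesis
  proof (cases "k = 3")
    case True
    then have "6 * ((j + 2) choose 2) \<le> (j + 3) * ((j + 2) choose 2)"
      using assms by (intro mult_le_mono1) auto
    then have "6 * ((j + 2) choose 2) \<le> 3 * ((j + 3) choose 3)" unfolding c3 .
    then show ?thesis unfolding sym True add.commute[of 3 j] by linarith
  next
    case False
    have "24 \<le> (j + 4) * (j + 3)" using mult_le_mono[of 6 "j + 4" 5 "j + 3"] assms by simp
    then have "24 * ((j + 2) choose 2) \<le> (j + 4) * (j + 3) * ((j + 2) choose 2)" by (rule mult_le_mono1)
    also have "\<dots> = (j + 4) * (3 * ((j + 3) choose 3))" unfolding c3 by (simp only: ac_simps)
    also have "\<dots> = 3 * (4 * ((j + 4) choose 4))" unfolding c4 by (simp only: ac_simps)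
    finally have "2 * ((j + 2) choose 2) \<le> (j + 4) choose 4" by simp
    also have "(j + 4) choose 4 = (4 + j) choose j" using binomial_symmetric[of 4 "j + 4"] by (simp add: add.commute)
    also have "\<dots> \<le> (k + j) choose j" using assms False by (intro binomial_right_mono) auto
    also have "\<dots> = (k + j) choose k" using binomial_symmetric[of j "k + j"] by simp
    finally show ?thesis using sym by simp
  qed
qed

text \<open>The hypothesis on \<open>card L\<close> is what a vertex of minimum degree inherits from
  the density condition. It leaves \<open>L\<close> no more edges than the complete
  \<open>k\<close>-graph on \<open>k + j + 2\<close> vertices has, and there the ratio is at most
  1/2.\<close>

lemma card_cliques_large:
  fixes L :: "nat set set"
  assumes L: "uniform k L" and "3 \<le> k" "2 \<le> j"
    and le: "j * card L + (k + 1) \<le> (k + j + 1) * ((k + j) choose k)"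
  shows "2 * card (cliques k (k + j) L) \<le> card L"
proof (cases "(k, j) = (3, 2)")
  \<comment> \<open>Two small bounds replace the failing ratio: at most 28 edges give at most 28
    cliques on four vertices, and up to 30 of those give at most half as many cliques on
    five.\<close>
  case True
  have "(5 :: nat) choose 3 = 10" "(7 :: nat) choose 3 = 35" by (simp_all add: eval_nat_numeral)
  then have d: "card L \<le> 28" using le True by simp
  have "real (card (cliques 3 4 L)) \<le> real (card L)"
    using clique_bound_binomial[of 3 7] L True d \<open>7 choose 3 = 35\<close> unfolding clique_bound_def by auto
  then have d4: "card (cliques 3 4 L) \<le> 28" using d by simp
  have u: "uniform 4 (cliques 3 4 L)" using uniform_cliques[OF L, of 4] True by auto
  have "card (cliques 3 5 L) \<le> card (cliques 4 5 (cliques 3 4 L))"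
    using cliques_Suc_subset[of 3 4 L] finite_cliques[OF u] by (intro card_mono) auto
  also have "real \<dots> \<le> 1/2 * real (card (cliques 3 4 L))"
    using clique_bound_4 u d4 unfolding clique_bound_def by auto
  finally show ?thesis using True \<open>real (card (cliques 3 4 L)) \<le> real (card L)\<close> by simp
next
  case False
  define s where "s = k + j"
  have jk: "j + 2 \<le> j * k"
    using mult_le_mono2[of 3 k j] assms by linarith
  have abs1: "(j + 1) * ((s + 1) choose k) = (s + 1) * (s choose k)"
    using binomial_absorb_comp[of "s + 1" k] unfolding s_def by simp
  have abs2: "(j + 2) * ((s + 2) choose k) = (s + 2) * ((s + 1) choose k)"
    using binomial_absorb_comp[of "s + 2" k] unfolding s_def by simp
  have "(j * (j + 2) * (j + 1)) * card L = (j + 2) * (j + 1) * (j * card L)" by (simp only: ac_simps)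
  also have "\<dots> \<le> (j + 2) * (j + 1) * ((s + 1) * (s choose k))"
    using le unfolding s_def by (intro mult_le_mono2) simp
  also have "(j + 2) * (j + 1) \<le> j * (s + 2)"
    using jk unfolding s_def by (simp add: algebra_simps)
  then have "(j + 2) * (j + 1) * ((s + 1) * (s choose k)) \<le> j * (s + 2) * ((s + 1) * (s choose k))"
    by (rule mult_le_mono1)
  also have "\<dots> = j * (s + 2) * ((j + 1) * ((s + 1) choose k))" by (simp only: abs1)
  also have "\<dots> = j * (j + 1) * ((s + 2) * ((s + 1) choose k))" by (simp only: ac_simps)
  also have "\<dots> = j * (j + 1) * ((j + 2) * ((s + 2) choose k))" by (simp only: abs2)
  also have "\<dots> = (j * (j + 2) * (j + 1)) * ((s + 2) choose k)" by (simp only: ac_simps)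
  finally have "card L \<le> (s + 2) choose k" using assms by simp
  then have "(s choose k) * card (cliques k s L) \<le> card L * ((s + 2 - k) choose j)"
    using card_cliques_binomial[OF L, of "s + 2" j] assms unfolding s_def by simp
  also have "s + 2 - k = j + 2" unfolding s_def by simp
  finally have "(s choose k) * (2 * card (cliques k s L)) \<le> card L * (2 * ((j + 2) choose j))" by simp
  also have "\<dots> \<le> card L * (s choose k)"
    using two_binomial_le[of k j] assms False unfolding s_def by (intro mult_le_mono2) simp
  finally have "(s choose k) * (2 * card (cliques k s L)) \<le> (s choose k) * card L" by (simp add: mult.commute)
  moreover have "0 < s choose k" unfolding s_def by simp
  ultimately show ?thesis unfolding s_def by simp
qed

section \<open>Cliques in graphs and the local bound on links\<close>

lemma card_cliques_1:
  assumes L: "uniform 1 L" shows "card (cliques 1 t L) \<le> card L choose t"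
proof -
  let ?X = "\<Union>L"
  have fin: "finite ?X" using uniform_finite_Union[OF L] .
  have "?X = (\<Union>f\<in>L. f)" by simp
  then have cX: "card ?X \<le> card L"
    using card_UN_le[of L "\<lambda>f. f"] L by (simp add: uniform_def)
  have "card (cliques 1 t L) \<le> card {W. W \<subseteq> ?X \<and> card W = t}"
    using fin by (intro card_mono) (auto simp: cliques_def)
  also have "\<dots> = card ?X choose t" using n_subsets[OF fin] .
  also have "\<dots> \<le> card L choose t" using cX by (rule binomial_right_mono)
  finally show ?thesis .
qed

text \<open>The bound on \<open>card L\<close> is the minimum-degree bound for \<open>k = 2\<close>,
  and it reproduces itself: deleting a vertex of degree above \<open>s\<close> leaves
  \<open>2 * card L \<le> s * s + 1\<close>, within the bound for \<open>s - 1\<close>. The claim is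
  proved at each vertex, with factor \<open>s / 4\<close>, and then summed.\<close>

lemma card_cliques_graph:
  fixes L :: "nat set set"
  assumes "4 \<le> s" "uniform 2 L" "2 * card L \<le> s * s + 2 * s + 3"
  shows "2 * card (cliques 2 s L) \<le> card L"
  using assms
proof (induction s arbitrary: L rule: less_induct)
  case (less s)
  note L = less.prems(2)
  obtain t where t: "s = Suc t" "3 \<le> t" using less.prems by (cases s) auto
  have vert: "4 * deg x (cliques 2 s L) \<le> s * deg x L" for x
  proof (cases "deg x L \<le> s")
    case True
    have u: "uniform 1 (link x L)" using uniform_link[of 1 L x] L by (simp add: numeral_2_eq_2)
    have "deg x (cliques 2 s L) \<le> card (cliques 1 t (link x L))"
      using deg_cliques_le_link[of 1 L t x] L t by (simp add: numeral_2_eq_2)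
    also have "\<dots> \<le> deg x L choose t" using card_cliques_1[OF u, of t] by (simp add: card_link)
    finally have le: "deg x (cliques 2 s L) \<le> deg x L choose t" .
    \<comment> \<open>A clique through \<open>x\<close> needs \<open>t\<close> neighbours, so a
      vertex of degree at most \<open>s = t + 1\<close> lies in no clique, in one, or in at most
      \<open>s\<close>.\<close>
    consider "deg x L < t" | "deg x L = t" | "deg x L = s" using True t by linarith
    then show ?thesis
    proof cases
      case 1
      then show ?thesis using le binomial_eq_0[of "deg x L" t] by simp
    next
      case 2
      have "4 * 1 \<le> s * t" using less.prems(1) t by (intro mult_le_mono) auto
      then show ?thesis using le 2 by simp
    next
      case 3
      then have "4 * deg x (cliques 2 s L) \<le> 4 * s" using le t binomial_symmetric[of 1 s] by simp
      also have "\<dots> \<le> s * s" using less.prems(1) by (rule mult_le_mono1)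
      finally show ?thesis using 3 by simp
    qed
  next
    case False
    let ?M = "{f \<in> L. x \<notin> f}"
    have uM: "uniform 2 ?M" by (rule uniform_subset[OF L]) auto
    have le: "deg x (cliques 2 s L) \<le> card (cliques 2 t ?M)"
      using deg_cliques_le_delete[OF L, of t x] t by simp
    have cM: "card ?M + deg x L = card L" using card_delete L by (auto simp: uniform_def)
    show ?thesis
    proof (cases "s = 4")
      \<comment> \<open>The induction bottoms out at triangles: at most 8 edges remain, spanning at
        most 5 triangles, while \<open>x\<close> has degree at least 5.\<close>
      case True
      then have "card ?M \<le> 8" "5 \<le> deg x L" using cM False less.prems(3) by auto
      moreover have "real (card (cliques 2 3 ?M)) \<le> 2/3 * real (card ?M)"
        using clique_bound_2 uM \<open>card ?M \<le> 8\<close> unfolding clique_bound_def by auto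
      moreover have "t = 3" using True t by simp
      ultimately show ?thesis using le True by simp
    next
      case False
      have "2 * card ?M \<le> t * t + 2 * t + 3"
        using cM less.prems(3) \<open>\<not> deg x L \<le> s\<close> t by simp
      then have "2 * card (cliques 2 t ?M) \<le> card ?M"
        using less.IH[of t ?M] uM t False less.prems(1) by simp
      then have "4 * deg x (cliques 2 s L) \<le> s * (s + 1)"
        using le cM less.prems(1,3) \<open>\<not> deg x L \<le> s\<close> by simp
      also have "\<dots> \<le> s * deg x L" using \<open>\<not> deg x L \<le> s\<close> by (intro mult_le_mono2) simp
      finally show ?thesis .
    qed
  qed
  have "s * (4 * card (cliques 2 s L)) = (\<Sum>x\<in>\<Union>L. 4 * deg x (cliques 2 s L))"
    using sum_deg_cliques[OF L, of s] by (simp add: sum_distrib_left[symmetric])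
  also have "\<dots> \<le> (\<Sum>x\<in>\<Union>L. s * deg x L)" by (rule sum_mono) (rule vert)
  also have "\<dots> = s * (2 * card L)" using sum_deg_uniform[OF L] by (simp add: sum_distrib_left[symmetric])
  finally have "4 * card (cliques 2 s L) \<le> 2 * card L" using less.prems(1) by simp
  then show ?case by simp
qed

text \<open>To be applied to the link of a vertex, with \<open>k = l - 1\<close> and
  \<open>j = r - l\<close>. For (2, 1) the claim fails at \<open>K_4\<close>. For (3, 1) the
  inequality permits 16 edges, one more than \<open>clique_bound_3\<close> handles.\<close>

lemma card_cliques_local:
  fixes L :: "nat set set"
  assumes L: "uniform k L" and "2 \<le> k" "1 \<le> j" and ne: "(k, j) \<noteq> (2, 1)"
    and le: "j * card L + (k + 1) \<le> (k + j + 1) * ((k + j) choose k)"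
    and ne': "(k, j) = (3, 1) \<Longrightarrow> card L \<le> 15"
  shows "2 * card (cliques k (k + j) L) \<le> card L"
proof -
  consider "j = 1" | "2 \<le> j" "k = 2" | "2 \<le> j" "3 \<le> k" using assms by linarith
  then show ?thesis
  proof cases
    case 1
    have "(k + 1) choose k = k + 1" using binomial_symmetric[of 1 "k + 1"] by simp
    then have "card L + (k + 1) \<le> (k + 2) * (k + 1)" using le 1 by simp
    then have d: "card L \<le> (k + 1)\<^sup>2" by (simp add: power2_eq_square)
    have "clique_bound k (if k = 3 then 15 else (k + 1)\<^sup>2) (1/2)"
      using clique_bound_3 clique_bound_square[of k] ne 1 assms(2) by auto
    then have "real (card (cliques k (Suc k) L)) \<le> 1/2 * real (card L)"
      using d ne' 1 L unfolding clique_bound_def by auto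
    then show ?thesis using 1 by simp
  next
    case 2
    define s where "s = j + 2"
    have "2 * (s choose 2) = s * (s - 1)"
      unfolding choose_two by (rule dvd_mult_div_cancel) (cases s, auto)
    then have c: "2 * (s choose 2) = (j + 2) * (j + 1)" by (simp add: s_def)
    have "j * (2 * card L) + 6 \<le> (s + 1) * (2 * (s choose 2))"
      using le 2 by (simp add: s_def add.commute)
    also have "\<dots> = j * (s * s + 2 * s + 3) + 6" unfolding c by (simp add: s_def algebra_simps)
    finally have "2 * card L \<le> s * s + 2 * s + 3" using 2 by simp
    then show ?thesis using card_cliques_graph[of s L] L 2 by (simp add: s_def add.commute)
  next
    case 3
    then show ?thesis using card_cliques_large[OF L] le by simp
  qed
qed

text \<open>The density hypothesis says \<open>card E \<le> m * card (\<Union>E)\<close> with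
  \<open>m = ((r choose l) - 1) / (r - l)\<close>. A vertex of minimum degree then lies in at most
  half as many cliques as edges and can be deleted; demanding the bound for all subsets makes it
  hereditary.\<close>

theorem card_cliques_le:
  fixes B :: "nat set set"
  assumes "3 \<le> l" "l + 1 \<le> r" "(l, r) \<noteq> (3, 4)" "uniform l B"
    and "\<And>E. E \<subseteq> B \<Longrightarrow> (r - l) * card E + card (\<Union>E) \<le> (r choose l) * card (\<Union>E)"
  shows "2 * card (cliques l r B) \<le> card B"
  using assms(4,5)
proof (induction "card B" arbitrary: B rule: less_induct)
  case less
  note B = less.prems(1) and dens = less.prems(2)
  let ?N = "cliques l r B"
  obtain k j where kj: "l = Suc k" "r = Suc (k + j)" "1 \<le> j" "2 \<le> k"
  proof -
    have "l = Suc (l - 1)" "r = Suc ((l - 1) + (r - l))" "1 \<le> r - l" "2 \<le> l - 1" using assms(1,2) by auto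
    then show ?thesis using that by blast
  qed
  show ?case
  proof (cases "B = {}")
    case True
    then show ?thesis using kj by (auto simp: cliques_def)
  next
    case False
    let ?X = "\<Union>B"
    have finX: "finite ?X" and finB: "finite B" using B uniform_finite_Union by (auto simp: uniform_def)
    obtain f where f: "f \<in> B" using False by blast
    then have "f \<noteq> {}" using B kj by (auto simp: uniform_def)
    then have neX: "?X \<noteq> {}" using f by blast
    then have X0: "0 < card ?X" using finX by (simp add: card_gt_0_iff)
    obtain x where x: "x \<in> ?X" and min: "\<And>y. y \<in> ?X \<Longrightarrow> deg x B \<le> deg y B"
      using ex_is_arg_min_if_finite[OF finX neX, of "\<lambda>y. deg y B"]
      by (auto simp: is_arg_min_linorder)
    have sum: "(\<Sum>y\<in>?X. deg y B) = l * card B" using sum_deg_uniform[OF B] .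
    have "card ?X * deg x B \<le> (\<Sum>y\<in>?X. deg y B)"
      using sum_mono[of ?X "\<lambda>_. deg x B" "\<lambda>y. deg y B"] min by simp
    then have avg: "card ?X * deg x B \<le> l * card B" unfolding sum .
    \<comment> \<open>The minimum degree is at most the average \<open>l * card B / card ?X\<close>.
      Inserting the density bound and absorbing \<open>l\<close> into the binomial gives the
      hypothesis of the local bound.\<close>
    have "card ?X * (j * deg x B + l) = j * (card ?X * deg x B) + l * card ?X" by (simp add: algebra_simps)
    also have "\<dots> \<le> j * (l * card B) + l * card ?X" using avg by simp
    also have "\<dots> = l * ((r - l) * card B + card ?X)" using kj by (simp add: algebra_simps)
    also have "\<dots> \<le> l * ((r choose l) * card ?X)" using dens[of B] by (intro mult_le_mono2) simp
    also have "\<dots> = card ?X * ((Suc (k + j) choose Suc k) * Suc k)" by (simp only: kj ac_simps)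
    also have "\<dots> = card ?X * ((k + j + 1) * ((k + j) choose k))"
      unfolding Suc_times_binomial_eq[symmetric] by simp
    finally have "j * deg x B + l \<le> (k + j + 1) * ((k + j) choose k)" using X0 by simp
    then have loc: "j * card (link x B) + (k + 1) \<le> (k + j + 1) * ((k + j) choose k)"
      using kj by (simp add: card_link)
    have ul: "uniform k (link y B)" for y using uniform_link[of k B y] B kj(1) by simp
    have deg_le: "deg y ?N \<le> card (cliques k (k + j) (link y B))" for y
      using deg_cliques_le_link[of k B "k + j" y] B kj by simp
    show ?thesis
    proof (cases "(k, j) = (3, 1) \<and> 15 < deg x B")
      \<comment> \<open>For \<open>(l, r) = (4, 5)\<close> the minimum degree may be 16, just
        outside the local bound. The average is then also at most 16, so \<open>B\<close> is
        16-regular, and ratio 5/8 at every vertex suffices: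
        \<open>5 * card ?N \<le> 10 * card ?X\<close> while
        \<open>4 * card B = 16 * card ?X\<close>.\<close>
      case True
      have "deg x B \<le> 16" using loc True by (simp add: card_link eval_nat_numeral)
      then have d16: "deg x B = 16" using True by simp
      have "card B \<le> 4 * card ?X" using dens[of B] True kj by (simp add: eval_nat_numeral)
      then have "(\<Sum>y\<in>?X. deg y B) \<le> (\<Sum>y\<in>?X. 16)" using sum kj True by simp
      moreover have ge: "(16 :: nat) \<le> deg y B" if "y \<in> ?X" for y using min[OF that] d16 by simp
      ultimately have sum_eq: "(\<Sum>y\<in>?X. 16) = (\<Sum>y\<in>?X. deg y B)"
        using sum_mono[of ?X "\<lambda>_. 16 :: nat" "\<lambda>y. deg y B"] by (metis le_antisym)
      have eq: "deg y B = 16" if "y \<in> ?X" for y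
        using sum_mono_inv[OF sum_eq ge that finX] by simp
      have "deg y ?N \<le> 10" if "y \<in> ?X" for y
      proof -
        have "real (card (cliques 3 4 (link y B))) \<le> 5/8 * real (card (link y B))"
          using clique_bound_3' ul[of y] eq[OF that] True unfolding clique_bound_def by (auto simp: card_link)
        then show ?thesis using deg_le[of y] True eq[OF that] by (simp add: card_link)
      qed
      then have "(\<Sum>y\<in>?X. deg y ?N) \<le> (\<Sum>y\<in>?X. 10)" by (rule sum_mono)
      then have "r * card ?N \<le> 10 * card ?X" using sum_deg_cliques[OF B, of r] by simp
      moreover have "16 * card ?X = l * card B" using sum eq by simp
      ultimately show ?thesis using kj True by simp
    next
      case False
      let ?B = "{f \<in> B. x \<notin> f}"
      have loc2: "2 * deg x ?N \<le> deg x B"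
      proof -
        have "2 * card (cliques k (k + j) (link x B)) \<le> card (link x B)"
          using card_cliques_local[OF ul[of x] kj(4,3) _ loc] False assms(3) kj by (auto simp: card_link)
        then show ?thesis using deg_le[of x] by (simp add: card_link)
      qed
      have cB: "card ?B + deg x B = card B" using card_delete[OF finB] .
      have "0 < deg x B" using x finB by (auto simp: deg_def card_gt_0_iff)
      then have "2 * card (cliques l r ?B) \<le> card ?B"
        using cB by (intro less.hyps uniform_subset[OF B] dens) auto
      moreover have "{W \<in> ?N. x \<notin> W} \<subseteq> cliques l r ?B"
      proof
        fix W assume W: "W \<in> {W \<in> ?N. x \<notin> W}"
        have cW: "card W = r" using W by (auto simp: cliques_def)
        have mem: "f \<in> ?B" if "f \<subseteq> W" "card f = l" for f using that W by (auto simp: cliques_def)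
        show "W \<in> cliques l r ?B" by (rule cliquesI[OF cW _ _ mem]) (use kj in auto)
      qed
      then have "card {W \<in> ?N. x \<notin> W} \<le> card (cliques l r ?B)"
        by (intro card_mono finite_cliques[of l] uniform_subset[OF B]) auto
      moreover have "card {W \<in> ?N. x \<notin> W} + deg x ?N = card ?N"
        using card_delete[OF finite_cliques[OF B]] .
      ultimately show ?thesis using loc2 cB by linarith
    qed
  qed
qed

section \<open>Rainbow-free colourings\<close>

text \<open>A copy is represented by its edge set alone, since only edges are coloured.\<close>

definition copies :: "'a set \<Rightarrow> 'a set set \<Rightarrow> 'b set set set" where
  "copies V E = {(\<lambda>e. \<phi> ` e) ` E | \<phi>. inj_on \<phi> V}"

text \<open>Relative to a part \<open>P\<close> and with arbitrary colours, so that colourings can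
  be assembled from pieces with disjoint palettes.\<close>

definition bounded_col :: "'x set \<Rightarrow> ('x \<Rightarrow> 'c) \<Rightarrow> bool" where
  "bounded_col P col \<longleftrightarrow> (\<forall>e\<in>P. card {e' \<in> P. col e' = col e} \<le> 2)"

definition colourable :: "'b set set set \<Rightarrow> 'b set set \<Rightarrow> bool" where
  "colourable \<C> B \<longleftrightarrow> (\<exists>col :: 'b set \<Rightarrow> nat. bounded_col B col \<and> (\<forall>C\<in>\<C>. C \<subseteq> B \<longrightarrow> \<not> inj_on col C))"

definition minimal_uncolourable :: "'b set set set \<Rightarrow> 'b set set \<Rightarrow> bool" where
  "minimal_uncolourable \<C> B \<longleftrightarrow> \<not> colourable \<C> B \<and> (\<forall>B'. B' \<subset> B \<longrightarrow> colourable \<C> B')"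

lemma bounded_col_comp:
  assumes "inj_on h (col ` P)" "bounded_col P col"
  shows "bounded_col P (h \<circ> col)"
proof -
  have "{e' \<in> P. (h \<circ> col) e' = (h \<circ> col) e} = {e' \<in> P. col e' = col e}" if "e \<in> P" for e
    using that inj_onD[OF assms(1)] by auto
  then show ?thesis using assms(2) unfolding bounded_col_def by simp
qed

lemma colourableI:
  fixes col :: "'b set \<Rightarrow> 'c"
  assumes "finite B" "bounded_col B col" "\<And>C. C \<in> \<C> \<Longrightarrow> C \<subseteq> B \<Longrightarrow> \<not> inj_on col C"
  shows "colourable \<C> B"
proof -
  obtain h :: "'c \<Rightarrow> nat" where h: "inj_on h (col ` B)"
    using finite_imp_inj_to_nat_seg[of "col ` B"] assms(1) by blast
  have "\<not> inj_on (h \<circ> col) C" if "C \<in> \<C>" "C \<subseteq> B" for C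
    using assms(3)[OF that] inj_on_imageI2 by blast
  then show ?thesis
    unfolding colourable_def using bounded_col_comp[OF h assms(2)] by blast
qed

text \<open>The parts get disjoint palettes \<open>Inr\<close> and \<open>Inl\<close>. A copy
  meeting \<open>P\<close> repeats a colour inside \<open>P\<close>; any other copy lies in
  \<open>B - P\<close>.\<close>

lemma colourable_extend:
  assumes "finite B" "P \<subseteq> B" "colourable \<C> (B - P)" "bounded_col P col"
    and "\<And>C. C \<in> \<C> \<Longrightarrow> C \<subseteq> B \<Longrightarrow> C \<inter> P \<noteq> {} \<Longrightarrow> \<not> inj_on col (C \<inter> P)"
  shows "colourable \<C> B"
proof -
  obtain col1 :: "_ \<Rightarrow> nat" where c1: "bounded_col (B - P) col1"
    "\<And>C. C \<in> \<C> \<Longrightarrow> C \<subseteq> B - P \<Longrightarrow> \<not> inj_on col1 C"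
    using assms(3) unfolding colourable_def by blast
  define c where "c = (\<lambda>e. if e \<in> P then Inr (col e) else Inl (col1 e))"
  have "bounded_col B c"
    unfolding bounded_col_def
  proof
    fix e assume e: "e \<in> B"
    show "card {e' \<in> B. c e' = c e} \<le> 2"
    proof (cases "e \<in> P")
      case True
      then have "{e' \<in> B. c e' = c e} = {e' \<in> P. col e' = col e}"
        using assms(2) unfolding c_def by auto
      then show ?thesis using assms(4) True unfolding bounded_col_def by simp
    next
      case False
      then have "{e' \<in> B. c e' = c e} = {e' \<in> B - P. col1 e' = col1 e}"
        unfolding c_def by auto
      then show ?thesis using c1(1) False e unfolding bounded_col_def by simp
    qed
  qed
  moreover have "\<not> inj_on c C" if C: "C \<in> \<C>" "C \<subseteq> B" for C
  proof
    assume inj: "inj_on c C"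
    show False
    proof (cases "C \<inter> P = {}")
      case True
      then have "c e = Inl (col1 e)" if "e \<in> C" for e using that unfolding c_def by auto
      then have "inj_on col1 C" using inj by (simp add: inj_on_def)
      then show False using c1(2)[of C] C True by blast
    next
      case False
      have "c e = Inr (col e)" if "e \<in> C \<inter> P" for e using that unfolding c_def by auto
      then have "inj_on col (C \<inter> P)" using inj by (simp add: inj_on_def)
      then show False using assms(5) C False by blast
    qed
  qed
  ultimately show ?thesis using colourableI[OF assms(1)] by blast
qed

lemma ex_minimal_uncolourable:
  assumes "finite B" "\<not> colourable \<C> B"
  obtains B0 where "B0 \<subseteq> B" "minimal_uncolourable \<C> B0"
proof -
  have "\<exists>B0\<subseteq>B. minimal_uncolourable \<C> B0"
    using assms
  proof (induction B rule: finite_psubset_induct)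
    case (psubset B)
    show ?case
    proof (cases "\<exists>B'. B' \<subset> B \<and> \<not> colourable \<C> B'")
      case True
      then show ?thesis using psubset.IH by (meson order.trans psubset_imp_subset)
    next
      case False
      then show ?thesis using psubset.prems unfolding minimal_uncolourable_def by blast
    qed
  qed
  then show thesis using that by blast
qed

text \<open>Otherwise \<open>col\<close> on \<open>P\<close> would extend a good colouring of
  \<open>B - P\<close>. Degree bounds and separation all come from suitable choices of
  \<open>P\<close> and \<open>col\<close> here.\<close>

lemma minimal_uncolourable_copy:
  assumes "minimal_uncolourable \<C> B" "finite B" "P \<subseteq> B" "P \<noteq> {}" "bounded_col P col"
  shows "\<exists>C\<in>\<C>. C \<subseteq> B \<and> C \<inter> P \<noteq> {} \<and> inj_on col (C \<inter> P)"
proof (rule ccontr)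
  assume "\<not> ?thesis"
  moreover have "B - P \<subset> B" using assms(3,4) by blast
  then have "colourable \<C> (B - P)" using assms(1) by (simp add: minimal_uncolourable_def)
  ultimately have "colourable \<C> B"
    by (intro colourable_extend[OF assms(2,3) _ assms(5)]) blast+
  then show False using assms(1) by (simp add: minimal_uncolourable_def)
qed

lemma minimal_uncolourable_has_copy:
  assumes "minimal_uncolourable \<C> B" "finite B"
  shows "\<exists>C\<in>\<C>. C \<subseteq> B"
proof (rule ccontr)
  assume none: "\<not> ?thesis"
  have eq: "{e' \<in> B. e' = e} = {e}" if "e \<in> B" for e using that by auto
  have "bounded_col B (\<lambda>e. e)" unfolding bounded_col_def using eq by simp
  then have "colourable \<C> B" using none by (intro colourableI[OF assms(2)]) blast+
  then show False using assms(1) by (simp add: minimal_uncolourable_def)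
qed

text \<open>Within each group the elements are paired up, each pair getting its own colour.\<close>

lemma ex_group_colouring:
  fixes g :: "'x \<Rightarrow> 'i"
  assumes "finite P"
  shows "\<exists>col :: 'x \<Rightarrow> 'i \<times> nat. bounded_col P col \<and>
    (\<forall>D i. D \<subseteq> P \<longrightarrow> inj_on col D \<longrightarrow> 2 * card {f \<in> D. g f = i} \<le> card {f \<in> P. g f = i} + 1)"
proof -
  have "\<exists>h. bij_betw h {f \<in> P. g f = i} {0..<card {f \<in> P. g f = i}}" for i
    using assms by (intro ex_bij_betw_finite_nat) simp
  then obtain h where h: "\<And>i. bij_betw (h i) {f \<in> P. g f = i} {0..<card {f \<in> P. g f = i}}" by metis
  \<comment> \<open>\<open>h\<close> numbers each group and \<open>div 2\<close> merges consecutive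
    numbers; the first component keeps different groups apart.\<close>
  define col where "col = (\<lambda>f. (g f, h (g f) f div 2))"
  have b: "bounded_col P col"
    unfolding bounded_col_def
  proof
    fix e assume e: "e \<in> P"
    let ?m = "h (g e) e div 2"
    let ?A = "{e' \<in> P. col e' = col e}"
    have "inj_on (h (g e)) ?A"
      using h[of "g e"] by (rule bij_betw_imp_inj_on[THEN inj_on_subset]) (auto simp: col_def)
    moreover have "h (g e) ` ?A \<subseteq> {2 * ?m, 2 * ?m + 1}" by (auto simp: col_def)
    ultimately have "card ?A \<le> card {2 * ?m, 2 * ?m + 1}" by (intro card_inj_on_le) auto
    then show "card ?A \<le> 2" by simp
  qed
  have c: "2 * card {f \<in> D. g f = i} \<le> card {f \<in> P. g f = i} + 1"
    if D: "D \<subseteq> P" "inj_on col D" for D i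
  proof -
    let ?n = "card {f \<in> P. g f = i}"
    have "inj_on (\<lambda>f. h i f div 2) {f \<in> D. g f = i}"
      using D(2) unfolding inj_on_def col_def by auto
    moreover have "(\<lambda>f. h i f div 2) ` {f \<in> D. g f = i} \<subseteq> {..<(?n + 1) div 2}"
    proof safe
      fix f assume f: "f \<in> D" "i = g f"
      then have "h i f \<in> h i ` {f \<in> P. g f = i}" using D(1) by blast
      then have "h i f \<in> {0..<?n}" using bij_betw_imp_surj_on[OF h[of i]] by simp
      then show "h (g f) f div 2 < (card {fa \<in> P. g fa = g f} + 1) div 2" using f by simp
    qed
    ultimately have "card {f \<in> D. g f = i} \<le> card {..<(?n + 1) div 2}" by (intro card_inj_on_le) auto
    then show ?thesis by simp
  qed
  show ?thesis by (intro exI[of _ col] conjI allI impI b c)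
qed

text \<open>Reduces the construction of colourings to the choice of a partition \<open>g\<close> of
  some edges; what remains is to count degrees in the copy obtained.\<close>

lemma minimal_uncolourable_group:
  assumes "minimal_uncolourable \<C> B" "finite B" "P \<subseteq> B" "P \<noteq> {}"
  shows "\<exists>C\<in>\<C>. C \<subseteq> B \<and> C \<inter> P \<noteq> {} \<and>
    (\<forall>i. 2 * card {f \<in> C \<inter> P. g f = i} \<le> card {f \<in> P. g f = i} + 1)"
proof -
  have "finite P" using assms(2,3) by (rule finite_subset[rotated])
  from ex_group_colouring[OF this, of g] obtain col :: "'a set \<Rightarrow> 'b \<times> nat" where col: "bounded_col P col"
    "\<And>D i. D \<subseteq> P \<Longrightarrow> inj_on col D \<Longrightarrow> 2 * card {f \<in> D. g f = i} \<le> card {f \<in> P. g f = i} + 1"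
    by blast
  obtain C where C: "C \<in> \<C>" "C \<subseteq> B" "C \<inter> P \<noteq> {}" "inj_on col (C \<inter> P)"
    using minimal_uncolourable_copy[OF assms col(1)] by blast
  have "2 * card {f \<in> C \<inter> P. g f = i} \<le> card {f \<in> P. g f = i} + 1" for i
    using col(2)[OF _ C(4)] by simp
  then have all: "\<forall>i. 2 * card {f \<in> C \<inter> P. g f = i} \<le> card {f \<in> P. g f = i} + 1" ..
  show ?thesis
  proof (rule bexI[OF _ C(1)], intro conjI)
    show "C \<subseteq> B" "C \<inter> P \<noteq> {}" using C(2,3) .
    show "\<forall>i. 2 * card {f \<in> C \<inter> P. g f = i} \<le> card {f \<in> P. g f = i} + 1" by (rule all)
  qed
qed

text \<open>All edges at \<open>x\<close> form a single group, so the copy obtained passes through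
  \<open>x\<close> and uses at most half of them, rounded up.\<close>

lemma minimal_uncolourable_deg:
  assumes B: "minimal_uncolourable \<C> B" "finite B" "x \<in> \<Union>B"
    and \<C>: "\<And>C y. C \<in> \<C> \<Longrightarrow> C \<subseteq> B \<Longrightarrow> y \<in> \<Union>C \<Longrightarrow> \<delta> \<le> deg y C"
  shows "2 * \<delta> \<le> deg x B + 1"
proof -
  let ?P = "{f \<in> B. x \<in> f}"
  define g :: "'a set \<Rightarrow> nat" where "g = (\<lambda>_. 0)"
  have "?P \<subseteq> B" "?P \<noteq> {}" using B(3) by auto
  then obtain C where C: "C \<in> \<C>" "C \<subseteq> B" "C \<inter> ?P \<noteq> {}"
    and all: "\<forall>i. 2 * card {f \<in> C \<inter> ?P. g f = i} \<le> card {f \<in> ?P. g f = i} + 1"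
    using minimal_uncolourable_group[OF B(1,2), of ?P g] by blast
  have "{f \<in> C \<inter> ?P. g f = 0} = {f \<in> C. x \<in> f}" "{f \<in> ?P. g f = 0} = ?P"
    using C(2) unfolding g_def by auto
  then have le: "2 * deg x C \<le> deg x B + 1"
    using spec[OF all, of 0] unfolding deg_def by simp
  have "x \<in> \<Union>C" using C(3) by blast
  then have "\<delta> \<le> deg x C" using \<C>[OF C(1,2)] by simp
  then show ?thesis using le by simp
qed

text \<open>Hall's theorem with \<open>k\<close> slots at every vertex: each edge takes a slot at
  one of its vertices, and the sparsity hypothesis is Hall's condition.\<close>

lemma ex_orientation:
  assumes "uniform l B" "\<And>E. E \<subseteq> B \<Longrightarrow> card E \<le> k * card (\<Union>E)"
  shows "\<exists>t. (\<forall>f\<in>B. t f \<in> f) \<and> (\<forall>x. card {f \<in> B. t f = x} \<le> k)"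
proof -
  have "\<exists>R. inj_on R B \<and> (\<forall>f\<in>B. R f \<in> f \<times> {..<k})"
  proof (rule hall_sdr)
    show "finite B" "\<And>f. f \<in> B \<Longrightarrow> finite (f \<times> {..<k})" using assms(1) by (auto simp: uniform_def)
    fix J assume J: "J \<subseteq> B"
    have "(\<Union>f\<in>J. f \<times> {..<k}) = \<Union>J \<times> {..<k}" by auto
    then show "card J \<le> card (\<Union>f\<in>J. f \<times> {..<k})"
      using assms(2)[OF J] by (simp add: card_cartesian_product mult.commute)
  qed
  then obtain R where R: "inj_on R B" "\<And>f. f \<in> B \<Longrightarrow> R f \<in> f \<times> {..<k}" by blast
  have "card {f \<in> B. fst (R f) = x} \<le> k" for x
  proof -
    have "inj_on (\<lambda>f. snd (R f)) {f \<in> B. fst (R f) = x}"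
    proof (rule inj_onI)
      fix a b
      assume a: "a \<in> {f \<in> B. fst (R f) = x}" and b: "b \<in> {f \<in> B. fst (R f) = x}" and "snd (R a) = snd (R b)"
      then have "R a = R b" by (simp add: prod_eq_iff)
      then show "a = b" using inj_onD[OF R(1), of a b] a b by simp
    qed
    moreover have "(\<lambda>f. snd (R f)) ` {f \<in> B. fst (R f) = x} \<subseteq> {..<k}"
      using R(2) by (auto simp: mem_Times_iff)
    ultimately have "card {f \<in> B. fst (R f) = x} \<le> card {..<k}" by (intro card_inj_on_le) auto
    then show ?thesis by simp
  qed
  moreover have "fst (R f) \<in> f" if "f \<in> B" for f using R(2)[OF that] by auto
  ultimately show ?thesis by (intro exI[of _ "\<lambda>f. fst (R f)"]) auto
qed

text \<open>The edges assigned to each vertex by the orientation are paired up. A rainbow copy gets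
  at most \<open>(k + 1) div 2\<close> edges from each of its vertices, too few in total.\<close>

lemma colourable_if_sparse:
  assumes B: "uniform l B" "\<And>E. E \<subseteq> B \<Longrightarrow> card E \<le> k * card (\<Union>E)"
    and \<C>: "\<And>C. C \<in> \<C> \<Longrightarrow> C \<subseteq> B \<Longrightarrow> card (\<Union>C) * ((k + 1) div 2) < card C"
  shows "colourable \<C> B"
proof -
  have finB: "finite B" using B by (simp add: uniform_def)
  obtain t where t: "\<forall>f\<in>B. t f \<in> f" "\<forall>x. card {f \<in> B. t f = x} \<le> k"
    using ex_orientation[OF B] by blast
  from ex_group_colouring[OF finB, of t]
  obtain col :: "'a set \<Rightarrow> 'a \<times> nat" where col: "bounded_col B col"
    "\<And>D i. D \<subseteq> B \<Longrightarrow> inj_on col D \<Longrightarrow> 2 * card {f \<in> D. t f = i} \<le> card {f \<in> B. t f = i} + 1"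
    by blast
  show ?thesis
  proof (rule colourableI[OF finB col(1)])
    fix C assume C: "C \<in> \<C>" "C \<subseteq> B"
    show "\<not> inj_on col C"
    proof
      assume inj: "inj_on col C"
      have finC: "finite (\<Union>C)" using uniform_finite_Union[OF uniform_subset[OF B(1) C(2)]] .
      have "C = (\<Union>x\<in>\<Union>C. {f \<in> C. t f = x})" using t(1) C(2) by blast
      then have "card C \<le> (\<Sum>x\<in>\<Union>C. card {f \<in> C. t f = x})"
        using card_UN_le[OF finC, of "\<lambda>x. {f \<in> C. t f = x}"] by simp
      also have "\<dots> \<le> (\<Sum>x\<in>\<Union>C. (k + 1) div 2)"
      proof (rule sum_mono)
        fix x
        show "card {f \<in> C. t f = x} \<le> (k + 1) div 2" using col(2)[OF C(2) inj, of x] spec[OF t(2), of x] by linarith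
      qed
      finally show False using \<C>[OF C] by simp
    qed
  qed
qed

lemma copiesE:
  assumes "C \<in> copies V E"
  obtains \<phi> where "inj_on \<phi> V" "C = (\<lambda>e. \<phi> ` e) ` E"
  using assms unfolding copies_def by blast

lemma inj_on_image_edges: "inj_on \<phi> V \<Longrightarrow> E \<subseteq> Pow V \<Longrightarrow> inj_on (\<lambda>e. \<phi> ` e) E"
  by (rule inj_on_subset[OF inj_on_image_Pow])

lemma card_copy: "inj_on \<phi> V \<Longrightarrow> E \<subseteq> Pow V \<Longrightarrow> card ((\<lambda>e. \<phi> ` e) ` E) = card E"
  by (intro card_image inj_on_image_edges)

lemma card_Union_copy:
  assumes "inj_on \<phi> V" "E \<subseteq> Pow V" shows "card (\<Union>((\<lambda>e. \<phi> ` e) ` E)) = card (\<Union>E)"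
proof -
  have "\<Union>((\<lambda>e. \<phi> ` e) ` E) = \<phi> ` \<Union>E" by blast
  moreover have "inj_on \<phi> (\<Union>E)" using assms(2) by (intro inj_on_subset[OF assms(1)]) auto
  ultimately show ?thesis by (simp add: card_image)
qed

lemma deg_copy:
  assumes "inj_on \<phi> V" "E \<subseteq> Pow V" "u \<in> V" shows "deg (\<phi> u) ((\<lambda>e. \<phi> ` e) ` E) = deg u E"
proof -
  have mem: "\<phi> u \<in> \<phi> ` e \<longleftrightarrow> u \<in> e" if "e \<in> E" for e
    using inj_on_image_mem_iff[OF assms(1,3), of e] that assms(2) by auto
  have "{f \<in> (\<lambda>e. \<phi> ` e) ` E. \<phi> u \<in> f} = (\<lambda>e. \<phi> ` e) ` {e \<in> E. u \<in> e}" using mem by auto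
  moreover have "inj_on (\<lambda>e. \<phi> ` e) {e \<in> E. u \<in> e}"
    using inj_on_image_edges[OF assms(1,2)] by (rule inj_on_subset) auto
  ultimately show ?thesis unfolding deg_def by (simp add: card_image)
qed

section \<open>Sparse graphs\<close>

lemma deg_conv_neighbours:
  assumes "uniform 2 B" shows "deg x B = card {y. {x, y} \<in> B}"
proof -
  have "{f \<in> B. x \<in> f} = (\<lambda>y. {x, y}) ` {y. {x, y} \<in> B}"
  proof safe
    fix f assume f: "f \<in> B" "x \<in> f"
    then have "card f = 2" using assms by (auto simp: uniform_def)
    then obtain y where "f = {x, y}" using f(2) by (auto simp: card_2_iff doubleton_eq_iff)
    then show "f \<in> (\<lambda>y. {x, y}) ` {y. {x, y} \<in> B}" using f(1) by blast
  qed
  moreover have "inj_on (\<lambda>y. {x, y}) {y. {x, y} \<in> B}"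
    by (rule inj_onI) (auto simp: doubleton_eq_iff)
  ultimately show ?thesis unfolding deg_def by (simp add: card_image)
qed

lemma edge_neq: "uniform 2 B \<Longrightarrow> {x, y} \<in> B \<Longrightarrow> x \<noteq> y"
  unfolding uniform_def by force

lemma deg_split:
  assumes "finite B" shows "deg x B = card {f \<in> B. x \<in> f \<and> Q f} + card {f \<in> B. x \<in> f \<and> \<not> Q f}"
proof -
  have "{f \<in> B. x \<in> f} = {f \<in> B. x \<in> f \<and> Q f} \<union> {f \<in> B. x \<in> f \<and> \<not> Q f}" by auto
  moreover have "card ({f \<in> B. x \<in> f \<and> Q f} \<union> {f \<in> B. x \<in> f \<and> \<not> Q f}) =
      card {f \<in> B. x \<in> f \<and> Q f} + card {f \<in> B. x \<in> f \<and> \<not> Q f}"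
    using assms by (intro card_Un_disjoint) auto
  ultimately show ?thesis unfolding deg_def by simp
qed

text \<open>The edge \<open>xy\<close> gets a colour of its own, the other edges at \<open>x\<close> and at \<open>y\<close> are paired up.\<close>

lemma no_adjacent_deg_5:
  assumes B: "minimal_uncolourable \<C> B" "uniform 2 B" "{x, y} \<in> B" "deg x B \<le> 5" "deg y B \<le> 5"
    and \<C>: "\<And>C z. C \<in> \<C> \<Longrightarrow> C \<subseteq> B \<Longrightarrow> z \<in> \<Union>C \<Longrightarrow> 3 \<le> deg z C"
    "\<And>C z w. C \<in> \<C> \<Longrightarrow> C \<subseteq> B \<Longrightarrow> {z, w} \<in> C \<Longrightarrow> deg z C \<noteq> 3 \<or> deg w C \<noteq> 3"
  shows False
proof -
  have finB: "finite B" using B(2) by (simp add: uniform_def)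
  have xy: "x \<noteq> y" using edge_neq B(2,3) by metis
  have only: "f = {x, y}" if "f \<in> B" "x \<in> f" "y \<in> f" for f
    using that B(2) xy by (auto simp: uniform_def card_2_iff doubleton_eq_iff)
  define P where "P = {f \<in> B. x \<in> f \<or> y \<in> f}"
  define g :: "'a set \<Rightarrow> nat" where "g = (\<lambda>f. if f = {x, y} then 0 else if x \<in> f then 1 else 2)"
  have P: "P \<subseteq> B" "P \<noteq> {}" unfolding P_def using B(3) by auto
  obtain C where C: "C \<in> \<C>" "C \<subseteq> B" "C \<inter> P \<noteq> {}"
    and all: "\<forall>i. 2 * card {f \<in> C \<inter> P. g f = i} \<le> card {f \<in> P. g f = i} + 1"
    using minimal_uncolourable_group[OF B(1) finB P, of g] by blast
  have finC: "finite C" using C(2) finB finite_subset by blast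
  have le1: "card {f \<in> A. z \<in> f \<and> f = {x, y}} \<le> 1" for A z
    using card_mono[of "{{x, y}}" "{f \<in> A. z \<in> f \<and> f = {x, y}}"] by auto
  have eqx: "{f \<in> P. g f = 1} = {f \<in> B. x \<in> f \<and> f \<noteq> {x, y}}"
    "{f \<in> C \<inter> P. g f = 1} = {f \<in> C. x \<in> f \<and> f \<noteq> {x, y}}"
    unfolding P_def g_def using C(2) by auto
  have eqy: "{f \<in> P. g f = 2} = {f \<in> B. y \<in> f \<and> f \<noteq> {x, y}}"
    "{f \<in> C \<inter> P. g f = 2} = {f \<in> C. y \<in> f \<and> f \<noteq> {x, y}}"
    unfolding P_def g_def using C(2) only by auto
  have "{f \<in> B. x \<in> f \<and> f = {x, y}} = {{x, y}}" "{f \<in> B. y \<in> f \<and> f = {x, y}} = {{x, y}}" using B(3) by auto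
  then have "card {f \<in> B. x \<in> f \<and> f \<noteq> {x, y}} \<le> 4" "card {f \<in> B. y \<in> f \<and> f \<noteq> {x, y}} \<le> 4"
    using deg_split[OF finB, of x "\<lambda>f. f = {x, y}"] deg_split[OF finB, of y "\<lambda>f. f = {x, y}"] B(4,5) by auto
  then have le2: "card {f \<in> C. x \<in> f \<and> f \<noteq> {x, y}} \<le> 2" "card {f \<in> C. y \<in> f \<and> f \<noteq> {x, y}} \<le> 2"
    using spec[OF all, of 1] spec[OF all, of 2] unfolding eqx eqy by auto
  have dx: "deg x C \<le> 2 + card {f \<in> C. x \<in> f \<and> f = {x, y}}" and dy: "deg y C \<le> 2 + card {f \<in> C. y \<in> f \<and> f = {x, y}}"
    using deg_split[OF finC, of x "\<lambda>f. f = {x, y}"] deg_split[OF finC, of y "\<lambda>f. f = {x, y}"] le2 by auto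
  \<comment> \<open>The paired edges contribute at most 2 to the degree of \<open>x\<close> or
    \<open>y\<close> in the copy, but 3 are needed. So the copy contains \<open>{x, y}\<close>, and
    both ends have degree exactly 3 in it.\<close>
  have "x \<in> \<Union>C \<or> y \<in> \<Union>C" using C(3) unfolding P_def by blast
  then have "card {f \<in> C. x \<in> f \<and> f = {x, y}} \<noteq> 0 \<or> card {f \<in> C. y \<in> f \<and> f = {x, y}} \<noteq> 0"
    using \<C>(1)[OF C(1,2), of x] \<C>(1)[OF C(1,2), of y] dx dy by linarith
  then have xyC: "{x, y} \<in> C" by (auto simp: card_eq_0_iff)
  then have "deg x C = 3" "deg y C = 3"
    using \<C>(1)[OF C(1,2), of x] \<C>(1)[OF C(1,2), of y] dx dy le1[of C x] le1[of C y] by fastforce+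
  then show False using \<C>(2)[OF C(1,2) xyC] by blast
qed

text \<open>Here \<open>xz\<close> and \<open>yz\<close> share a colour and the remaining edges at \<open>x\<close>, at \<open>y\<close> and at \<open>z\<close> are paired up.\<close>

lemma no_deg_6_between_deg_5:
  assumes B: "minimal_uncolourable \<C> B" "uniform 2 B" "{x, z} \<in> B" "{y, z} \<in> B" "x \<noteq> y"
    "deg x B \<le> 5" "deg y B \<le> 5" "deg z B \<le> 6" "{x, y} \<notin> B"
    and \<C>: "\<And>C z. C \<in> \<C> \<Longrightarrow> C \<subseteq> B \<Longrightarrow> z \<in> \<Union>C \<Longrightarrow> 3 \<le> deg z C"
    "\<And>C z w. C \<in> \<C> \<Longrightarrow> C \<subseteq> B \<Longrightarrow> {z, w} \<in> C \<Longrightarrow> deg z C \<noteq> 3 \<or> deg w C \<noteq> 3"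
  shows False
proof -
  have finB: "finite B" using B(2) by (simp add: uniform_def)
  have ne: "x \<noteq> z" "y \<noteq> z" using edge_neq B(2,3,4) by metis+
  have only: "f = {u, v}" if "f \<in> B" "u \<in> f" "v \<in> f" "u \<noteq> v" for f u v
    using that B(2) by (auto simp: uniform_def card_2_iff doubleton_eq_iff)
  define Z where "Z = {{x, z}, {y, z}}"
  have cZ: "card Z = 2" unfolding Z_def using B(5) ne by (auto simp: doubleton_eq_iff)
  define P where "P = {f \<in> B. x \<in> f \<or> y \<in> f \<or> z \<in> f}"
  define g :: "'a set \<Rightarrow> nat" where
    "g = (\<lambda>f. if f \<in> Z then 0 else if x \<in> f then 1 else if y \<in> f then 2 else 3)"
  have P: "P \<subseteq> B" "P \<noteq> {}" unfolding P_def using B(3) by auto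
  obtain C where C: "C \<in> \<C>" "C \<subseteq> B" "C \<inter> P \<noteq> {}"
    and all: "\<forall>i. 2 * card {f \<in> C \<inter> P. g f = i} \<le> card {f \<in> P. g f = i} + 1"
    using minimal_uncolourable_group[OF B(1) finB P, of g] by blast
  have finC: "finite C" using C(2) finB finite_subset by blast
  have xB: "{f \<in> B. x \<in> f \<and> f \<in> Z} = {{x, z}}" and yB: "{f \<in> B. y \<in> f \<and> f \<in> Z} = {{y, z}}"
    and zB: "{f \<in> B. z \<in> f \<and> f \<in> Z} = Z"
    using B(3,4,5) ne unfolding Z_def by auto
  have grp: "{f \<in> P. g f = 0} = Z" "{f \<in> C \<inter> P. g f = 0} = C \<inter> Z"
    using B(3,4) C(2) unfolding P_def g_def Z_def by auto
  have eqx: "{f \<in> P. g f = 1} = {f \<in> B. x \<in> f \<and> f \<notin> Z}"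
    "{f \<in> C \<inter> P. g f = 1} = {f \<in> C. x \<in> f \<and> f \<notin> Z}"
    unfolding P_def g_def using C(2) by auto
  have xyf: "\<not> (x \<in> f \<and> y \<in> f)" if "f \<in> B" for f using only[of f x y] that B(5,9) by blast
  have xzf: "f \<in> Z" if "f \<in> B" "x \<in> f \<or> y \<in> f" "z \<in> f" for f
    using only[of f x z] only[of f y z] that ne unfolding Z_def by blast
  have eqy: "{f \<in> P. g f = 2} = {f \<in> B. y \<in> f \<and> f \<notin> Z}"
    "{f \<in> C \<inter> P. g f = 2} = {f \<in> C. y \<in> f \<and> f \<notin> Z}"
    unfolding P_def g_def using C(2) xyf by auto
  have eqz: "{f \<in> P. g f = 3} = {f \<in> B. z \<in> f \<and> f \<notin> Z}"
    "{f \<in> C \<inter> P. g f = 3} = {f \<in> C. z \<in> f \<and> f \<notin> Z}"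
    unfolding P_def g_def using C(2) xzf by auto
  \<comment> \<open>Removing \<open>Z\<close> costs one edge at \<open>x\<close> and at
    \<open>y\<close> and two at \<open>z\<close>; degrees 5, 5 and 6 all drop to 4, of which the
    copy has at most 2.\<close>
  have "card {f \<in> B. x \<in> f \<and> f \<notin> Z} \<le> 4" "card {f \<in> B. y \<in> f \<and> f \<notin> Z} \<le> 4"
    "card {f \<in> B. z \<in> f \<and> f \<notin> Z} \<le> 4"
    using deg_split[OF finB, of x "\<lambda>f. f \<in> Z"] deg_split[OF finB, of y "\<lambda>f. f \<in> Z"]
      deg_split[OF finB, of z "\<lambda>f. f \<in> Z"] B(6,7,8) unfolding xB yB zB cZ by auto
  then have le2: "card {f \<in> C. x \<in> f \<and> f \<notin> Z} \<le> 2" "card {f \<in> C. y \<in> f \<and> f \<notin> Z} \<le> 2"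
    "card {f \<in> C. z \<in> f \<and> f \<notin> Z} \<le> 2"
    using spec[OF all, of 1] spec[OF all, of 2] spec[OF all, of 3] unfolding eqx eqy eqz by auto
  have CZ: "card (C \<inter> Z) \<le> 1" using spec[OF all, of 0] unfolding grp cZ by simp
  have le1: "card {f \<in> C. u \<in> f \<and> f \<in> Z} \<le> 1" for u
  proof -
    have "card {f \<in> C. u \<in> f \<and> f \<in> Z} \<le> card (C \<inter> Z)" using finC by (intro card_mono) auto
    then show ?thesis using CZ by simp
  qed
  have d: "deg u C \<le> 2 + card {f \<in> C. u \<in> f \<and> f \<in> Z}" if "u \<in> {x, y, z}" for u
    using deg_split[OF finC, of u "\<lambda>f. f \<in> Z"] le2 that by auto
  have d3: "deg u C = 3 \<and> (\<exists>f\<in>C. u \<in> f \<and> f \<in> Z)" if "u \<in> {x, y, z}" "u \<in> \<Union>C" for u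
  proof -
    have "3 \<le> deg u C" using \<C>(1)[OF C(1,2) that(2)] .
    then have "deg u C = 3" "card {f \<in> C. u \<in> f \<and> f \<in> Z} \<noteq> 0" using d[OF that(1)] le1[of u] by linarith+
    then show ?thesis by (auto simp: card_eq_0_iff)
  qed
  have "x \<in> \<Union>C \<or> y \<in> \<Union>C \<or> z \<in> \<Union>C" using C(3) unfolding P_def by blast
  then have "\<exists>f\<in>C. f \<in> Z" using d3 by blast
  then consider "{x, z} \<in> C" | "{y, z} \<in> C" unfolding Z_def by blast
  then show False
  proof cases
    case 1
    then show False using \<C>(2)[OF C(1,2) 1] d3[of x] d3[of z] by blast
  next
    case 2
    then show False using \<C>(2)[OF C(1,2) 2] d3[of y] d3[of z] by blast
  qed
qed

lemma finite_neighbours: "uniform 2 B \<Longrightarrow> finite {y. {x, y} \<in> B}"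
  by (rule finite_subset[OF _ uniform_finite_Union[of 2 B]]) auto

text \<open>For a triangle \<open>xyz\<close> of vertices of degree 5 pair \<open>xy\<close> with \<open>xa\<close>, \<open>yz\<close> with \<open>yb\<close> and \<open>zx\<close> with \<open>zc\<close>,
  and pair up the two remaining edges at each of \<open>x\<close>, \<open>y\<close>, \<open>z\<close>. A rainbow copy of \<open>K\<^sub>4\<close> meeting the triangle
  contains it, and choosing \<open>a\<close>, \<open>b\<close>, \<open>c\<close> to exhaust the common neighbours of \<open>x\<close>, \<open>y\<close>, \<open>z\<close> excludes it.\<close>

lemma five_regular_colourable_K4:
  assumes B: "minimal_uncolourable \<C> B" "uniform 2 B" "\<And>x. x \<in> \<Union>B \<Longrightarrow> deg x B = 5"
    and \<C>: "\<And>C. C \<in> \<C> \<Longrightarrow> C \<subseteq> B \<Longrightarrow> \<exists>W. card W = 4 \<and> C = {e. e \<subseteq> W \<and> card e = 2}"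
  shows False
proof -
  have finB: "finite B" using B(2) by (simp add: uniform_def)
  obtain C0 where C0: "C0 \<in> \<C>" "C0 \<subseteq> B"
    using minimal_uncolourable_has_copy[OF B(1) finB] by blast
  obtain W0 where W0: "card W0 = 4" "C0 = {e. e \<subseteq> W0 \<and> card e = 2}" using \<C>[OF C0] by blast
  obtain T where "T \<subseteq> W0" "card T = 3" using obtain_subset_with_card_n[of 3 W0] W0(1) by auto
  then obtain x y z where xyz: "x \<in> W0" "y \<in> W0" "z \<in> W0" "x \<noteq> y" "y \<noteq> z" "z \<noteq> x"
    by (auto simp: card_3_iff)
  have tri: "{x, y} \<in> B" "{y, z} \<in> B" "{z, x} \<in> B"
    by (rule subsetD[OF C0(2)], simp add: W0(2) xyz)+
  define N where "N = (\<lambda>u. {w. {u, w} \<in> B} - {x, y, z})"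
  have N3: "card (N u) = 3" if "u \<in> {x, y, z}" for u
  proof -
    have "x \<in> \<Union>B" "y \<in> \<Union>B" "z \<in> \<Union>B"
      by (rule UnionI[OF tri(1)], simp, rule UnionI[OF tri(2)], simp, rule UnionI[OF tri(3)], simp)
    then have "u \<in> \<Union>B" using that by auto
    then have "deg u B = 5" by (rule B(3))
    then have c5: "card {w. {u, w} \<in> B} = 5" using deg_conv_neighbours[OF B(2)] by simp
    have u: "u \<notin> {w. {u, w} \<in> B}" using edge_neq[OF B(2)] by blast
    have "N u = {w. {u, w} \<in> B} - ({x, y, z} - {u})" using u unfolding N_def by auto
    moreover have "{x, y, z} - {u} \<subseteq> {w. {u, w} \<in> B}" using that tri by (auto simp: insert_commute)
    moreover have "card ({x, y, z} - {u}) = 2" using that xyz by auto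
    ultimately show ?thesis using c5 by (simp add: card_Diff_subset)
  qed
  define Q where "Q = N x \<inter> N y \<inter> N z"
  have finN: "finite (N u)" for u unfolding N_def using finite_neighbours[OF B(2)] by simp
  have "\<exists>a b c. a \<in> N x \<and> b \<in> N y \<and> c \<in> N z \<and> Q \<subseteq> {a, b, c}"
  proof -
    have "card Q \<le> card (N x)" unfolding Q_def by (intro card_mono finN) auto
    then have "card Q \<le> 3" using N3 by simp
    then consider "card Q = 0" | "card Q = 1" | "card Q = 2" | "card Q = 3" by linarith
    then show ?thesis
    proof cases
      case 1
      then have "Q = {}" using finN unfolding Q_def by auto
      moreover have "N x \<noteq> {}" "N y \<noteq> {}" "N z \<noteq> {}" using N3[of x] N3[of y] N3[of z] by auto
      ultimately show ?thesis by blast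
    next
      case 2
      then obtain a where "Q = {a}" by (auto simp: card_1_singleton_iff)
      then show ?thesis unfolding Q_def by blast
    next
      case 3
      then obtain a b where "Q = {a, b}" by (auto simp: card_2_iff)
      then show ?thesis unfolding Q_def by blast
    next
      case 4
      then obtain a b c where "Q = {a, b, c}" by (auto simp: card_3_iff)
      then show ?thesis unfolding Q_def by blast
    qed
  qed
  then obtain a b c where abc: "a \<in> N x" "b \<in> N y" "c \<in> N z" "Q \<subseteq> {a, b, c}" by blast
  have abc_ne: "a \<notin> {x, y, z}" "b \<notin> {x, y, z}" "c \<notin> {x, y, z}" using abc unfolding N_def by auto
  define P where "P = {f \<in> B. x \<in> f \<or> y \<in> f \<or> z \<in> f}"
  have loop: "{u} \<notin> B" for u using edge_neq[OF B(2), of u u] by auto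
  define A0 where "A0 = {{x, y}, {x, a}}"
  define A1 where "A1 = {{y, z}, {y, b}}"
  define A2 where "A2 = {{z, x}, {z, c}}"
  define g :: "'a set \<Rightarrow> nat" where
    "g = (\<lambda>f. if f \<in> A0 then 0 else if f \<in> A1 then 1 else if f \<in> A2 then 2
       else if x \<in> f then 3 else if y \<in> f then 4 else 5)"
  have gD: "g f = 0 \<Longrightarrow> f \<in> A0" "g f = 1 \<Longrightarrow> f \<in> A1" "g f = 2 \<Longrightarrow> f \<in> A2"
    "g f = 3 \<Longrightarrow> x \<in> f \<and> f \<notin> A0 \<union> A1 \<union> A2"
    "g f = 4 \<Longrightarrow> y \<in> f \<and> f \<notin> A0 \<union> A1 \<union> A2"
    "g f = 5 \<Longrightarrow> x \<notin> f \<and> y \<notin> f \<and> f \<notin> A0 \<union> A1 \<union> A2" for f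
    by (simp_all add: g_def split: if_splits)
  have "P \<subseteq> B" "{x, y} \<in> P" unfolding P_def using tri by auto
  then have P: "P \<subseteq> B" "P \<noteq> {}" by blast+
  from minimal_uncolourable_group[OF B(1) finB P, of g]
  obtain C where C: "C \<in> \<C>" "C \<subseteq> B" "C \<inter> P \<noteq> {}"
    and all: "\<forall>i. 2 * card {f \<in> C \<inter> P. g f = i} \<le> card {f \<in> P. g f = i} + 1"
    by blast
  have finC: "finite C" using C(2) finB by (rule finite_subset)
  have rest: "card {f \<in> B. u \<in> f \<and> f \<notin> (\<lambda>w. {u, w}) ` ({x, y, z} \<union> {d})} \<le> 2"
    if "u \<in> {x, y, z}" "d \<in> N u" for u d
  proof -
    have "{f \<in> B. u \<in> f \<and> f \<notin> (\<lambda>w. {u, w}) ` ({x, y, z} \<union> {d})} \<subseteq> (\<lambda>w. {u, w}) ` (N u - {d})"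
    proof
      fix f assume f: "f \<in> {f \<in> B. u \<in> f \<and> f \<notin> (\<lambda>w. {u, w}) ` ({x, y, z} \<union> {d})}"
      then have "card f = 2" using B(2) by (auto simp: uniform_def)
      then obtain w where w: "f = {u, w}" using f by (auto simp: card_2_iff doubleton_eq_iff)
      then have "w \<notin> {x, y, z} \<union> {d}" using f by blast
      then show "f \<in> (\<lambda>w. {u, w}) ` (N u - {d})" using f w unfolding N_def by auto
    qed
    then have "card {f \<in> B. u \<in> f \<and> f \<notin> (\<lambda>w. {u, w}) ` ({x, y, z} \<union> {d})} \<le> card (N u - {d})"
      using finN by (meson finite_Diff surj_card_le)
    then show ?thesis using N3[OF that(1)] that(2) finN by simp
  qed
  have pair: "card {f \<in> P. g f = i} \<le> 2" if "{f \<in> P. g f = i} \<subseteq> {s, t}" for i s t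
    using card_mono[OF _ that] by (auto intro: le_trans[OF _ card_insert_le_m1])
  have "card {f \<in> P. g f = i} \<le> 2" if "i < 6" for i
  proof -
    have "i \<in> {0, 1, 2, 3, 4, 5}" using that by auto
    then consider "i = 0" | "i = 1" | "i = 2" | "i = 3" | "i = 4" | "i = 5" by blast
    then show ?thesis
    proof cases
      case 1
      show ?thesis unfolding 1 by (rule pair[of _ "{x, y}" "{x, a}"]) (use gD(1) A0_def in blast)
    next
      case 2
      show ?thesis unfolding 2 by (rule pair[of _ "{y, z}" "{y, b}"]) (use gD(2) A1_def in blast)
    next
      case 3
      show ?thesis unfolding 3 by (rule pair[of _ "{z, x}" "{z, c}"]) (use gD(3) A2_def in blast)
    next
      case 4
      have "f \<in> B \<and> x \<in> f \<and> f \<notin> (\<lambda>w. {x, w}) ` ({x, y, z} \<union> {a})" if "f \<in> P" "g f = 3" for f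
      proof (intro conjI)
        show fB: "f \<in> B" and "x \<in> f" using that gD(4) unfolding P_def by auto
        have "f \<noteq> {x, y}" "f \<noteq> {x, a}" "f \<noteq> {x, z}" "f \<noteq> {x, x}"
          using gD(4)[OF that(2)] loop fB unfolding A0_def A2_def by (auto simp: insert_commute)
        then show "f \<notin> (\<lambda>w. {x, w}) ` ({x, y, z} \<union> {a})" by blast
      qed
      then have "card {f \<in> P. g f = 3} \<le> card {f \<in> B. x \<in> f \<and> f \<notin> (\<lambda>w. {x, w}) ` ({x, y, z} \<union> {a})}"
        using finB by (intro card_mono) auto
      then show ?thesis using rest[of x a] abc 4 by simp
    next
      case 5
      have "f \<in> B \<and> y \<in> f \<and> f \<notin> (\<lambda>w. {y, w}) ` ({x, y, z} \<union> {b})" if "f \<in> P" "g f = 4" for f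
      proof (intro conjI)
        show fB: "f \<in> B" and "y \<in> f" using that gD(5) unfolding P_def by auto
        have "f \<noteq> {y, x}" "f \<noteq> {y, b}" "f \<noteq> {y, z}" "f \<noteq> {y, y}"
          using gD(5)[OF that(2)] loop fB unfolding A0_def A1_def by (auto simp: insert_commute)
        then show "f \<notin> (\<lambda>w. {y, w}) ` ({x, y, z} \<union> {b})" by blast
      qed
      then have "card {f \<in> P. g f = 4} \<le> card {f \<in> B. y \<in> f \<and> f \<notin> (\<lambda>w. {y, w}) ` ({x, y, z} \<union> {b})}"
        using finB by (intro card_mono) auto
      then show ?thesis using rest[of y b] abc 5 by simp
    next
      case 6
      have "f \<in> B \<and> z \<in> f \<and> f \<notin> (\<lambda>w. {z, w}) ` ({x, y, z} \<union> {c})" if "f \<in> P" "g f = 5" for f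
      proof (intro conjI)
        show fB: "f \<in> B" and "z \<in> f" using that gD(6) unfolding P_def by auto
        have "f \<noteq> {z, x}" "f \<noteq> {z, c}" "f \<noteq> {z, y}" "f \<noteq> {z, z}"
          using gD(6)[OF that(2)] loop fB unfolding A1_def A2_def by (auto simp: insert_commute)
        then show "f \<notin> (\<lambda>w. {z, w}) ` ({x, y, z} \<union> {c})" by blast
      qed
      then have "card {f \<in> P. g f = 5} \<le> card {f \<in> B. z \<in> f \<and> f \<notin> (\<lambda>w. {z, w}) ` ({x, y, z} \<union> {c})}"
        using finB by (intro card_mono) auto
      then show ?thesis using rest[of z c] abc 6 by simp
    qed
  qed
  then have le1: "card {f \<in> C \<inter> P. g f = i} \<le> 1" if "i < 6" for i
    using spec[OF all, of i] that by fastforce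
  have same: "f = f'" if "f \<in> C \<inter> P" "f' \<in> C \<inter> P" "g f = g f'" "g f < 6" for f f'
  proof -
    have "card {h \<in> C \<inter> P. g h = g f} \<le> Suc 0" using le1[OF that(4)] by simp
    then show ?thesis using that finC by (subst (asm) card_le_Suc0_iff_eq) auto
  qed
  obtain W where W: "card W = 4" "C = {e. e \<subseteq> W \<and> card e = 2}" using \<C>[OF C(1,2)] by blast
  have uC: "uniform 2 C" using uniform_subset[OF B(2) C(2)] .
  \<comment> \<open>Degree 3 in a copy of \<open>K_4\<close>, with at most one edge from each of two
    groups, forces the third edge \<open>e\<close>. Applied around the triangle, it lets each of
    \<open>x\<close>, \<open>y\<close>, \<open>z\<close> pull the next one into the copy.\<close>
  have step: "e \<in> C" if u: "u \<in> W"
    and cov: "{f \<in> C. u \<in> f} \<subseteq> {f \<in> C \<inter> P. g f = i} \<union> {f \<in> C \<inter> P. g f = j} \<union> (C \<inter> {e})"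
    and ij: "i < 6" "j < 6" for u i j e
  proof (rule ccontr)
    assume "e \<notin> C"
    then have "deg u C \<le> card ({f \<in> C \<inter> P. g f = i} \<union> {f \<in> C \<inter> P. g f = j})"
      unfolding deg_def using cov finC by (intro card_mono) auto
    also have "\<dots> \<le> 2" using card_Un_le[of "{f \<in> C \<inter> P. g f = i}" "{f \<in> C \<inter> P. g f = j}"] le1[OF ij(1)] le1[OF ij(2)] by linarith
    finally have "deg u C \<le> 2" .
    moreover have "{w. {u, w} \<in> C} = W - {u}" using u unfolding W(2) by (auto simp: card_2_iff doubleton_eq_iff)
    then have "deg u C = 3" using deg_conv_neighbours[OF uC, of u] W(1) u by simp
    ultimately show False by simp
  qed
  have memP: "f \<in> P" if "f \<in> C" "x \<in> f \<or> y \<in> f \<or> z \<in> f" for f using that C(2) unfolding P_def by auto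
  have two: "f = {u, v}" if "f \<in> C" "u \<in> f" "v \<in> f" "u \<noteq> v" for f u v
    using that W(2) by (auto simp: card_2_iff doubleton_eq_iff)
  have nA: "f \<notin> A1" if "f \<in> C" "x \<in> f" for f
    using that xyz abc_ne unfolding A1_def by auto
  have nA': "f \<notin> A2" if "f \<in> C" "y \<in> f" for f
    using that xyz abc_ne unfolding A2_def by auto
  have nA'': "f \<notin> A0" if "f \<in> C" "z \<in> f" for f
    using that xyz abc_ne unfolding A0_def by auto
  have gx: "g f = 0 \<or> g f = 3 \<or> f = {z, x}" if "f \<in> C" "x \<in> f" for f
  proof (cases "f \<in> A2")
    case True
    then show ?thesis using that abc_ne xyz unfolding A2_def by auto
  next
    case False
    then show ?thesis using nA[OF that] that(2) unfolding g_def by simp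
  qed
  have gy: "g f = 1 \<or> g f = 4 \<or> f = {x, y}" if "f \<in> C" "y \<in> f" for f
  proof (cases "f \<in> A0 \<or> x \<in> f")
    case True
    then show ?thesis using that abc_ne xyz two[OF that(1), of x y] unfolding A0_def by auto
  next
    case False
    then show ?thesis using nA'[OF that] that(2) unfolding g_def by simp
  qed
  have gz: "g f = 2 \<or> g f = 5 \<or> f = {y, z}" if "f \<in> C" "z \<in> f" for f
  proof (cases "f \<in> A1 \<or> y \<in> f")
    case True
    then show ?thesis using that abc_ne xyz two[OF that(1), of y z] unfolding A1_def by auto
  next
    case False
    then have "x \<in> f \<Longrightarrow> f \<in> A2" using two[OF that(1), of x z] that(2) xyz unfolding A2_def by auto
    then show ?thesis using nA''[OF that] that(2) False unfolding g_def by auto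
  qed
  have xz: "{z, x} \<in> C" if "x \<in> W" by (rule step[OF that, of 0 3]) (use gx memP in auto)
  have yx: "{x, y} \<in> C" if "y \<in> W" by (rule step[OF that, of 1 4]) (use gy memP in auto)
  have zy: "{y, z} \<in> C" if "z \<in> W" by (rule step[OF that, of 2 5]) (use gz memP in auto)
  have "x \<in> W \<or> y \<in> W \<or> z \<in> W" using C(3) W(2) unfolding P_def by blast
  then have xyzW: "x \<in> W" "y \<in> W" "z \<in> W" using xz yx zy W(2) by auto
  have finW: "finite W" using W(1) by (intro card_ge_0_finite) simp
  have "card (W - {x, y, z}) = 1" using W(1) xyzW xyz finW by (simp add: card_Diff_subset)
  then obtain w where w: "W - {x, y, z} = {w}" by (auto simp: card_1_singleton_iff)
  have wW: "w \<in> W" "w \<notin> {x, y, z}" using w by auto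
  have inC: "{u, v} \<in> C" if "u \<in> W" "v \<in> W" "u \<noteq> v" for u v using that W(2) by auto
  \<comment> \<open>The fourth vertex is a common neighbour of the triangle, hence one of
    \<open>a\<close>, \<open>b\<close>, \<open>c\<close>; each choice puts two equally coloured
    edges into the copy.\<close>
  have "w \<in> Q" unfolding Q_def N_def using wW xyzW inC C(2) by auto
  then consider "w = a" | "w = b" | "w = c" using abc(4) by auto
  then show False
  proof cases
    case 1
    have "{x, y} \<in> C" "{x, w} \<in> C" using inC xyzW wW xyz by auto
    moreover have "{x, y} \<in> A0" "{x, w} \<in> A0" unfolding A0_def 1 by auto
    ultimately have "{x, y} = {x, w}" using memP by (intro same) (auto simp: g_def)
    then show False using wW by (auto simp: doubleton_eq_iff)
  next
    case 2
    have "{y, z} \<in> C" "{y, w} \<in> C" using inC xyzW wW xyz by auto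
    moreover have "{y, z} \<in> A1" "{y, w} \<in> A1" "{y, z} \<notin> A0" "{y, w} \<notin> A0"
      using xyz abc_ne wW unfolding A0_def A1_def 2 by (auto simp: doubleton_eq_iff)
    ultimately have "{y, z} = {y, w}" using memP by (intro same) (auto simp: g_def)
    then show False using wW by (auto simp: doubleton_eq_iff)
  next
    case 3
    have "{z, x} \<in> C" "{z, w} \<in> C" using inC xyzW wW xyz by auto
    moreover have "{z, x} \<in> A2" "{z, w} \<in> A2" "{z, x} \<notin> A0" "{z, w} \<notin> A0" "{z, x} \<notin> A1" "{z, w} \<notin> A1"
      using xyz abc_ne wW unfolding A0_def A1_def A2_def 3 by (auto simp: doubleton_eq_iff)
    ultimately have "{z, x} = {z, w}" using memP by (intro same) (auto simp: g_def)
    then show False using wW by (auto simp: doubleton_eq_iff)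
  qed
qed

text \<open>A discharging argument: the average degree is at most 11/2, the vertices of degree 5
  form an independent set \<open>S\<close>, and counting edges between \<open>S\<close> and the rest
  \<open>T\<close> shows that the degrees in \<open>T\<close> are too large.\<close>

lemma no_sparse_graph:
  assumes B: "uniform 2 B" "B \<noteq> {}" "4 * card B \<le> 11 * card (\<Union>B)" "\<And>x. x \<in> \<Union>B \<Longrightarrow> 5 \<le> deg x B"
    and adj: "\<And>x y. {x, y} \<in> B \<Longrightarrow> \<not> (deg x B = 5 \<and> deg y B = 5)"
    and path: "\<And>x y z. {x, z} \<in> B \<Longrightarrow> {y, z} \<in> B \<Longrightarrow> x \<noteq> y \<Longrightarrow> deg x B = 5 \<Longrightarrow> deg y B = 5 \<Longrightarrow> 7 \<le> deg z B"
  shows False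
proof -
  define X where "X = \<Union>B"
  define S where "S = {x \<in> X. deg x B = 5}"
  define T where "T = X - S"
  have finX: "finite X" using uniform_finite_Union[OF B(1)] unfolding X_def .
  have fin: "finite S" "finite T" using finX unfolding S_def T_def by auto
  have ST: "X = S \<union> T" "S \<inter> T = {}" unfolding S_def T_def by auto
  have sum_X: "(\<Sum>x\<in>X. deg x B) = 2 * card B" using sum_deg_uniform[OF B(1)] unfolding X_def .
  have split: "(\<Sum>x\<in>X. deg x B) = (\<Sum>x\<in>S. deg x B) + (\<Sum>x\<in>T. deg x B)"
    unfolding ST(1) using fin ST(2) by (rule sum.union_disjoint)
  have sum_S: "(\<Sum>x\<in>S. deg x B) = 5 * card S" unfolding S_def by simp
  have cX: "card X = card S + card T" unfolding ST(1) using fin ST(2) by (rule card_Un_disjoint)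
  have nb: "{y. {x, y} \<in> B} = {y \<in> T. {x, y} \<in> B}" if "x \<in> S" for x
    using that adj unfolding S_def T_def X_def by blast
  have "5 * card S = (\<Sum>x\<in>S. card {y \<in> T. {x, y} \<in> B})"
    unfolding sum_S[symmetric] by (intro sum.cong refl) (simp add: deg_conv_neighbours[OF B(1)] nb)
  also have "\<dots> = (\<Sum>x\<in>S. \<Sum>y\<in>T. if {x, y} \<in> B then 1 else 0)"
    using fin by (intro sum.cong refl) (simp add: sum.If_cases Int_def)
  also have "\<dots> = (\<Sum>y\<in>T. \<Sum>x\<in>S. if {x, y} \<in> B then 1 else 0)" by (rule sum.swap)
  also have "\<dots> = (\<Sum>y\<in>T. card {x \<in> S. {x, y} \<in> B})"
    using fin by (intro sum.cong refl) (simp add: sum.If_cases Int_def)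
  finally have count: "5 * card S = (\<Sum>y\<in>T. card {x \<in> S. {x, y} \<in> B})" .
  have T6: "6 \<le> deg y B" if "y \<in> T" for y
  proof -
    have "y \<in> \<Union>B" "deg y B \<noteq> 5" using that unfolding T_def S_def X_def by auto
    then show ?thesis using B(4)[of y] by linarith
  qed
  \<comment> \<open>The weights come from the average: with \<open>d\<close> the degree sum over
    \<open>T\<close>, the bound \<open>2 * d \<le> card S + 11 * card T\<close> tripled has
    \<open>33 * card T\<close> on the right. Degree 6 gives \<open>1 + 33 \<le> 36\<close>, and
    degree at least 7 gives \<open>deg y B + 33 \<le> 6 * deg y B\<close>.\<close>
  have pt: "card {x \<in> S. {x, y} \<in> B} + 33 \<le> 6 * deg y B" if "y \<in> T" for y
  proof (cases "deg y B = 6")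
    case True
    have "card {x \<in> S. {x, y} \<in> B} \<le> Suc 0"
    proof (subst card_le_Suc0_iff_eq)
      show "finite {x \<in> S. {x, y} \<in> B}" using fin by simp
      show "\<forall>a\<in>{x \<in> S. {x, y} \<in> B}. \<forall>b\<in>{x \<in> S. {x, y} \<in> B}. a = b"
        using path[of _ y] True unfolding S_def by fastforce
    qed
    then show ?thesis using True by simp
  next
    case False
    have "{x \<in> S. {x, y} \<in> B} \<subseteq> {x. {y, x} \<in> B}" by (auto simp: insert_commute)
    then have "card {x \<in> S. {x, y} \<in> B} \<le> deg y B"
      unfolding deg_conv_neighbours[OF B(1)] by (intro card_mono finite_neighbours[OF B(1)])
    then show ?thesis using T6[OF that] False by linarith
  qed
  have "5 * card S + 33 * card T = (\<Sum>y\<in>T. card {x \<in> S. {x, y} \<in> B} + 33)"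
    unfolding count by (simp add: sum.distrib)
  also have "\<dots> \<le> (\<Sum>y\<in>T. 6 * deg y B)" by (rule sum_mono) (rule pt)
  also have "\<dots> = 6 * (\<Sum>y\<in>T. deg y B)" by (simp add: sum_distrib_left)
  finally have 1: "5 * card S + 33 * card T \<le> 6 * (\<Sum>y\<in>T. deg y B)" .
  have 2: "2 * card B = 5 * card S + (\<Sum>y\<in>T. deg y B)" using sum_X split sum_S by linarith
  have 3: "6 * card T \<le> (\<Sum>y\<in>T. deg y B)" using sum_mono[of T "\<lambda>_. 6" "\<lambda>y. deg y B"] T6 by simp
  have 4: "4 * card B \<le> 11 * (card S + card T)" using B(3) cX unfolding X_def by simp
  have ST0: "s = 0 \<and> t = 0"
    if "5 * s + 33 * t \<le> 6 * d" "2 * e = 5 * s + d" "6 * t \<le> d" "4 * e \<le> 11 * (s + t)" for s t d e :: nat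
  proof -
    have "4 * e = 10 * s + 2 * d" using that(2) by simp
    then have "2 * d \<le> s + 11 * t" using that(4) by simp
    then have "s = 0" "12 * t \<le> s + 11 * t" using that(1,3) by linarith+
    then show ?thesis by simp
  qed
  have "card S = 0 \<and> card T = 0" using ST0[OF 1 2 3 4] .
  then have "X = {}" using cX finX by simp
  then have "B \<subseteq> {{}}" unfolding X_def by auto
  then show False using B(1,2) unfolding uniform_def by (metis card.empty subset_singletonD singletonI zero_neq_numeral)
qed

text \<open>Deleting \<open>u\<close> leaves a strictly sparser subgraph, so more than
  \<open>m\<close> edges are lost. One vertex beyond \<open>l + 1\<close> is required for the rest
  still to be subject to balancedness.\<close>

lemma deg_gt_balanced:
  assumes finV: "finite V" and E: "\<And>e. e \<in> E \<Longrightarrow> e \<subseteq> V \<and> card e = l" and lV: "l + 2 \<le> card V"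
    and m_eq: "real (card E) - 1 = m * (real (card V) - real l)"
    and bal: "\<And>U J. U \<subseteq> V \<Longrightarrow> J \<subseteq> E \<Longrightarrow> \<Union>J \<subseteq> U \<Longrightarrow> l + 1 \<le> card U \<Longrightarrow> (U, J) \<noteq> (V, E) \<Longrightarrow>
      real (card J) - 1 < m * (real (card U) - real l)"
    and u: "u \<in> V"
  shows "m < real (deg u E)"
proof -
  have finE: "finite E" using E finV by (intro finite_subset[of E "Pow V"]) auto
  have c: "card (V - {u}) = card V - 1" using u by (rule card_Diff_singleton)
  have "real (card {e \<in> E. u \<notin> e}) - 1 < m * (real (card (V - {u})) - real l)"
    using u lV E c by (intro bal) auto
  also have "real (card (V - {u})) = real (card V) - 1" using c lV by (simp add: of_nat_diff)
  finally have "real (card {e \<in> E. u \<notin> e}) - 1 < m * (real (card V) - real l) - m" by (simp add: algebra_simps)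
  moreover have "real (card {e \<in> E. u \<notin> e}) = real (card E) - real (deg u E)"
    using card_delete[OF finE, of u] by linarith
  ultimately show ?thesis using m_eq by linarith
qed

text \<open>The degree sum 8 forces all degrees to be 2, and the two neighbours of \<open>a\<close>
  must also be those of the remaining vertex.\<close>

lemma isomorphic_cycle_4:
  assumes V: "card V = 4" and E: "card E = 4" "\<And>e. e \<in> E \<Longrightarrow> e \<subseteq> V \<and> card e = 2"
    and deg: "\<And>u. u \<in> V \<Longrightarrow> 2 \<le> deg u E"
  shows "isomorphic (HGraph V E) (cycle_graph 4)"
proof -
  have finV: "finite V" using V by (intro card_ge_0_finite) simp
  have finE: "finite E" using E(1) by (intro card_ge_0_finite) simp
  have uE: "uniform 2 E" unfolding uniform_def using finE E(2) finV finite_subset by blast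
  have "(\<Sum>u\<in>V. deg u E) = 2 * card E" using sum_deg[OF finV finE, of 2] E(2) by blast
  then have "(\<Sum>u\<in>V. 2) = (\<Sum>u\<in>V. deg u E)" using V E(1) by simp
  then have deg2: "deg u E = 2" if "u \<in> V" for u
    using sum_mono_inv[of "\<lambda>_. 2" V "\<lambda>u. deg u E" u] deg that finV by simp
  have inV: "u \<in> V \<and> w \<in> V" if "{u, w} \<in> E" for u w using E(2)[OF that] by simp
  obtain a where a: "a \<in> V" using V by force
  have "card {w. {a, w} \<in> E} = 2" using deg2[OF a] deg_conv_neighbours[OF uE] by simp
  then obtain b d where bd: "{w. {a, w} \<in> E} = {b, d}" "b \<noteq> d" by (auto simp: card_2_iff)
  have abd: "{a, b} \<in> E" "{a, d} \<in> E" using bd by auto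
  have ne: "a \<noteq> b" "a \<noteq> d" using abd edge_neq[OF uE] by auto
  have bdV: "b \<in> V" "d \<in> V" using abd inV by blast+
  have "card (V - {a, b, d}) = 1" using V a bdV ne bd(2) finV by (simp add: card_Diff_subset)
  then obtain c where c: "V - {a, b, d} = {c}" by (auto simp: card_1_singleton_iff)
  have cV: "c \<in> V" "c \<noteq> a" "c \<noteq> b" "c \<noteq> d" using c by auto
  have "{w. {c, w} \<in> E} \<subseteq> {b, d}"
  proof
    fix w assume w: "w \<in> {w. {c, w} \<in> E}"
    then have "w \<in> V" "w \<noteq> c" using inV edge_neq[OF uE] by auto
    moreover have "w \<noteq> a"
    proof
      assume "w = a"
      then have "c \<in> {w. {a, w} \<in> E}" using w by (simp add: insert_commute)
      then show False using bd cV by auto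
    qed
    ultimately show "w \<in> {b, d}" using c by auto
  qed
  moreover have "card {w. {c, w} \<in> E} = card {b, d}"
    using deg2[OF cV(1)] deg_conv_neighbours[OF uE] bd(2) by simp
  ultimately have "{w. {c, w} \<in> E} = {b, d}" by (intro card_subset_eq) auto
  then have cbd: "{c, b} \<in> E" "{c, d} \<in> E" by blast+
  have "{{a, b}, {b, c}, {c, d}, {d, a}} = E"
  proof (rule card_subset_eq[OF finE])
    show "{{a, b}, {b, c}, {c, d}, {d, a}} \<subseteq> E" using abd cbd by (auto simp: insert_commute)
    show "card {{a, b}, {b, c}, {c, d}, {d, a}} = card E"
      using E(1) ne bd(2) cV by (auto simp: doubleton_eq_iff card_insert_if)
  qed
  then have Eeq: "E = {{a, b}, {b, c}, {c, d}, {d, a}}" by simp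
  have Veq: "V = {a, b, c, d}" using c a bdV by auto
  define h :: "'a \<Rightarrow> nat" where "h = (\<lambda>u. if u = a then 0 else if u = b then 1 else if u = c then 2 else 3)"
  have h: "h a = 0" "h b = 1" "h c = 2" "h d = 3" unfolding h_def using ne bd(2) cV by auto
  have bij: "bij_betw h V {0, 1, 2, 3}"
    unfolding bij_betw_def Veq by (auto simp: inj_on_def h)
  have lt4: "{..<4} = {0, 1, 2, 3 :: nat}"
  proof (rule set_eqI)
    fix x :: nat
    show "x \<in> {..<4} \<longleftrightarrow> x \<in> {0, 1, 2, 3}" unfolding lessThan_iff insert_iff empty_iff by presburger
  qed
  have bij': "bij_betw h V {..<4}" unfolding lt4 by (rule bij)
  have mods: "Suc 0 mod 4 = (1 :: nat)" "Suc 1 mod 4 = (2 :: nat)" "Suc 2 mod 4 = (3 :: nat)" "Suc 3 mod 4 = (0 :: nat)"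
    by presburger+
  have cyc: "(\<lambda>i. {i, Suc i mod 4}) ` {..<4 :: nat} = {{0, 1}, {1, 2}, {2, 3}, {3, 0}}"
    unfolding lt4 image_insert image_empty mods ..
  have img: "(\<lambda>e. h ` e) ` E = {{0, 1}, {1, 2}, {2, 3}, {3, 0}}"
    unfolding Eeq image_insert image_empty h ..
  have vc: "verts (cycle_graph 4) = {..<4}" "verts (HGraph V E) = V" "edges (HGraph V E) = E"
    unfolding cycle_graph_def by simp_all
  have "edges (cycle_graph 4) = (\<lambda>i. {i, Suc i mod 4}) ` {..<4}"
    unfolding cycle_graph_def by simp
  also have "\<dots> = (\<lambda>e. h ` e) ` E" unfolding cyc img ..
  finally have ed: "edges (cycle_graph 4) = (\<lambda>e. h ` e) ` E" .
  show ?thesis unfolding isomorphic_def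
  proof (intro exI[of _ h] conjI)
    show "bij_betw h (verts (HGraph V E)) (verts (cycle_graph 4))" unfolding vc by (rule bij')
    show "edges (cycle_graph 4) = (\<lambda>e. h ` e) ` edges (HGraph V E)" unfolding vc by (rule ed)
  qed
qed

lemma copy_degree:
  assumes "C \<in> copies V E" "E \<subseteq> Pow V" "x \<in> \<Union>C"
  obtains \<phi> u where "inj_on \<phi> V" "C = (\<lambda>e. \<phi> ` e) ` E" "u \<in> V" "x = \<phi> u" "deg x C = deg u E"
proof -
  obtain \<phi> where \<phi>: "inj_on \<phi> V" "C = (\<lambda>e. \<phi> ` e) ` E" using assms(1) by (rule copiesE)
  then obtain u where u: "u \<in> V" "x = \<phi> u" using assms(2,3) by blast
  then show thesis using that[OF \<phi> u] deg_copy[OF \<phi>(1) assms(2) u(1)] \<phi>(2) by simp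
qed

text \<open>Two inequalities in the minimum degree \<open>\<delta>\<close> decide. A minimal
  uncolourable \<open>B0\<close> has minimum degree at least \<open>2 * \<delta> - 1\<close>, whence
  \<open>2 * \<delta> - 1 \<le> 2 * m\<close>; failure of the orientation colouring gives
  \<open>e \<le> v * ((\<delta> + 1) div 2)\<close>. They leave only \<open>C_4\<close> for
  \<open>\<delta> = 2\<close>, nothing for \<open>\<delta> \<ge> 4\<close>, and a few dense graphs
  for \<open>\<delta> = 3\<close> that need special colourings.\<close>

theorem graph_colourable:
  fixes V :: "'a set" and E :: "'a set set" and B :: "'b set set" and m :: real
  assumes finV: "finite V" and E: "\<And>e. e \<in> E \<Longrightarrow> e \<subseteq> V \<and> card e = 2" and V4: "4 \<le> card V"
    and m: "m = (real (card E) - 1) / (real (card V) - 2)" "1 < m"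
    and bal: "\<And>U J. U \<subseteq> V \<Longrightarrow> J \<subseteq> E \<Longrightarrow> \<Union>J \<subseteq> U \<Longrightarrow> 3 \<le> card U \<Longrightarrow> (U, J) \<noteq> (V, E) \<Longrightarrow>
      real (card J) - 1 < m * (real (card U) - 2)"
    and notC4: "\<not> isomorphic (HGraph V E) (cycle_graph 4)"
    and B: "uniform 2 B" and dens: "\<And>D. D \<subseteq> B \<Longrightarrow> real (card D) \<le> m * real (card (\<Union>D))"
  shows "colourable (copies V E) B"
proof (rule ccontr)
  assume bad: "\<not> ?thesis"
  let ?v = "card V" and ?e = "card E"
  have EP: "E \<subseteq> Pow V" using E by blast
  have finE: "finite E" using EP finV by (meson finite_Pow_iff finite_subset)
  have uE: "uniform 2 E" unfolding uniform_def using finE E finV finite_subset by blast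
  have me: "real ?e - 1 = m * (real ?v - 2)" using m(1) V4 by simp
  have deg_m: "m < real (deg u E)" if u: "u \<in> V" for u
  proof (rule deg_gt_balanced[OF finV E _ _ _ u])
    show "2 + 2 \<le> card V" using V4 by simp
    show "real ?e - 1 = m * (real ?v - real 2)" using me by simp
    show "real (card J) - 1 < m * (real (card U) - real 2)"
      if "U \<subseteq> V" "J \<subseteq> E" "\<Union>J \<subseteq> U" "2 + 1 \<le> card U" "(U, J) \<noteq> (V, E)" for U J
      using bal[OF that(1,2,3) _ that(5)] that(4) by simp
  qed
  have UE: "\<Union>E = V"
  proof
    show "V \<subseteq> \<Union>E"
    proof
      fix u assume "u \<in> V"
      then have "deg u E \<noteq> 0" using deg_m[of u] m(2) by auto
      then show "u \<in> \<Union>E" unfolding deg_def by (auto simp: card_eq_0_iff)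
    qed
  qed (use EP in blast)
  define \<delta> where "\<delta> = Min ((\<lambda>u. deg u E) ` V)"
  have V_ne: "V \<noteq> {}" using V4 by auto
  have \<delta>_le: "\<delta> \<le> deg u E" if "u \<in> V" for u unfolding \<delta>_def using that finV by simp
  have "\<delta> \<in> (\<lambda>u. deg u E) ` V" unfolding \<delta>_def using finV V_ne by (intro Min_in) auto
  then obtain u0 where u0: "u0 \<in> V" "deg u0 E = \<delta>" by auto
  have m\<delta>: "m < real \<delta>" using deg_m[OF u0(1)] u0(2) by simp
  have \<delta>2: "2 \<le> \<delta>" using m\<delta> m(2) by linarith
  have \<delta>v: "\<delta> + 1 \<le> ?v"
  proof -
    have "{w. {u0, w} \<in> E} \<subseteq> V - {u0}" 
    proof
      fix w assume "w \<in> {w. {u0, w} \<in> E}"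
      then have w: "{u0, w} \<in> E" by simp
      show "w \<in> V - {u0}" using E[OF w] edge_neq[OF uE w] by auto
    qed
    then have "deg u0 E \<le> card (V - {u0})"
      unfolding deg_conv_neighbours[OF uE] using finV by (intro card_mono) auto
    then show ?thesis using u0 card_Diff_singleton[OF u0(1)] V4 by linarith
  qed
  have sumE: "\<delta> * ?v \<le> 2 * ?e"
  proof -
    have "(\<Sum>u\<in>V. \<delta>) \<le> (\<Sum>u\<in>V. deg u E)" by (rule sum_mono) (rule \<delta>_le)
    then show ?thesis using sum_deg_uniform[OF uE] UE by (simp add: mult.commute)
  qed
  define \<C> where "\<C> = (copies V E :: 'b set set set)"
  have degC: "\<delta> \<le> deg x C" if C: "C \<in> \<C>" "x \<in> \<Union>C" for C x
  proof -
    obtain \<phi> u where "inj_on \<phi> V" "C = (\<lambda>e. \<phi> ` e) ` E" and u: "u \<in> V" "x = \<phi> u" "deg x C = deg u E"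
      using copy_degree[OF C(1)[unfolded \<C>_def] EP C(2)] .
    show ?thesis unfolding u(3) by (rule \<delta>_le[OF u(1)])
  qed
  have cardC: "card C = ?e" "card (\<Union>C) = ?v" if C: "C \<in> \<C>" for C
  proof -
    obtain \<phi> where \<phi>: "inj_on \<phi> V" "C = (\<lambda>e. \<phi> ` e) ` E" using C unfolding \<C>_def by (rule copiesE)
    show "card C = ?e" unfolding \<phi>(2) by (rule card_copy[OF \<phi>(1) EP])
    show "card (\<Union>C) = ?v" unfolding \<phi>(2) card_Union_copy[OF \<phi>(1) EP] UE ..
  qed
  have "finite B" using B by (simp add: uniform_def)
  then obtain B0 where B0: "B0 \<subseteq> B" "minimal_uncolourable \<C> B0"
    using ex_minimal_uncolourable[OF _ bad] unfolding \<C>_def by blast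
  have u0B: "uniform 2 B0" using uniform_subset[OF B B0(1)] .
  then have finB0: "finite B0" by (simp add: uniform_def)
  obtain C0 where C0: "C0 \<in> \<C>" "C0 \<subseteq> B0" using minimal_uncolourable_has_copy[OF B0(2) finB0] by blast
  have B0_ne: "B0 \<noteq> {}"
  proof
    assume "B0 = {}"
    then show False using C0 cardC(1)[OF C0(1)] sumE \<delta>2 V4 by simp
  qed
  have degB0: "2 * \<delta> \<le> deg x B0 + 1" if "x \<in> \<Union>B0" for x
    using minimal_uncolourable_deg[OF B0(2) finB0 that] degC by blast
  define X where "X = \<Union>B0"
  have finX: "finite X" unfolding X_def using uniform_finite_Union[OF u0B] .
  have X_ne: "0 < card X"
  proof -
    obtain f where f: "f \<in> B0" using B0_ne by blast
    then have "f \<noteq> {}" using u0B by (auto simp: uniform_def)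
    then have "X \<noteq> {}" using f unfolding X_def by blast
    then show ?thesis using finX by (simp add: card_gt_0_iff)
  qed
  have sumX: "(\<Sum>x\<in>X. deg x B0) = 2 * card B0" using sum_deg_uniform[OF u0B] unfolding X_def .
  have densX: "real (card B0) \<le> m * real (card X)" using dens[OF B0(1)] unfolding X_def .
  have lower: "2 * real \<delta> - 1 \<le> 2 * m"
  proof -
    have "real (\<Sum>x\<in>X. 2 * \<delta> - 1) \<le> real (\<Sum>x\<in>X. deg x B0)"
      using degB0 unfolding X_def by (intro of_nat_mono sum_mono) (simp add: le_diff_conv)
    then have "(2 * real \<delta> - 1) * real (card X) \<le> 2 * real (card B0)"
      using \<delta>2 unfolding sumX by (simp add: of_nat_diff mult.commute)
    also have "\<dots> \<le> (2 * m) * real (card X)" using densX by simp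
    finally show ?thesis using X_ne by simp
  qed
  have upper: "?e \<le> ?v * ((\<delta> + 1) div 2)"
  proof (rule ccontr)
    assume "\<not> ?thesis"
    then have gt: "?v * ((\<delta> + 1) div 2) < ?e" by simp
    \<comment> \<open>Since \<open>m < \<delta>\<close>, outdegree \<open>\<delta>\<close> is
      available for the orientation.\<close>
    have "colourable \<C> B0"
    proof (rule colourable_if_sparse[OF u0B, of \<delta>])
      fix D assume "D \<subseteq> B0"
      then have "real (card D) \<le> m * real (card (\<Union>D))" using dens B0(1) by blast
      also have "\<dots> \<le> real \<delta> * real (card (\<Union>D))" using m\<delta> by (intro mult_right_mono) auto
      finally have "real (card D) \<le> real (\<delta> * card (\<Union>D))" unfolding of_nat_mult .
      then show "card D \<le> \<delta> * card (\<Union>D)" by (simp only: of_nat_le_iff)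
    next
      fix C assume "C \<in> \<C>"
      then show "card (\<Union>C) * ((\<delta> + 1) div 2) < card C" using gt cardC by simp
    qed
    then show False using B0(2) by (simp add: minimal_uncolourable_def)
  qed
  have lower': "(2 * real \<delta> - 1) * (real ?v - 2) \<le> 2 * (real ?e - 1)"
  proof -
    have "(2 * real \<delta> - 1) * (real ?v - 2) \<le> 2 * m * (real ?v - 2)"
      using lower V4 by (intro mult_right_mono) auto
    then show ?thesis using me by simp
  qed
  consider "\<delta> = 2" | "\<delta> = 3" | "\<delta> = 4" | "5 \<le> \<delta>" using \<delta>2 by linarith
  then show False
  proof cases
    case 1
    then have ub: "real ?e \<le> real ?v" using upper by simp
    have lb: "3 * real ?v \<le> 2 * real ?e + 4" using lower' 1 by (simp add: algebra_simps)
    then have "real ?v \<le> 4" using ub by linarith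
    then have v4: "?v = 4" using V4 by simp
    then have "real ?e = 4" using ub lb by simp
    then have e4: "?e = 4" by simp
    have d2: "2 \<le> deg u E" if "u \<in> V" for u using \<delta>_le[OF that] 1 by simp
    show False using isomorphic_cycle_4[OF v4 e4 E d2] notC4 by simp
  next
    \<comment> \<open>Here \<open>\<delta> = 4\<close>: the bounds force at most four vertices,
      whereas degree 4 needs five.\<close>
    case 3
    then have "real ?e \<le> 2 * real ?v" using upper by simp
    moreover have "7 * real ?v \<le> 2 * real ?e + 12" using lower' 3 by (simp add: algebra_simps)
    ultimately show False using \<delta>v 3 by linarith
  next
    case 4
    have "2 * ?e \<le> ?v * (\<delta> + 1)"
    proof -
      have "2 * ?e \<le> ?v * (2 * ((\<delta> + 1) div 2))" using upper by simp
      also have "\<dots> \<le> ?v * (\<delta> + 1)" by (intro mult_le_mono2) simp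
      finally show ?thesis .
    qed
    then have "real (2 * ?e) \<le> real (?v * (\<delta> + 1))" by (simp only: of_nat_le_iff)
    then have "2 * real ?e \<le> real ?v * (real \<delta> + 1)" by (simp add: algebra_simps)
    then have "(2 * real \<delta> - 1) * (real ?v - 2) \<le> real ?v * (real \<delta> + 1) - 2"
      using lower' by (simp add: algebra_simps)
    then have "real ?v * (real \<delta> - 2) \<le> 4 * (real \<delta> - 1)" by (simp add: algebra_simps)
    moreover have "6 * (real \<delta> - 2) \<le> real ?v * (real \<delta> - 2)"
      using \<delta>v 4 by (intro mult_right_mono) auto
    ultimately have "6 * (real \<delta> - 2) \<le> 4 * (real \<delta> - 1)" by linarith
    then have "real \<delta> \<le> 4" by (simp add: algebra_simps)
    then show False using 4 by simp
  next
    case 2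
    have ub: "real ?e \<le> 2 * real ?v" using upper 2 by simp
    have m52: "5 / 2 \<le> m" using lower 2 by simp
    have deg5: "5 \<le> deg x B0" if "x \<in> \<Union>B0" for x using degB0[OF that] 2 by simp
    have lb: "5 * real ?v \<le> 2 * real ?e + 8" using lower' 2 by (simp add: algebra_simps)
    show False
    proof (cases "?v = 4")
      \<comment> \<open>On four vertices the lower bound forces all six edges, so
        \<open>m = 5/2\<close>; minimum degree 5 and average degree at most 5 then make
        \<open>B0\<close> 5-regular.\<close>
      case True
      have eq: "E = {e. e \<subseteq> V \<and> card e = 2}"
      proof (rule card_seteq)
        show "finite {e. e \<subseteq> V \<and> card e = 2}" using finV by simp
        show "E \<subseteq> {e. e \<subseteq> V \<and> card e = 2}" using E by blast
        have "card {e. e \<subseteq> V \<and> card e = 2} = 6" using n_subsets[OF finV, of 2] True by (simp add: choose_two)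
        then show "card {e. e \<subseteq> V \<and> card e = 2} \<le> card E" using lb True by simp
      qed
      then have "?e = 6" using n_subsets[OF finV, of 2] True by (simp add: choose_two)
      then have m52: "m = 5 / 2" using me True by simp
      have "2 * real (card B0) \<le> 5 * real (card X)" using densX unfolding m52 by simp
      then have le: "(\<Sum>x\<in>X. deg x B0) \<le> (\<Sum>x\<in>X. 5)" using sumX by simp
      have ge: "5 \<le> deg x B0" if "x \<in> X" for x using deg5 that unfolding X_def by blast
      have "(\<Sum>x\<in>X. 5) \<le> (\<Sum>x\<in>X. deg x B0)" by (rule sum_mono) (rule ge)
      then have sum_eq: "(\<Sum>x\<in>X. 5) = (\<Sum>x\<in>X. deg x B0)" using le by (rule le_antisym)
      have reg: "deg x B0 = 5" if "x \<in> \<Union>B0" for x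
        using sum_mono_inv[OF sum_eq ge _ finX, of x] that unfolding X_def by simp
      have K4: "\<exists>W. card W = 4 \<and> C = {e. e \<subseteq> W \<and> card e = 2}" if C: "C \<in> \<C>" for C
      proof -
        obtain \<phi> where \<phi>: "inj_on \<phi> V" "C = (\<lambda>e. \<phi> ` e) ` E" using C unfolding \<C>_def by (rule copiesE)
        have ci: "card (\<phi> ` a) = card a" if "a \<subseteq> V" for a
          using card_image[OF inj_on_subset[OF \<phi>(1) that]] .
        have "C = {e. e \<subseteq> \<phi> ` V \<and> card e = 2}"
        proof
          show "C \<subseteq> {e. e \<subseteq> \<phi> ` V \<and> card e = 2}"
          proof
            fix f assume "f \<in> C"
            then obtain a where a: "a \<in> E" "f = \<phi> ` a" unfolding \<phi>(2) by blast
            have aV: "a \<subseteq> V" "card a = 2" using E[OF a(1)] by simp_all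
            show "f \<in> {e. e \<subseteq> \<phi> ` V \<and> card e = 2}" using ci[OF aV(1)] aV(2) image_mono[OF aV(1)] a(2) by simp
          qed
          show "{e. e \<subseteq> \<phi> ` V \<and> card e = 2} \<subseteq> C"
          proof
            fix f assume f: "f \<in> {e. e \<subseteq> \<phi> ` V \<and> card e = 2}"
            then have "f \<subseteq> \<phi> ` V" by simp
            then obtain a where a: "a \<subseteq> V" "f = \<phi> ` a" by (rule subset_imageE)
            then have "a \<in> E" unfolding eq using f ci by simp
            then show "f \<in> C" unfolding \<phi>(2) a(2) by (rule imageI)
          qed
        qed
        moreover have "card (\<phi> ` V) = 4" using card_image[OF \<phi>(1)] True by simp
        ultimately show ?thesis by (intro exI[of _ "\<phi> ` V"] conjI)
      qed
      show False by (rule five_regular_colourable_K4[OF B0(2) u0B reg K4])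
    next
      case False
      then have v5: "5 \<le> ?v" using V4 by simp
      \<comment> \<open>This is \<open>m \<le> 11/4\<close>. From six vertices on it follows from
        \<open>e \<le> 2 * v\<close>; with five vertices, ten edges would give \<open>m = 3\<close>,
        against \<open>m < \<delta>\<close>.\<close>
      have "4 * real ?e + 18 \<le> 11 * real ?v"
      proof (cases "?v = 5")
        case True
        have "?e \<noteq> 10"
        proof
          assume e10: "?e = 10"
          have "real (\<delta> + 1) \<le> 4" using m\<delta> 2 by simp
          have "real ?e - 1 = 3 * m" using me True by simp
          then show False using e10 m\<delta> 2 by simp
        qed
        moreover have "?e \<le> 10" using ub True by simp
        ultimately have "?e \<le> 9" by simp
        then show ?thesis using True by simp
      next
        case False
        then show ?thesis using ub v5 by linarith
      qed
      then have "4 * m * (real ?v - 2) \<le> 11 * (real ?v - 2)" using me by (simp add: algebra_simps)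
      then have m114: "4 * m \<le> 11" by (rule mult_right_le_imp_le) (use V4 in simp)
      \<comment> \<open>Deleting two adjacent vertices of degree 3 loses only five edges, so
        balancedness would give \<open>2 * m < 5\<close>.\<close>
      have nonadj: "deg u E \<noteq> 3 \<or> deg w E \<noteq> 3" if uw: "{u, w} \<in> E" for u w
      proof (rule ccontr)
        assume "\<not> ?thesis"
        then have d: "deg u E = 3" "deg w E = 3" by auto
        have ne: "u \<noteq> w" and V: "u \<in> V" "w \<in> V" using edge_neq[OF uE uw] E[OF uw] by auto
        let ?J = "{e \<in> E. u \<notin> e \<and> w \<notin> e}"
        have "{e \<in> E. u \<in> e \<or> w \<in> e} = {e \<in> E. u \<in> e} \<union> ({e \<in> E. w \<in> e} - {{u, w}})"
        proof
          show "{e \<in> E. u \<in> e \<or> w \<in> e} \<subseteq> {e \<in> E. u \<in> e} \<union> ({e \<in> E. w \<in> e} - {{u, w}})"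
          proof
            fix e assume e: "e \<in> {e \<in> E. u \<in> e \<or> w \<in> e}"
            show "e \<in> {e \<in> E. u \<in> e} \<union> ({e \<in> E. w \<in> e} - {{u, w}})"
            proof (cases "u \<in> e")
              case True
              then show ?thesis using e by simp
            next
              case False
              then have "e \<noteq> {u, w}" by blast
              then show ?thesis using e False by simp
            qed
          qed
        qed blast
        then have "card {e \<in> E. u \<in> e \<or> w \<in> e} \<le> deg u E + card ({e \<in> E. w \<in> e} - {{u, w}})"
          unfolding deg_def by (simp add: card_Un_le)
        also have "card ({e \<in> E. w \<in> e} - {{u, w}}) = 2"
          using d(2) uw finE unfolding deg_def by (simp add: card_Diff_singleton)
        finally have c5: "card {e \<in> E. u \<in> e \<or> w \<in> e} \<le> 5" using d(1) by simp
        have "?J \<union> {e \<in> E. u \<in> e \<or> w \<in> e} = E" by blast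
        then have "?e \<le> card ?J + card {e \<in> E. u \<in> e \<or> w \<in> e}"
          using card_Un_le[of ?J "{e \<in> E. u \<in> e \<or> w \<in> e}"] by simp
        then have cJ: "real ?e \<le> real (card ?J) + 5" using c5 by linarith
        have cU: "card (V - {u, w}) = ?v - 2" using V ne finV by (simp add: card_Diff_subset)
        have "real (card ?J) - 1 < m * (real (card (V - {u, w})) - 2)"
        proof (rule bal)
          show "3 \<le> card (V - {u, w})" using cU v5 by simp
          show "(V - {u, w}, ?J) \<noteq> (V, E)"
          proof
            assume "(V - {u, w}, ?J) = (V, E)"
            then have "V - {u, w} = V" by (rule Pair_inject)
            then show False using V(1) by blast
          qed
          show "V - {u, w} \<subseteq> V" by blast
          show "?J \<subseteq> E" by blast
          show "\<Union>?J \<subseteq> V - {u, w}" using EP by blast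
        qed
        also have "real (card (V - {u, w})) - 2 = (real ?v - 2) - 2" using cU v5 by simp
        also have "m * ((real ?v - 2) - 2) = (real ?e - 1) - 2 * m" using me by (simp add: algebra_simps)
        finally show False using cJ m52 by linarith
      qed
      have degC3: "3 \<le> deg z C" if "C \<in> \<C>" "C \<subseteq> B0" "z \<in> \<Union>C" for C z
        using degC[OF that(1,3)] 2 by simp
      have nonadjC: "deg z C \<noteq> 3 \<or> deg w C \<noteq> 3" if C: "C \<in> \<C>" "C \<subseteq> B0" "{z, w} \<in> C" for C z w
      proof -
        obtain \<phi> where \<phi>: "inj_on \<phi> V" "C = (\<lambda>e. \<phi> ` e) ` E" using C(1) unfolding \<C>_def by (rule copiesE)
        then obtain e where e: "e \<in> E" "{z, w} = \<phi> ` e" using C(3) by blast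
        then have eV: "e \<subseteq> V" "card e = 2" using E by auto
        then obtain p q where pq: "e = {p, q}" by (auto simp: card_2_iff)
        then have V: "p \<in> V" "q \<in> V" using eV by auto
        have pqE: "{p, q} \<in> E" using e(1) pq by simp
        have dp: "deg (\<phi> p) C = deg p E" unfolding \<phi>(2) by (rule deg_copy[OF \<phi>(1) EP V(1)])
        have dq: "deg (\<phi> q) C = deg q E" unfolding \<phi>(2) by (rule deg_copy[OF \<phi>(1) EP V(2)])
        have d: "deg (\<phi> p) C \<noteq> 3 \<or> deg (\<phi> q) C \<noteq> 3" unfolding dp dq by (rule nonadj[OF pqE])
        have "{z, w} = {\<phi> p, \<phi> q}" using e(2) unfolding pq by simp
        then have "z = \<phi> p \<and> w = \<phi> q \<or> z = \<phi> q \<and> w = \<phi> p" unfolding doubleton_eq_iff .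
        then show ?thesis using d by (elim disjE conjE) simp_all
      qed
      have adj: "\<not> (deg x B0 = 5 \<and> deg y B0 = 5)" if "{x, y} \<in> B0" for x y
      proof
        assume d: "deg x B0 = 5 \<and> deg y B0 = 5"
        show False by (rule no_adjacent_deg_5[OF B0(2) u0B that _ _ degC3 nonadjC]) (use d in simp_all)
      qed
      have path: "7 \<le> deg z B0"
        if "{x, z} \<in> B0" "{y, z} \<in> B0" "x \<noteq> y" "deg x B0 = 5" "deg y B0 = 5" for x y z
      proof (rule ccontr)
        assume "\<not> ?thesis"
        then have z6: "deg z B0 \<le> 6" by simp
        have nxy: "{x, y} \<notin> B0" using adj that(4,5) by blast
        show False
          by (rule no_deg_6_between_deg_5[OF B0(2) u0B that(1,2,3) _ _ z6 nxy degC3 nonadjC]) (simp_all add: that(4,5))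
      qed
      have "4 * real (card B0) \<le> (4 * m) * real (card X)" using densX by simp
      also have "\<dots> \<le> 11 * real (card X)" using m114 by (intro mult_right_mono) auto
      finally have "4 * card B0 \<le> 11 * card (\<Union>B0)" unfolding X_def by linarith
      then show False by (rule no_sparse_graph[OF u0B B0_ne _ deg5 adj path])
    qed
  qed
qed

section \<open>Minimal uncolourable hypergraphs and templates\<close>

text \<open>Giving the two edges a common colour leaves a copy that meets them and is rainbow on
  them, so it contains exactly one.\<close>

lemma minimal_uncolourable_separates:
  assumes B: "minimal_uncolourable \<C> B" "finite B" and e: "e1 \<in> B" "e2 \<in> B" "e1 \<noteq> e2"
  shows "\<exists>C\<in>\<C>. C \<subseteq> B \<and> (e1 \<in> C) \<noteq> (e2 \<in> C)"
proof -
  have eq: "{e' \<in> {e1, e2}. (0 :: nat) = 0} = {e1, e2}" by auto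
  have "bounded_col {e1, e2} (\<lambda>_. 0 :: nat)"
    unfolding bounded_col_def eq using e(3) by simp
  then obtain C where C: "C \<in> \<C>" "C \<subseteq> B" "C \<inter> {e1, e2} \<noteq> {}" "inj_on (\<lambda>_. 0 :: nat) (C \<inter> {e1, e2})"
    using minimal_uncolourable_copy[OF B, of "{e1, e2}" "\<lambda>_. 0 :: nat"] e by auto
  have "\<not> (e1 \<in> C \<and> e2 \<in> C)" using inj_onD[OF C(4), of e1 e2] e(3) by auto
  then show ?thesis using C by auto
qed

text \<open>Otherwise good colourings of \<open>X\<close> and \<open>B - X\<close> with disjoint
  palettes would combine.\<close>

lemma minimal_uncolourable_connected:
  assumes B: "minimal_uncolourable \<C> B" "finite B" and X: "X \<subset> B" "X \<noteq> {}"
  shows "\<exists>C\<in>\<C>. C \<subseteq> B \<and> C \<inter> X \<noteq> {} \<and> \<not> C \<subseteq> X"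
proof (rule ccontr)
  assume none: "\<not> ?thesis"
  have "B - X \<subset> B" using X by blast
  then have "colourable \<C> X" "colourable \<C> (B - X)"
    using B(1) X(1) by (simp_all add: minimal_uncolourable_def)
  from this(1)[unfolded colourable_def] obtain col :: "'a set \<Rightarrow> nat"
    where col: "bounded_col X col" "\<forall>C\<in>\<C>. C \<subseteq> X \<longrightarrow> \<not> inj_on col C"
    by (elim exE conjE)
  have "colourable \<C> B"
  proof (rule colourable_extend[OF B(2) _ \<open>colourable \<C> (B - X)\<close> col(1)])
    show "X \<subseteq> B" using X by blast
    fix C assume C: "C \<in> \<C>" "C \<subseteq> B" "C \<inter> X \<noteq> {}"
    then have "C \<subseteq> X" using none by blast
    then show "\<not> inj_on col (C \<inter> X)" using col(2) C(1) by (simp add: Int_absorb2)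
  qed
  then show False using B(1) by (simp add: minimal_uncolourable_def)
qed

text \<open>What the exploration needs of \<open>F'\<close> in all cases. Four edges ensure that two
  remain when two are set aside; minimum degree 2 ensures that a copy minus an edge still covers all
  its vertices.\<close>

locale template =
  fixes V :: "'a set" and E :: "'a set set" and l :: nat and m :: real
  assumes finV: "finite V" and edge: "\<And>e. e \<in> E \<Longrightarrow> e \<subseteq> V \<and> card e = l"
    and l_pos: "1 \<le> l" and card_V: "l + 1 \<le> card V" and card_E: "4 \<le> card E"
    and deg2: "\<And>u. u \<in> V \<Longrightarrow> 2 \<le> deg u E"
    and m_eq: "real (card E) - 1 = m * (real (card V) - real l)"
    and balanced: "\<And>U J. U \<subseteq> V \<Longrightarrow> J \<subseteq> E \<Longrightarrow> \<Union>J \<subseteq> U \<Longrightarrow> l + 1 \<le> card U \<Longrightarrow> J \<noteq> E \<Longrightarrow>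
      real (card J) - 1 < m * (real (card U) - real l)"
begin

abbreviation "v \<equiv> card V"
abbreviation "e \<equiv> card E"

lemma EP: "E \<subseteq> Pow V" using edge by blast

lemma finE: "finite E" using EP finV by (meson finite_Pow_iff finite_subset)

lemma UE: "\<Union>E = V"
proof
  show "V \<subseteq> \<Union>E"
  proof
    fix u assume "u \<in> V"
    then have "deg u E \<noteq> 0" using deg2[of u] by auto
    then show "u \<in> \<Union>E" unfolding deg_def by (auto simp: card_eq_0_iff)
  qed
qed (use EP in blast)

definition \<C> :: "nat set set set" where "\<C> = copies V E"

lemma m_pos: "0 < m"
proof (rule ccontr)
  assume "\<not> 0 < m"
  then have "m * (real v - real l) \<le> 0" using card_V by (intro mult_nonpos_nonneg) auto
  then show False using m_eq card_E by simp
qed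

lemma balanced_le:
  assumes "U \<subseteq> V" "J \<subseteq> E" "\<Union>J \<subseteq> U" "l + 1 \<le> card U"
  shows "real (card J) - 1 \<le> m * (real (card U) - real l)"
proof (cases "J = E")
  case True
  then have "U = V" using assms UE by blast
  then show ?thesis using True m_eq by simp
next
  case False
  then show ?thesis using balanced[OF assms] by simp
qed

lemma copyE:
  assumes "C \<in> \<C>" obtains \<phi> where "inj_on \<phi> V" "C = (\<lambda>a. \<phi> ` a) ` E" "\<Union>C = \<phi> ` V"
proof -
  obtain \<phi> where \<phi>: "inj_on \<phi> V" "C = (\<lambda>a. \<phi> ` a) ` E" using assms unfolding \<C>_def by (rule copiesE)
  have "\<Union>C = \<phi> ` \<Union>E" unfolding \<phi>(2) by blast
  then show thesis using that \<phi> UE by simp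
qed

lemma copy_facts:
  assumes C: "C \<in> \<C>"
  shows "card C = e" "card (\<Union>C) = v" "finite C" "finite (\<Union>C)" "g \<in> C \<Longrightarrow> card g = l" "g \<in> C \<Longrightarrow> finite g"
    "y \<in> \<Union>C \<Longrightarrow> \<exists>g'\<in>C. g' \<noteq> h \<and> y \<in> g'"
proof -
  obtain \<phi> where \<phi>: "inj_on \<phi> V" "C = (\<lambda>a. \<phi> ` a) ` E" "\<Union>C = \<phi> ` V" using copyE[OF C] .
  show "card C = e" unfolding \<phi>(2) by (rule card_copy[OF \<phi>(1) EP])
  show "card (\<Union>C) = v" unfolding \<phi>(3) by (rule card_image[OF \<phi>(1)])
  show "finite C" unfolding \<phi>(2) using finE by simp
  show fU: "finite (\<Union>C)" unfolding \<phi>(3) using finV by simp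
  show "card g = l" if g: "g \<in> C"
  proof -
    obtain a where "a \<in> E" "g = \<phi> ` a" using g \<phi>(2) by blast
    then show ?thesis using edge[of a] card_image[OF inj_on_subset[OF \<phi>(1)]] by simp
  qed
  show "finite g" if "g \<in> C" using that fU by (meson Union_upper finite_subset)
  show "\<exists>g'\<in>C. g' \<noteq> h \<and> y \<in> g'" if y: "y \<in> \<Union>C"
  proof (rule ccontr)
    assume none: "\<not> ?thesis"
    obtain u where u: "u \<in> V" "y = \<phi> u" using y \<phi>(3) by blast
    have "{f \<in> C. y \<in> f} \<subseteq> {h}" using none by blast
    then have "deg y C \<le> card {h}" unfolding deg_def by (intro card_mono) auto
    then show False using deg_copy[OF \<phi>(1) EP u(1)] deg2[OF u(1)] u(2) \<phi>(2) by simp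
  qed
qed

lemma inter_single:
  assumes C: "C \<in> \<C>" and f: "\<Union>C \<inter> \<Union>X = f" "f \<in> C" "f \<in> X"
  shows "C \<inter> X = {f}"
proof
  show "C \<inter> X \<subseteq> {f}"
  proof
    fix g assume g: "g \<in> C \<inter> X"
    then have "g \<subseteq> f" using f(1) by blast
    then have "g = f" using copy_facts(5,6)[OF C] g f(2) by (metis IntD1 card_subset_eq)
    then show "g \<in> {f}" by simp
  qed
qed (use f in blast)

text \<open>Gluing a copy along a single edge creates no further copies: otherwise strict balancedness would
  fail for one of the two parts into which the gluing splits the new copy.\<close>

lemma glued_copy_unique:
  assumes C: "C \<in> \<C>" and f: "\<Union>C \<inter> \<Union>X = f" "f \<in> C" "f \<in> X"
    and C': "C' \<in> \<C>" "C' \<subseteq> X \<union> C" "\<not> C' \<subseteq> X"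
  shows "C' = C"
proof -
  obtain \<phi> where \<phi>: "inj_on \<phi> V" "C = (\<lambda>a. \<phi> ` a) ` E" "\<Union>C = \<phi> ` V" using copyE[OF C] .
  obtain \<psi> where \<psi>: "inj_on \<psi> V" "C' = (\<lambda>a. \<psi> ` a) ` E" "\<Union>C' = \<psi> ` V" using copyE[OF C'(1)] .
  have injE: "inj_on (\<lambda>a. \<phi> ` a) E" "inj_on (\<lambda>a. \<psi> ` a) E"
    using inj_on_image_edges[OF \<phi>(1) EP] inj_on_image_edges[OF \<psi>(1) EP] .
  have CX: "C \<inter> X = {f}" using inter_single[OF C f] .
  have cf: "card f = l" "finite f" using copy_facts(5,6)[OF C f(2)] .
  \<comment> \<open>\<open>C'\<close> is split into its part in \<open>X\<close>, with vertices
    \<open>U\<close> and edges \<open>J\<close>, and the rest, with vertices \<open>W\<close> and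
    edges \<open>K\<close>, which lies in \<open>C\<close>.\<close>
  define U where "U = {x \<in> V. \<psi> x \<in> \<Union>X}"
  define W where "W = V - U"
  define J where "J = {a \<in> E. \<psi> ` a \<in> X}"
  define K where "K = E - J"
  have UV: "U \<subseteq> V" "W \<subseteq> V" "V = U \<union> W" "U \<inter> W = {}" unfolding U_def W_def by auto
  have JE: "J \<subseteq> E" "K \<subseteq> E" "E = J \<union> K" "J \<inter> K = {}" unfolding J_def K_def by auto
  have fin: "finite U" "finite W" "finite J" "finite K" using UV JE finV finE finite_subset by metis+
  have cUW: "card U + card W = v" using card_Un_disjoint[OF fin(1,2) UV(4)] UV(3) by simp
  have cJK: "card J + card K = e" using card_Un_disjoint[OF fin(3,4) JE(4)] JE(3) by simp
  have JU: "\<Union>J \<subseteq> U" unfolding J_def U_def using edge by blast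
  have KC: "\<psi> ` a \<in> C - {f}" if "a \<in> K" for a
  proof -
    have "\<psi> ` a \<in> C'" "\<psi> ` a \<notin> X" using that \<psi>(2) unfolding K_def J_def by auto
    then show ?thesis using C'(2) f(3) by blast
  qed
  have K_ne: "K \<noteq> {}"
  proof
    assume "K = {}"
    then have "C' \<subseteq> X" using \<psi>(2) unfolding K_def J_def by auto
    then show False using C'(3) by blast
  qed
  have JneE: "J \<noteq> E" using K_ne unfolding K_def by blast
  have inf: "y \<in> f" if "y \<in> \<Union>C" "y \<in> \<Union>X" for y using that f(1) by blast
  have fX: "f \<subseteq> \<Union>X" "f \<subseteq> \<Union>C" using f by blast+
  have WC: "\<psi> ` W \<subseteq> \<Union>C - f"
  proof safe
    fix x assume x: "x \<in> W"
    then have xV: "x \<in> V" and nX: "\<psi> x \<notin> \<Union>X" unfolding W_def U_def by auto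
    obtain a where a: "a \<in> E" "x \<in> a" using xV UE by blast
    then have "\<psi> ` a \<notin> X" using nX by blast
    then have "\<psi> ` a \<in> C" using C'(2) a(1) \<psi>(2) by blast
    then show "\<psi> x \<in> \<Union>C" using a(2) by blast
    show False if "\<psi> x \<in> f" using that nX fX by blast
  qed
  have cCf: "card (\<Union>C - f) = v - l"
    using copy_facts(2,4)[OF C] cf fX(2) by (simp add: card_Diff_subset)
  have cW: "card (\<psi> ` W) = card W" using card_image[OF inj_on_subset[OF \<psi>(1) UV(2)]] .
  have W_le: "card W \<le> v - l"
    using card_mono[OF _ WC] copy_facts(4)[OF C] cW cCf by simp
  have W_ne: "W \<noteq> {}"
  proof
    assume W0: "W = {}"
    obtain b where b: "b \<in> K" using K_ne by blast
    have bE: "b \<in> E" using b JE by blast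
    have "\<psi> ` b \<subseteq> \<Union>X" using edge[OF bE] W0 UV(3) unfolding U_def by blast
    moreover have "\<psi> ` b \<subseteq> \<Union>C" using KC[OF b] by blast
    ultimately have "\<psi> ` b \<subseteq> f" using inf by blast
    moreover have "card (\<psi> ` b) = card f" using KC[OF b] copy_facts(5)[OF C] cf by auto
    ultimately have "\<psi> ` b = f" using cf(2) by (intro card_subset_eq)
    then show False using KC[OF b] by blast
  qed
  \<comment> \<open>The part of \<open>C'\<close> outside \<open>X\<close>, completed by
    \<open>f\<close>, is pulled back to a subgraph of the template with \<open>card W + l\<close>
    vertices and \<open>card K + 1\<close> edges; balancedness then bounds \<open>card K\<close> by
    \<open>m * card W\<close>.\<close>
  define J1 where "J1 = {a \<in> E. \<phi> ` a \<in> (\<lambda>a. \<psi> ` a) ` K \<union> {f}}"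
  define U1 where "U1 = {x \<in> V. \<phi> x \<in> \<psi> ` W \<union> f}"
  have "(\<lambda>a. \<phi> ` a) ` J1 = (\<lambda>a. \<psi> ` a) ` K \<union> {f}"
  proof
    show "(\<lambda>a. \<psi> ` a) ` K \<union> {f} \<subseteq> (\<lambda>a. \<phi> ` a) ` J1"
    proof
      fix h assume h: "h \<in> (\<lambda>a. \<psi> ` a) ` K \<union> {f}"
      then have "h \<in> C" using KC f(2) by blast
      then obtain a where "a \<in> E" "h = \<phi> ` a" using \<phi>(2) by blast
      then show "h \<in> (\<lambda>a. \<phi> ` a) ` J1" using h unfolding J1_def by blast
    qed
  qed (auto simp: J1_def)
  moreover have "card ((\<lambda>a. \<phi> ` a) ` J1) = card J1"
    unfolding J1_def by (intro card_image inj_on_subset[OF injE(1)]) auto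
  moreover have cK: "card ((\<lambda>a. \<psi> ` a) ` K) = card K"
    by (intro card_image inj_on_subset[OF injE(2)] JE)
  moreover have "f \<notin> (\<lambda>a. \<psi> ` a) ` K" using KC by blast
  ultimately have cJ1: "card J1 = card K + 1" using fin by simp
  have "\<phi> ` U1 = \<psi> ` W \<union> f"
  proof
    show "\<psi> ` W \<union> f \<subseteq> \<phi> ` U1"
    proof
      fix y assume y: "y \<in> \<psi> ` W \<union> f"
      then have "y \<in> \<Union>C" using WC fX(2) by blast
      then obtain x where "x \<in> V" "y = \<phi> x" using \<phi>(3) by blast
      then show "y \<in> \<phi> ` U1" using y unfolding U1_def by blast
    qed
  qed (auto simp: U1_def)
  moreover have "card (\<phi> ` U1) = card U1"
    unfolding U1_def by (intro card_image inj_on_subset[OF \<phi>(1)]) auto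
  moreover have "card (\<psi> ` W \<union> f) = card W + l"
    using WC cW cf fin by (subst card_Un_disjoint) auto
  ultimately have cU1: "card U1 = card W + l" by simp
  have "\<Union>J1 \<subseteq> U1"
  proof
    fix x assume "x \<in> \<Union>J1"
    then obtain a where a: "a \<in> E" "x \<in> a" "\<phi> ` a \<in> (\<lambda>a. \<psi> ` a) ` K \<union> {f}" unfolding J1_def by blast
    have xV: "x \<in> V" using a edge by blast
    have "\<phi> x \<in> \<psi> ` W \<union> f"
    proof (cases "\<phi> ` a = f")
      case True
      then show ?thesis using a(2) by blast
    next
      case False
      then obtain b where b: "b \<in> K" "\<phi> ` a = \<psi> ` b" using a(3) by blast
      then obtain y where y: "y \<in> b" "\<phi> x = \<psi> y" using a(2) by blast
      have yV: "y \<in> V" using y b JE edge by blast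
      show ?thesis
      proof (cases "y \<in> U")
        case True
        then have "\<phi> x \<in> \<Union>X" using y(2) unfolding U_def by simp
        moreover have "\<phi> x \<in> \<Union>C" using xV \<phi>(3) by blast
        ultimately show ?thesis using inf by blast
      next
        case False
        then show ?thesis using y(2) yV unfolding W_def by blast
      qed
    qed
    then show "x \<in> U1" using xV unfolding U1_def by blast
  qed
  moreover have "1 \<le> card W" using W_ne fin by (simp add: Suc_le_eq card_gt_0_iff)
  ultimately have "real (card J1) - 1 \<le> m * (real (card U1) - real l)"
    using cU1 by (intro balanced_le) (auto simp: J1_def U1_def)
  then have KW: "real (card K) \<le> m * real (card W)" using cJ1 cU1 by simp
  \<comment> \<open>With more than \<open>l\<close> vertices in \<open>U\<close>, the strict bound
    for \<open>J\<close> and the bound for \<open>K\<close> add up to fewer edges than a copy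
    has.\<close>
  have "card U \<le> l"
  proof (rule ccontr)
    assume "\<not> card U \<le> l"
    then have "real (card J) - 1 < m * (real (card U) - real l)"
      using balanced[OF UV(1) JE(1) JU _ JneE] by simp
    then have "real (card J) + real (card K) - 1 < m * (real (card U) + real (card W) - real l)"
      using KW by (simp add: algebra_simps)
    also have "real (card U) + real (card W) = real v" using cUW by linarith
    also have "real (card J) + real (card K) = real e" using cJK by linarith
    finally show False using m_eq by simp
  qed
  \<comment> \<open>\<open>W\<close> has room for only \<open>v - l\<close> vertices, so
    \<open>U\<close> has exactly \<open>l\<close>. Then \<open>J\<close> can only be the edge
    \<open>U\<close> itself, and counting forces \<open>K\<close> to be mapped onto
    \<open>C - {f}\<close>.\<close>
  then have cU: "card U = l" using cUW W_le card_V by linarith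
  have "J \<subseteq> {U}"
  proof
    fix a assume a: "a \<in> J"
    then have "a \<subseteq> U" "card a = card U" using JU JE edge cU by blast+
    then show "a \<in> {U}" using fin(1) by (simp add: card_subset_eq)
  qed
  moreover have KCsub: "(\<lambda>a. \<psi> ` a) ` K \<subseteq> C - {f}" using KC by blast
  have K_le: "card K \<le> e - 1"
    using card_mono[OF _ KCsub] copy_facts(1,3)[OF C] cK f(2) by simp
  have "J \<noteq> {}" using cJK K_le card_E by auto
  ultimately have JU': "J = {U}" by blast
  then have "card K = e - 1" using cJK by simp
  then have Keq: "(\<lambda>a. \<psi> ` a) ` K = C - {f}"
    using KCsub copy_facts(1,3)[OF C] cK f(2) by (intro card_subset_eq) auto
  \<comment> \<open>Every vertex of \<open>f\<close> lies in a second edge of \<open>C\<close>,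
    hence in an image of an edge of \<open>K\<close>.\<close>
  have "f \<subseteq> \<psi> ` U"
  proof
    fix y assume y: "y \<in> f"
    then obtain g where g: "g \<in> C" "g \<noteq> f" "y \<in> g" using copy_facts(7)[OF C, of y f] f(2) by blast
    then have "g \<in> (\<lambda>a. \<psi> ` a) ` K" using Keq by blast
    then obtain b where b: "b \<in> K" "g = \<psi> ` b" by blast
    then obtain x where x: "x \<in> b" "y = \<psi> x" using g(3) by blast
    then have "x \<in> V" using b JE edge by blast
    moreover have "\<psi> x \<in> \<Union>X" using x y fX by blast
    ultimately show "y \<in> \<psi> ` U" using x unfolding U_def by blast
  qed
  moreover have "card (\<psi> ` U) = l" using card_image[OF inj_on_subset[OF \<psi>(1) UV(1)]] cU by simp
  ultimately have "f = \<psi> ` U" using cf fin by (intro card_subset_eq) auto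
  have "C' = (\<lambda>a. \<psi> ` a) ` K \<union> (\<lambda>a. \<psi> ` a) ` J" using \<psi>(2) JE(3) by blast
  also have "\<dots> = (C - {f}) \<union> {f}" using Keq JU' \<open>f = \<psi> ` U\<close> by simp
  also have "\<dots> = C" using f(2) by blast
  finally show ?thesis .
qed

end

section \<open>Exploring an uncolourable hypergraph\<close>

context template
begin

text \<open>The trace of a regular step: a freshly attached copy is pendant and remains so until
  some later copy touches it elsewhere.\<close>

definition pendant :: "nat set set \<Rightarrow> nat set set set \<Rightarrow> bool" where
  "pendant D S \<longleftrightarrow> D \<in> S \<and> (\<exists>f. f \<in> D \<and> f \<in> \<Union>(S - {D}) \<and> \<Union>D \<inter> \<Union>(\<Union>(S - {D})) = f)"

text \<open>As the uncolourable hypergraph separates any two of its edges, an open copy guarantees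
  that the exploration can continue at it.\<close>

definition open_copy :: "nat set set \<Rightarrow> nat set set set \<Rightarrow> bool" where
  "open_copy D S \<longleftrightarrow> D \<in> S \<and>
     (\<exists>e1\<in>D. \<exists>e2\<in>D. e1 \<noteq> e2 \<and> (\<forall>C\<in>\<C>. C \<subseteq> \<Union>S \<longrightarrow> (e1 \<in> C \<longleftrightarrow> e2 \<in> C)))"

text \<open>Arises when a pendant copy is hit at a second edge. Attaching to it next cannot spoil
  another pendant copy.\<close>

definition half_open :: "nat set set \<Rightarrow> nat set set set \<Rightarrow> bool" where
  "half_open D S \<longleftrightarrow> open_copy D S \<and> \<not> pendant D S"

lemma pendantE:
  assumes "pendant D S"
  obtains f where "D \<in> S" "f \<in> D" "f \<in> \<Union>(S - {D})" "\<Union>D \<inter> \<Union>(\<Union>(S - {D})) = f"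
  using assms unfolding pendant_def by blast

text \<open>By uniqueness of glued copies: \<open>C\<close> is not contained in the rest of the
  state, so it must be the glued copy \<open>D\<close>.\<close>

lemma pendant_copies:
  assumes p: "pendant D S" and f: "f \<in> \<Union>(S - {D})" "\<Union>D \<inter> \<Union>(\<Union>(S - {D})) = f" "f \<in> D"
    and S: "S \<subseteq> \<C>" and C: "C \<in> \<C>" "C \<subseteq> \<Union>S" and h: "h \<in> C" "h \<in> D" "h \<noteq> f"
  shows "C = D"
proof -
  have D: "D \<in> S" "D \<in> \<C>" using p S unfolding pendant_def by auto
  have "D \<inter> \<Union>(S - {D}) = {f}" using inter_single[OF D(2) f(2,3,1)] .
  then have "\<not> C \<subseteq> \<Union>(S - {D})" using h by blast
  moreover have "C \<subseteq> \<Union>(S - {D}) \<union> D" using C(2) by blast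
  ultimately show ?thesis using glued_copy_unique[OF D(2) f(2,3,1) C(1)] by blast
qed

lemma obtain_two_edges:
  assumes "D \<in> \<C>" "card A \<le> 2" "finite A"
  obtains e1 e2 where "e1 \<in> D - A" "e2 \<in> D - A" "e1 \<noteq> e2"
proof -
  have "card D - card A \<le> card (D - A)" by (rule diff_card_le_card_Diff[OF assms(3)])
  then have "2 \<le> card (D - A)" using copy_facts(1)[OF assms(1)] card_E assms(2) by linarith
  then obtain T where "T \<subseteq> D - A" "card T = 2" by (meson obtain_subset_with_card_n)
  then show thesis using that by (auto simp: card_2_iff)
qed

lemma pendant_open:
  assumes p: "pendant D S" and S: "S \<subseteq> \<C>"
  shows "open_copy D S"
proof -
  obtain f where f: "D \<in> S" "f \<in> D" "f \<in> \<Union>(S - {D})" "\<Union>D \<inter> \<Union>(\<Union>(S - {D})) = f"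
    using pendantE[OF p] .
  have DC: "D \<in> \<C>" using f S by blast
  obtain e1 e2 where e: "e1 \<in> D - {f}" "e2 \<in> D - {f}" "e1 \<noteq> e2"
    using obtain_two_edges[OF DC, of "{f}"] by auto
  have "e1 \<in> C \<longleftrightarrow> e2 \<in> C" if C: "C \<in> \<C>" "C \<subseteq> \<Union>S" for C
    using pendant_copies[OF p f(3,4,2) S C, of e1] pendant_copies[OF p f(3,4,2) S C, of e2] e by blast
  then show ?thesis unfolding open_copy_def using f(1) e by blast
qed

lemma attached_not_mem:
  assumes "C \<in> \<C>" "\<Union>C \<inter> \<Union>(\<Union>S) = g" "g \<in> C" shows "C \<notin> S"
proof
  assume "C \<in> S"
  then have "\<Union>C = g" using assms(2) by blast
  then show False using copy_facts(2)[OF assms(1)] copy_facts(5)[OF assms(1,3)] card_V by simp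
qed

lemma attach_pendant_new:
  assumes "C \<in> \<C>" "\<Union>C \<inter> \<Union>(\<Union>S) = g" "g \<in> C" "g \<in> \<Union>S" shows "pendant C (insert C S)"
proof -
  have "insert C S - {C} = S" using attached_not_mem[OF assms(1-3)] by blast
  then show ?thesis unfolding pendant_def using assms by auto
qed

text \<open>\<open>C\<close> meets the old part only in \<open>g\<close>, whose vertices belong to
  \<open>D0\<close>. So \<open>D\<close> shares no new vertex with the others.\<close>

lemma attach_pendant_old:
  assumes C: "C \<in> \<C>" "\<Union>C \<inter> \<Union>(\<Union>S) = g" "g \<in> C" and p: "pendant D S" and D0: "D0 \<in> S" "D0 \<noteq> D" "g \<in> D0"
  shows "pendant D (insert C S)"
proof -
  obtain f where f: "D \<in> S" "f \<in> D" "f \<in> \<Union>(S - {D})" "\<Union>D \<inter> \<Union>(\<Union>(S - {D})) = f"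
    using pendantE[OF p] .
  have "C \<noteq> D" using attached_not_mem[OF C] f(1) by blast
  then have eq: "insert C S - {D} = insert C (S - {D})" by blast
  have "\<Union>D \<inter> \<Union>C \<subseteq> g" using C(2) f(1) by blast
  moreover have "g \<subseteq> \<Union>(\<Union>(S - {D}))" using D0 by blast
  ultimately have "\<Union>D \<inter> \<Union>C \<subseteq> f" using f(4) by blast
  then have "\<Union>D \<inter> \<Union>(\<Union>(insert C S - {D})) = f" unfolding eq using f(4) by auto
  moreover have "f \<in> \<Union>(insert C S - {D})" unfolding eq using f(3) by auto
  ultimately show ?thesis unfolding pendant_def using f(1,2) by blast
qed

text \<open>Two edges of \<open>D\<close> other than \<open>f\<close> and \<open>g\<close> remain,
  and no copy except \<open>D\<close> contains either of them: old copies by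
  \<open>pendant_copies\<close>, and the only new one, \<open>C\<close>, meets the old edges in
  \<open>g\<close> alone.\<close>

lemma attach_half_open:
  assumes C: "C \<in> \<C>" "\<Union>C \<inter> \<Union>(\<Union>S) = g" "g \<in> C" "g \<in> \<Union>S" and S: "S \<subseteq> \<C>"
    and p: "pendant D S" "\<not> pendant D (insert C S)"
  shows "half_open D (insert C S)"
proof -
  obtain f where f: "D \<in> S" "f \<in> D" "f \<in> \<Union>(S - {D})" "\<Union>D \<inter> \<Union>(\<Union>(S - {D})) = f"
    using pendantE[OF p(1)] .
  have DC: "D \<in> \<C>" using f S by blast
  have CS: "C \<inter> \<Union>S = {g}" using inter_single[OF C] .
  have "card {f, g} \<le> 2" by (simp add: card_insert_if)
  then obtain e1 e2 where e: "e1 \<in> D - {f, g}" "e2 \<in> D - {f, g}" "e1 \<noteq> e2"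
    using obtain_two_edges[OF DC, of "{f, g}"] by auto
  have "e1 \<in> C' \<longleftrightarrow> e2 \<in> C'" if C': "C' \<in> \<C>" "C' \<subseteq> \<Union>(insert C S)" for C'
  proof (cases "C' \<subseteq> \<Union>S")
    case True
    then show ?thesis
      using pendant_copies[OF p(1) f(3,4,2) S C'(1) True, of e1] pendant_copies[OF p(1) f(3,4,2) S C'(1) True, of e2] e by blast
  next
    case False
    moreover have "C' \<subseteq> \<Union>S \<union> C" using C'(2) by blast
    ultimately have "C' = C" using glued_copy_unique[OF C C'(1)] by blast
    then show ?thesis using CS e f(1) by blast
  qed
  then have "open_copy D (insert C S)" unfolding open_copy_def using f(1) e by blast
  then show ?thesis using p(2) unfolding half_open_def by blast
qed

text \<open>The edges at which the next copy is sought. Provided \<open>K\<close> is at least the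
  number of edges of a copy, this set never exceeds \<open>K\<close> elements, so the number of
  choices in a regular step does not grow with the state.\<close>

definition allowed :: "nat \<Rightarrow> nat set set set \<Rightarrow> nat set set" where
  "allowed K S = (if \<exists>D. half_open D S then SOME D. half_open D S
     else if \<exists>D. open_copy D S then SOME D. open_copy D S
     else if card (\<Union>S) \<le> K then \<Union>S else {})"

lemma half_open_allowed:
  assumes "\<exists>D. half_open D S" shows "half_open (allowed K S) S"
  unfolding allowed_def using assms someI_ex[OF assms] by simp

lemma open_copy_allowed:
  assumes "\<not> (\<exists>D. half_open D S)" "\<exists>D. open_copy D S" shows "open_copy (allowed K S) S"
  unfolding allowed_def using assms someI_ex[OF assms(2)] by simp

lemma allowed_no_open:
  assumes "\<not> (\<exists>D. half_open D S)" "\<not> (\<exists>D. open_copy D S)"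
  shows "allowed K S = (if card (\<Union>S) \<le> K then \<Union>S else {})"
  unfolding allowed_def using assms by simp

lemma half_openD: "half_open D S \<Longrightarrow> D \<in> S \<and> \<not> pendant D S"
  by (simp add: half_open_def open_copy_def)

lemma open_copy_mem: "open_copy D S \<Longrightarrow> D \<in> S"
  by (simp add: open_copy_def)

lemma allowed_subset: "allowed K S \<subseteq> \<Union>S"
proof -
  consider "\<exists>D. half_open D S" | "\<not> (\<exists>D. half_open D S)" "\<exists>D. open_copy D S"
    | "\<not> (\<exists>D. half_open D S)" "\<not> (\<exists>D. open_copy D S)" by blast
  then show ?thesis
  proof cases
    case 1
    then show ?thesis by (intro Union_upper) (simp add: half_open_allowed half_openD)
  next
    case 2
    then show ?thesis by (intro Union_upper open_copy_mem open_copy_allowed)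
  next
    case 3
    then show ?thesis by (simp add: allowed_no_open)
  qed
qed

section \<open>Exploration steps and their potential\<close>

definition cops :: "nat \<Rightarrow> nat set set set" where
  "cops n = {C \<in> \<C>. \<Union>C \<subseteq> {..<n}}"

definition regular :: "nat \<Rightarrow> nat \<Rightarrow> nat set set set \<Rightarrow> nat set set set" where
  "regular K n S = {C \<in> cops n. \<exists>g. g \<in> C \<and> g \<in> allowed K S \<and> \<Union>C \<inter> \<Union>(\<Union>S) = g}"

text \<open>Here the place of attachment is not restricted: counting all positions in the explored
  part costs only powers of logarithms, which the gain of a degenerate step absorbs.\<close>

definition degenerate :: "nat \<Rightarrow> nat set set set \<Rightarrow> nat set set set" where
  "degenerate n S = {C \<in> cops n. \<not> C \<subseteq> \<Union>S \<and> l + 1 \<le> card (\<Union>C \<inter> \<Union>(\<Union>S))}"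

definition extensions :: "(nat set set set \<Rightarrow> nat set set set) \<Rightarrow> nat set set set set \<Rightarrow> nat set set set set" where
  "extensions R Q = {insert C S | S C. S \<in> Q \<and> C \<in> R S}"

text \<open>\<open>states K n i d\<close> contains the outcomes of \<open>i\<close> exploration steps, \<open>d\<close> of them degenerate.\<close>

fun states :: "nat \<Rightarrow> nat \<Rightarrow> nat \<Rightarrow> nat \<Rightarrow> nat set set set set" where
  "states K n 0 0 = {{C} | C. C \<in> cops n}"
| "states K n 0 (Suc d) = {}"
| "states K n (Suc i) 0 = extensions (regular K n) (states K n i 0)"
| "states K n (Suc i) (Suc d) =
     extensions (regular K n) (states K n i (Suc d)) \<union> extensions (degenerate n) (states K n i d)"

definition half :: "nat set set set \<Rightarrow> nat" where
  "half S = (if \<exists>D. half_open D S then 1 else 0)"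

text \<open>Pendant copies count twice so that a new one outweighs the possible loss of
  \<open>half\<close>; \<open>half\<close> in turn rewards a step that replaces one pendant copy by
  another.\<close>

definition pot :: "nat set set set \<Rightarrow> nat" where
  "pot S = 2 * card {D. pendant D S} + half S"

lemma half_le: "half S \<le> 1"
  unfolding half_def by simp

lemma half_eq_1: "half_open D S \<Longrightarrow> half S = 1"
  unfolding half_def by auto

lemma half_eq_0: "\<not> (\<exists>D. half_open D S) \<Longrightarrow> half S = 0"
  unfolding half_def by simp

lemma finite_pendant: "finite S \<Longrightarrow> finite {D. pendant D S}"
  by (rule finite_subset[of _ S]) (auto simp: pendant_def)

text \<open>If all pendant copies survive, the new one adds 2 and \<open>half\<close> loses at most
  1. If some \<open>D\<close> is spoiled, \<open>g\<close> lies in no other copy, so only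
  \<open>D\<close> is lost and \<open>C\<close> replaces it, while \<open>half\<close> rises from 0
  to 1: had there been a half-open copy, the step would have used its edges rather than those of the
  pendant \<open>D\<close>.\<close>

lemma pot_regular:
  assumes S: "finite S" "S \<subseteq> \<C>" and C: "C \<in> regular K n S"
  shows "pot S + 1 \<le> pot (insert C S)"
proof -
  obtain g where g: "C \<in> \<C>" "\<Union>C \<inter> \<Union>(\<Union>S) = g" "g \<in> C" "g \<in> allowed K S"
    using C unfolding regular_def cops_def by blast
  have gS: "g \<in> \<Union>S" using g(4) allowed_subset by blast
  let ?P = "{D. pendant D S}" and ?P' = "{D. pendant D (insert C S)}"
  have fin: "finite ?P" "finite ?P'" using S(1) by (auto intro: finite_pendant)
  have CS: "C \<notin> S" using attached_not_mem[OF g(1-3)] .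
  then have C_notin: "C \<notin> ?P" by (simp add: pendant_def)
  have C_in: "C \<in> ?P'" by (rule CollectI) (rule attach_pendant_new[OF g(1-3) gS])
  show ?thesis
  proof (cases "?P \<subseteq> ?P'")
    case True
    then have "insert C ?P \<subseteq> ?P'" using C_in by blast
    then have "card (insert C ?P) \<le> card ?P'" by (rule card_mono[OF fin(2)])
    then have "card ?P + 1 \<le> card ?P'" unfolding card_insert_disjoint[OF fin(1) C_notin] by simp
    then show ?thesis using half_le[of S] unfolding pot_def by linarith
  next
    case False
    then obtain D where D: "pendant D S" "\<not> pendant D (insert C S)" by blast
    then have ho: "half_open D (insert C S)" using attach_half_open[OF g(1-3) gS S(2)] by blast
    have only: "D' = D" if "D' \<in> S" "g \<in> D'" for D'
      using attach_pendant_old[OF g(1-3) D(1) that(1) _ that(2)] D(2) by blast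
    obtain D1 where D1: "D1 \<in> S" "g \<in> D1" using gS by blast
    have gD: "g \<in> D" "D \<in> S" using only[OF D1] D1 by auto
    have no: "\<not> (\<exists>D. half_open D S)"
    proof
      assume ex: "\<exists>D. half_open D S"
      then have h: "allowed K S \<in> S" "\<not> pendant (allowed K S) S" using half_open_allowed half_openD by blast+
      show False using only[OF h(1) g(4)] h(2) D(1) by simp
    qed
    have "insert C (?P - {D}) \<subseteq> ?P'"
    proof
      fix D' assume D': "D' \<in> insert C (?P - {D})"
      show "D' \<in> ?P'"
      proof (cases "D' = C")
        case True
        then show ?thesis using C_in by simp
      next
        case False
        then have "pendant D' S" "D \<noteq> D'" using D' by auto
        then show ?thesis using attach_pendant_old[OF g(1-3) _ gD(2) _ gD(1)] by simp
      qed
    qed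
    then have le: "card (insert C (?P - {D})) \<le> card ?P'" by (rule card_mono[OF fin(2)])
    have "C \<notin> ?P - {D}" using C_notin by simp
    then have "card (insert C (?P - {D})) = Suc (card (?P - {D}))" by (rule card_insert_disjoint[rotated]) (simp add: fin)
    also have "\<dots> = card ?P" by (rule card_Suc_Diff1[OF fin(1)]) (simp add: D(1))
    finally show ?thesis using le half_eq_0[OF no] half_eq_1[OF ho] unfolding pot_def by linarith
  qed
qed

text \<open>Each spoiled pendant copy shares with \<open>C\<close> a vertex lying in no other copy
  of the state. These vertices are distinct, so at most \<open>v\<close> copies are spoiled at cost
  2 each, plus 1 for \<open>half\<close>.\<close>

lemma pot_degenerate:
  assumes S: "finite S" and C: "C \<in> \<C>"
  shows "pot S \<le> pot (insert C S) + (2 * v + 1)"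
proof -
  let ?P = "{D. pendant D S}" and ?P' = "{D. pendant D (insert C S)}"
  have fin: "finite ?P" "finite ?P'" using S by (auto intro: finite_pendant)
  let ?K = "?P - ?P'"
  have "\<exists>x. x \<in> \<Union>C \<and> x \<in> \<Union>D \<and> x \<notin> \<Union>(\<Union>(S - {D}))" if D: "D \<in> ?K" for D
  proof (rule ccontr)
    assume none: "\<not> ?thesis"
    have "pendant D S" using D by simp
    then obtain f where f: "D \<in> S" "f \<in> D" "f \<in> \<Union>(S - {D})" "\<Union>D \<inter> \<Union>(\<Union>(S - {D})) = f"
      using pendantE by metis
    have "\<Union>D \<inter> \<Union>(\<Union>(insert C S - {D})) = f"
    proof (cases "C = D")
      case True
      then have "insert C S - {D} = S - {D}" by blast
      then show ?thesis using f(4) by simp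
    next
      case False
      then have eq: "insert C S - {D} = insert C (S - {D})" by blast
      have "\<Union>D \<inter> \<Union>C \<subseteq> f" using none f(4) by blast
      then show ?thesis unfolding eq using f(4) by auto
    qed
    moreover have "f \<in> \<Union>(insert C S - {D})" using f(3) by blast
    ultimately have "pendant D (insert C S)" unfolding pendant_def using f(1,2) by blast
    then show False using D by blast
  qed
  then obtain x where x: "\<And>D. D \<in> ?K \<Longrightarrow> x D \<in> \<Union>C \<and> x D \<in> \<Union>D \<and> x D \<notin> \<Union>(\<Union>(S - {D}))" by metis
  have "inj_on x ?K"
  proof (rule inj_onI)
    fix D D' assume D: "D \<in> ?K" "D' \<in> ?K" "x D = x D'"
    show "D = D'"
    proof (rule ccontr)
      assume "D \<noteq> D'"
      then have "D \<in> S - {D'}" using D(1) unfolding pendant_def by blast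
      then have "x D \<in> \<Union>(\<Union>(S - {D'}))" using x[OF D(1)] by blast
      then show False using x[OF D(2)] D(3) by simp
    qed
  qed
  moreover have "x ` ?K \<subseteq> \<Union>C" using x by blast
  ultimately have "card ?K \<le> v"
    using card_inj_on_le[of x ?K "\<Union>C"] copy_facts(2,4)[OF C] by simp
  moreover have "card ?P \<le> card (?P' \<union> ?K)" using fin by (intro card_mono) auto
  then have "card ?P \<le> card ?P' + card ?K" using card_Un_le order_trans by blast
  ultimately show ?thesis using half_le[of S] unfolding pot_def by linarith
qed

lemma cops_subset: "cops n \<subseteq> \<C>"
  unfolding cops_def by blast

text \<open>A regular step adds 1 to both \<open>i\<close> and the potential. A degenerate step adds
  1 to \<open>i\<close> and may lower the potential by \<open>2 * v + 1\<close>, which explains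
  \<open>2 * v + 2\<close>.\<close>

lemma states_invariant:
  "S \<in> states K n i d \<Longrightarrow> finite S \<and> S \<noteq> {} \<and> S \<subseteq> cops n \<and> card S \<le> i + 1 \<and> i \<le> pot S + (2 * v + 2) * d"
proof (induction i arbitrary: S d)
  case 0
  then obtain C where "C \<in> cops n" "S = {C}" by (cases d) auto
  then show ?case by simp
next
  case (Suc i)
  have ext: "S \<in> extensions (regular K n) (states K n i d) \<or>
      (\<exists>d'. d = Suc d' \<and> S \<in> extensions (degenerate n) (states K n i d'))"
    using Suc.prems by (cases d) auto
  have card_ins: "card (insert C S0) \<le> Suc i + 1" if "card S0 \<le> i + 1" for C :: "nat set set" and S0
    using that card_insert_le_m1[of "Suc i + 1" S0 C] by simp
  from ext show ?case
  proof
    assume "S \<in> extensions (regular K n) (states K n i d)"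
    then obtain S0 C where S: "S = insert C S0" "S0 \<in> states K n i d" "C \<in> regular K n S0"
      unfolding extensions_def by blast
    have IH: "finite S0" "S0 \<subseteq> cops n" "card S0 \<le> i + 1" "i \<le> pot S0 + (2 * v + 2) * d"
      using Suc.IH[OF S(2)] by auto
    have "C \<in> cops n" using S(3) unfolding regular_def by blast
    moreover have "pot S0 + 1 \<le> pot S"
      unfolding S(1) using pot_regular[OF IH(1) _ S(3)] IH(2) cops_subset by blast
    ultimately show ?thesis using IH card_ins[OF IH(3), of C] unfolding S(1) by simp
  next
    assume "\<exists>d'. d = Suc d' \<and> S \<in> extensions (degenerate n) (states K n i d')"
    then obtain d' S0 C where S: "d = Suc d'" "S = insert C S0" "S0 \<in> states K n i d'" "C \<in> degenerate n S0"
      unfolding extensions_def by blast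
    have IH: "finite S0" "S0 \<subseteq> cops n" "card S0 \<le> i + 1" "i \<le> pot S0 + (2 * v + 2) * d'"
      using Suc.IH[OF S(3)] by auto
    have C: "C \<in> cops n" using S(4) unfolding degenerate_def by blast
    then have "pot S0 \<le> pot S + (2 * v + 1)"
      unfolding S(2) using pot_degenerate[OF IH(1)] cops_subset by blast
    then show ?thesis using IH C card_ins[OF IH(3), of C] unfolding S(1,2) by simp
  qed
qed

lemma card_Union_state:
  assumes "finite S" "S \<subseteq> \<C>" shows "card (\<Union>S) \<le> e * card S" "card (\<Union>(\<Union>S)) \<le> v * card S"
    "finite (\<Union>S)" "finite (\<Union>(\<Union>S))"
proof -
  have "card (\<Union>S) \<le> (\<Sum>C\<in>S. card C)" using card_UN_le[OF assms(1), of "\<lambda>C. C"] by simp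
  also have "\<dots> = (\<Sum>C\<in>S. e)" using copy_facts(1) assms(2) by (intro sum.cong) auto
  finally show "card (\<Union>S) \<le> e * card S" by (simp add: mult.commute)
  have "\<Union>(\<Union>S) = (\<Union>C\<in>S. \<Union>C)" by blast
  then have "card (\<Union>(\<Union>S)) \<le> (\<Sum>C\<in>S. card (\<Union>C))" using card_UN_le[OF assms(1), of "\<lambda>C. \<Union>C"] by simp
  also have "\<dots> = (\<Sum>C\<in>S. v)" using copy_facts(2) assms(2) by (intro sum.cong) auto
  finally show "card (\<Union>(\<Union>S)) \<le> v * card S" by (simp add: mult.commute)
  show "finite (\<Union>S)" using assms copy_facts(3) by auto
  show "finite (\<Union>(\<Union>S))" using assms copy_facts(3,6) by (intro finite_Union) auto
qed

text \<open>Pendant and half-open copies are open, so without open copies the potential is 0 and the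
  number of steps is bounded in terms of \<open>d\<close>.\<close>

lemma no_open_small:
  assumes "S \<in> states K n i d" "\<not> (\<exists>D. open_copy D S)"
  shows "card (\<Union>S) \<le> e * ((2 * v + 2) * d + 1)"
proof -
  have inv: "finite S" "S \<subseteq> \<C>" "card S \<le> i + 1" "i \<le> pot S + (2 * v + 2) * d"
    using states_invariant[OF assms(1)] cops_subset by auto
  have none: "\<not> pendant D S" "\<not> half_open D S" for D
    using pendant_open[OF _ inv(2)] assms(2) unfolding half_open_def by auto
  have "half S = 0" using none(2) by (intro half_eq_0) blast
  then have "pot S = 0" unfolding pot_def by (simp add: none(1))
  then have "card S \<le> (2 * v + 2) * d + 1" using inv(3,4) by simp
  then have "e * card S \<le> e * ((2 * v + 2) * d + 1)" by (rule mult_le_mono2)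
  then show ?thesis using card_Union_state(1)[OF inv(1,2)] by linarith
qed

end

context template
begin

text \<open>The exploration is never stuck while \<open>B\<close> is large: a copy separating two
  edges of an open copy is new, and a state without open copies is small, hence a proper part of
  \<open>B\<close>, and some copy crosses it.\<close>

lemma exploration:
  assumes B: "minimal_uncolourable \<C> B" "finite B" "\<Union>B \<subseteq> {..<n}" and k: "1 \<le> k"
    and K: "K = e * ((2 * v + 2) * k + 1)"
  shows "card B \<le> K \<or> (\<exists>j\<le>i. \<exists>S\<in>states K n j k. \<Union>S \<subseteq> B) \<or> (\<exists>d<k. \<exists>S\<in>states K n i d. \<Union>S \<subseteq> B)"
proof (induction i)
  case 0
  obtain C where C: "C \<in> \<C>" "C \<subseteq> B" using minimal_uncolourable_has_copy[OF B(1,2)] by blast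
  have "C \<in> cops n" unfolding cops_def using C B(3) by blast
  then have "{C} \<in> states K n 0 0" by auto
  moreover have "\<Union>{C} \<subseteq> B" using C(2) by simp
  ultimately have "\<exists>S\<in>states K n 0 0. \<Union>S \<subseteq> B" by (rule bexI[rotated])
  moreover have "0 < k" using k by simp
  ultimately show ?case by (intro disjI2 exI[of _ 0] conjI)
next
  case (Suc i)
  show ?case
  proof (cases "card B \<le> K \<or> (\<exists>j\<le>i. \<exists>S\<in>states K n j k. \<Union>S \<subseteq> B)")
    case True
    then show ?thesis using le_SucI[of _ i] by blast
  next
    case False
    then obtain d S where S: "d < k" "S \<in> states K n i d" "\<Union>S \<subseteq> B" using Suc.IH by blast
    have inv: "finite S" "S \<noteq> {}" "S \<subseteq> cops n" using states_invariant[OF S(2)] by auto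
    have S\<C>: "S \<subseteq> \<C>" using inv(3) cops_subset by blast
    have small: "card (\<Union>S) \<le> K" if "\<not> (\<exists>D. open_copy D S)"
    proof -
      have "e * ((2 * v + 2) * d + 1) \<le> K" unfolding K using S(1) by (intro mult_le_mono2 add_le_mono1) simp
      then show ?thesis using no_open_small[OF S(2) that] by linarith
    qed
    have sep: "\<exists>C\<in>\<C>. C \<subseteq> B \<and> \<not> C \<subseteq> \<Union>S \<and> C \<inter> D \<noteq> {}" if D: "open_copy D S" for D
    proof -
      obtain e1 e2 where e: "e1 \<in> D" "e2 \<in> D" "e1 \<noteq> e2" "D \<in> S"
        and eq: "\<And>C. C \<in> \<C> \<Longrightarrow> C \<subseteq> \<Union>S \<Longrightarrow> (e1 \<in> C \<longleftrightarrow> e2 \<in> C)"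
        using D unfolding open_copy_def by blast
      then have "e1 \<in> B" "e2 \<in> B" using S(3) by blast+
      then obtain C where C: "C \<in> \<C>" "C \<subseteq> B" "(e1 \<in> C) \<noteq> (e2 \<in> C)"
        using minimal_uncolourable_separates[OF B(1,2) _ _ e(3)] by blast
      then have "\<not> C \<subseteq> \<Union>S" using eq[OF C(1)] by blast
      moreover have "C \<inter> D \<noteq> {}" using C(3) e by blast
      ultimately show ?thesis using C by blast
    qed
    have "\<exists>C\<in>\<C>. C \<subseteq> B \<and> \<not> C \<subseteq> \<Union>S \<and> C \<inter> allowed K S \<noteq> {}"
    proof -
      consider "\<exists>D. half_open D S" | "\<not> (\<exists>D. half_open D S)" "\<exists>D. open_copy D S" | "\<not> (\<exists>D. open_copy D S)" by blast
      then show ?thesis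
      proof cases
        case 1
        then have "half_open (allowed K S) S" by (rule half_open_allowed)
        then show ?thesis using sep unfolding half_open_def by blast
      next
        case 2
        then have "open_copy (allowed K S) S" by (rule open_copy_allowed)
        then show ?thesis using sep by blast
      next
        case 3
        then have no: "\<not> (\<exists>D. half_open D S)" unfolding half_open_def by blast
        then have al: "allowed K S = \<Union>S" using allowed_no_open 3 small[OF 3] by simp
        have "\<Union>S \<noteq> B" using False small[OF 3] by blast
        then have "\<Union>S \<subset> B" using S(3) by blast
        moreover have "\<Union>S \<noteq> {}"
        proof -
          obtain D where "D \<in> S" using inv(2) by blast
          then have "card D = e" "D \<in> S" using copy_facts(1) S\<C> by blast+
          then have "D \<noteq> {}" using card_E by auto
          then show ?thesis using \<open>D \<in> S\<close> by blast
        qed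
        ultimately obtain C where "C \<in> \<C>" "C \<subseteq> B" "C \<inter> \<Union>S \<noteq> {}" "\<not> C \<subseteq> \<Union>S"
          using minimal_uncolourable_connected[OF B(1,2)] by meson
        then show ?thesis unfolding al by blast
      qed
    qed
    then obtain C g where C: "C \<in> \<C>" "C \<subseteq> B" "\<not> C \<subseteq> \<Union>S" "g \<in> C" "g \<in> allowed K S" by blast
    have Cn: "C \<in> cops n" unfolding cops_def using C(1,2) B(3) by blast
    have gS: "g \<in> \<Union>S" using C(5) allowed_subset by blast
    have sub: "\<Union>(insert C S) \<subseteq> B" using C(2) S(3) by simp
    show ?thesis
    proof (cases "\<Union>C \<inter> \<Union>(\<Union>S) = g")
      case True
      then have "C \<in> regular K n S" unfolding regular_def using Cn C(4,5) by blast
      then have "insert C S \<in> extensions (regular K n) (states K n i d)"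
        unfolding extensions_def using S(2) by blast
      then have "insert C S \<in> states K n (Suc i) d" by (cases d) auto
      then show ?thesis using sub S(1) by blast
    next
      \<comment> \<open>The new copy shares the edge \<open>g\<close> and at least one further
        vertex, so the step is degenerate.\<close>
      case neq: False
      have "g \<subseteq> \<Union>C \<inter> \<Union>(\<Union>S)" using C(4) gS by blast
      then have "g \<subset> \<Union>C \<inter> \<Union>(\<Union>S)" using neq by blast
      then have "card g < card (\<Union>C \<inter> \<Union>(\<Union>S))" using copy_facts(4)[OF C(1)] by (intro psubset_card_mono) auto
      then have "l + 1 \<le> card (\<Union>C \<inter> \<Union>(\<Union>S))" using copy_facts(5)[OF C(1,4)] by simp
      then have "C \<in> degenerate n S" unfolding degenerate_def using Cn C(3) by blast
      then have "insert C S \<in> extensions (degenerate n) (states K n i d)"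
        unfolding extensions_def using S(2) by blast
      then have st: "insert C S \<in> states K n (Suc i) (Suc d)" by simp
      show ?thesis
      proof (cases "Suc d = k")
        case True
        then show ?thesis using st sub by blast
      next
        case False
        then have "Suc d < k" using S(1) by simp
        then show ?thesis using st sub by blast
      qed
    qed
  qed
qed

end

section \<open>Probability estimates\<close>

text \<open>An inequality, so as to include sets \<open>D\<close> that are not made of possible
  edges and have probability 0.\<close>

lemma prob_subset_edges:
  assumes p: "0 \<le> p" "p \<le> 1" and D: "finite D"
  shows "measure_pmf.prob (random_lgraph l n p) {G. D \<subseteq> edges G} \<le> p ^ card D"
proof -
  let ?A = "edges (complete_lgraph l n)"
  let ?P = "Pi_pmf ?A False (\<lambda>_. bernoulli_pmf p)"
  have finA: "finite ?A" unfolding complete_lgraph_def by simp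
  have eq: "measure_pmf.prob (random_lgraph l n p) {G. D \<subseteq> edges G} =
      measure_pmf.prob ?P {f. D \<subseteq> ?A \<and> (\<forall>x\<in>D. f x)}"
    unfolding random_lgraph_def measure_map_pmf by (rule arg_cong[where f = "measure_pmf.prob ?P"]) auto
  show ?thesis
  proof (cases "D \<subseteq> ?A")
    case True
    let ?B = "\<lambda>x. if x \<in> D then {True} else UNIV"
    have "{f. D \<subseteq> ?A \<and> (\<forall>x\<in>D. f x)} = Pi ?A ?B"
      using True by (auto simp: Pi_def)
    then have "measure_pmf.prob ?P {f. D \<subseteq> ?A \<and> (\<forall>x\<in>D. f x)} =
        (\<Prod>x\<in>?A. measure_pmf.prob (bernoulli_pmf p) (?B x))"
      by (simp add: measure_Pi_pmf_Pi[OF finA])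
    also have "\<dots> = (\<Prod>x\<in>?A. if x \<in> D then p else 1)"
      using p by (intro prod.cong refl) (simp add: measure_pmf_single)
    also have "\<dots> = p ^ card (?A \<inter> D)"
      using finA by (simp add: prod.If_cases)
    also have "?A \<inter> D = D" using True by blast
    finally show ?thesis using eq by simp
  next
    case False
    then have emp: "{f. D \<subseteq> ?A \<and> (\<forall>x\<in>D. f x)} = {}" by blast
    show ?thesis unfolding eq emp using p by simp
  qed
qed

lemma prob_UN_le:
  assumes "finite I" and "\<And>i. i \<in> I \<Longrightarrow> measure_pmf.prob M (A i) \<le> b i"
  shows "measure_pmf.prob M (\<Union>i\<in>I. A i) \<le> (\<Sum>i\<in>I. b i)"
proof -
  have "measure_pmf.prob M (\<Union>i\<in>I. A i) \<le> (\<Sum>i\<in>I. measure_pmf.prob M (A i))"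
    using assms(1) by (intro measure_pmf.finite_measure_subadditive_finite) auto
  also have "\<dots> \<le> (\<Sum>i\<in>I. b i)" using assms(2) by (rule sum_mono)
  finally show ?thesis .
qed

lemma whpI:
  assumes "(\<lambda>n. measure_pmf.prob (M n) {x. \<not> P x}) \<longlonglongrightarrow> 0"
  shows "whp M P"
proof -
  have eq: "measure_pmf.prob (M n) {x. P x} = 1 - measure_pmf.prob (M n) {x. \<not> P x}" for n
  proof -
    have "{x. \<not> P x} = space (measure_pmf (M n)) - {x. P x}" by auto
    then show ?thesis using measure_pmf.prob_compl[of "{x. P x}" "M n"] by simp
  qed
  have "(\<lambda>n. 1 - measure_pmf.prob (M n) {x. \<not> P x}) \<longlonglongrightarrow> 1 - 0"
    by (intro tendsto_diff tendsto_const assms)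
  then show ?thesis unfolding whp_def eq by simp
qed

lemma sum_UN_le_nonneg:
  fixes f :: "'x \<Rightarrow> real"
  assumes "finite Z" "\<And>z. z \<in> Z \<Longrightarrow> finite (A z)" "D \<subseteq> (\<Union>z\<in>Z. A z)"
    and "\<And>z x. z \<in> Z \<Longrightarrow> x \<in> A z \<Longrightarrow> 0 \<le> f x"
  shows "sum f D \<le> (\<Sum>z\<in>Z. sum f (A z))"
proof -
  let ?S = "Sigma Z A"
  have fin: "finite ?S" using assms by auto
  have "sum f D \<le> sum f (snd ` ?S)"
    using assms fin by (intro sum_mono2) force+
  also have "\<dots> \<le> sum (f \<circ> snd) ?S"
    using assms fin by (intro sum_image_le) auto
  also have "\<dots> = (\<Sum>z\<in>Z. sum f (A z))"
    using assms by (subst sum.Sigma) (auto simp: case_prod_unfold comp_def)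
  finally show ?thesis .
qed

text \<open>Vertices in \<open>U\<close> go to the explored set \<open>X\<close>, the others
  anywhere. Injectivity is not imposed, since only upper bounds are wanted.\<close>

definition embeddings :: "'a set \<Rightarrow> nat \<Rightarrow> 'a set \<Rightarrow> nat set \<Rightarrow> ('a \<Rightarrow> nat) set" where
  "embeddings V n U X = PiE V (\<lambda>x. if x \<in> U then X else {..<n})"

lemma finite_embeddings: "finite V \<Longrightarrow> finite X \<Longrightarrow> finite (embeddings V n U X)"
  unfolding embeddings_def by (intro finite_PiE) auto

lemma card_embeddings:
  assumes "finite V" "U \<subseteq> V" shows "card (embeddings V n U X) = card X ^ card U * n ^ (card V - card U)"
proof -
  have "card (embeddings V n U X) = (\<Prod>x\<in>V. if x \<in> U then card X else n)"
    unfolding embeddings_def using assms(1) by (subst card_PiE) (auto intro: prod.cong)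
  also have "\<dots> = card X ^ card (V \<inter> U) * n ^ card (V \<inter> - U)"
    using assms(1) by (simp add: prod.If_cases)
  also have "V \<inter> U = U" using assms(2) by blast
  also have "V \<inter> - U = V - U" by blast
  also have "card (V - U) = card V - card U" using assms by (meson card_Diff_subset finite_subset)
  finally show ?thesis .
qed

section \<open>Counting regular and degenerate extensions\<close>

context template
begin

lemma cops_embedding:
  assumes "C \<in> cops n"
  obtains \<phi> where "inj_on \<phi> V" "\<phi> \<in> extensional V" "C = (\<lambda>a. \<phi> ` a) ` E" "\<Union>C = \<phi> ` V" "\<phi> ` V \<subseteq> {..<n}"
proof -
  have C: "C \<in> \<C>" using cops_subset assms by (rule subsetD)
  obtain \<phi> where \<phi>: "inj_on \<phi> V" "C = (\<lambda>a. \<phi> ` a) ` E" "\<Union>C = \<phi> ` V"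
    using copyE[OF C] .
  define f where "f = restrict \<phi> V"
  have fx: "f x = \<phi> x" if "x \<in> V" for x unfolding f_def using that by simp
  have inj: "inj_on f V" unfolding f_def using \<phi>(1) by (simp add: inj_on_restrict_eq)
  have im: "f ` V = \<phi> ` V" by (rule image_cong[OF refl fx])
  have fa: "f ` a = \<phi> ` a" if "a \<in> E" for a
  proof (rule image_cong[OF refl])
    fix x assume x: "x \<in> a"
    have "a \<subseteq> V" using edge[OF that] by simp
    then have "x \<in> V" using x by (rule subsetD)
    then show "f x = \<phi> x" by (rule fx)
  qed
  have "(\<lambda>a. f ` a) ` E = (\<lambda>a. \<phi> ` a) ` E" by (rule image_cong[OF refl fa])
  then have Cf: "C = (\<lambda>a. f ` a) ` E" using \<phi>(2) by (rule trans[OF _ sym, rotated])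
  have UC: "\<Union>C = f ` V" using \<phi>(3) im by (rule trans[OF _ sym])
  have "\<Union>C \<subseteq> {..<n}" using assms unfolding cops_def by blast
  then have rng: "f ` V \<subseteq> {..<n}" unfolding UC .
  have ext: "f \<in> extensional V" unfolding f_def by (rule restrict_extensional)
  show thesis by (rule that[OF inj ext Cf UC rng])
qed

lemma finite_cops: "finite (cops n)"
proof (rule finite_subset)
  show "cops n \<subseteq> Pow (Pow {..<n})"
  proof
    fix C assume "C \<in> cops n"
    then have "\<Union>C \<subseteq> {..<n}" unfolding cops_def by blast
    then show "C \<in> Pow (Pow {..<n})" by blast
  qed
qed simp

text \<open>The choices are the allowed edge \<open>g\<close>, its preimage \<open>a\<close>, the
  map from \<open>a\<close> to \<open>g\<close>, and the images of the remaining
  \<open>v - l\<close> vertices.\<close>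

lemma card_regular:
  assumes fin: "finite (allowed K S)" and c: "card (allowed K S) \<le> K"
  shows "card (regular K n S) \<le> K * e * (l ^ l * n ^ (v - l))"
proof -
  let ?A = "{g \<in> allowed K S. card g = l \<and> finite g}"
  let ?F = "\<lambda>(g, a). (\<lambda>\<phi>. (\<lambda>a. \<phi> ` a) ` E) ` embeddings V n a g"
  have sub: "regular K n S \<subseteq> (\<Union>z\<in>?A \<times> E. ?F z)"
  proof
    fix C assume "C \<in> regular K n S"
    then obtain g where g: "C \<in> cops n" "g \<in> C" "g \<in> allowed K S" unfolding regular_def by blast
    obtain \<phi> where \<phi>: "inj_on \<phi> V" "\<phi> \<in> extensional V" "C = (\<lambda>a. \<phi> ` a) ` E" "\<Union>C = \<phi> ` V" "\<phi> ` V \<subseteq> {..<n}"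
      using cops_embedding[OF g(1)] .
    obtain a where a: "a \<in> E" "g = \<phi> ` a" using g(2) \<phi>(3) by blast
    have "\<phi> \<in> embeddings V n a g" unfolding embeddings_def using \<phi>(2,5) a(2) by (auto simp: PiE_def)
    then have "C \<in> ?F (g, a)" using \<phi>(3) by auto
    moreover have "g \<in> ?A" using g copy_facts(5,6)[of C g] cops_subset by blast
    ultimately show "C \<in> (\<Union>z\<in>?A \<times> E. ?F z)" using a(1) by blast
  qed
  have finF: "finite (?F z)" if "z \<in> ?A \<times> E" for z
    using that finite_embeddings[OF finV] by auto
  have cF: "card (?F z) \<le> l ^ l * n ^ (v - l)" if z: "z \<in> ?A \<times> E" for z
  proof -
    obtain g a where ga: "z = (g, a)" "card g = l" "finite g" "a \<in> E" using z by auto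
    have "card (?F z) \<le> card (embeddings V n a g)"
      unfolding ga(1) by (simp add: card_image_le finite_embeddings[OF finV ga(3)])
    also have "\<dots> = l ^ l * n ^ (v - l)" using card_embeddings[OF finV, of a n g] edge[OF ga(4)] ga(2) by simp
    finally show ?thesis .
  qed
  have finAE: "finite (?A \<times> E)" using fin finE by simp
  have "card (regular K n S) \<le> card (\<Union>z\<in>?A \<times> E. ?F z)"
    using sub finAE finF by (intro card_mono) auto
  also have "\<dots> \<le> (\<Sum>z\<in>?A \<times> E. card (?F z))" by (rule card_UN_le[OF finAE])
  also have "\<dots> \<le> (\<Sum>z\<in>?A \<times> E. l ^ l * n ^ (v - l))" by (rule sum_mono) (rule cF)
  also have "\<dots> = card ?A * e * (l ^ l * n ^ (v - l))" by (simp add: card_cartesian_product)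
  also have "card ?A \<le> K" using card_mono[OF fin, of ?A] c by auto
  then have "card ?A * e * (l ^ l * n ^ (v - l)) \<le> K * e * (l ^ l * n ^ (v - l))" by (intro mult_le_mono1)
  finally show ?thesis .
qed

text \<open>The possible shapes of what a degenerate copy shares with the explored part, pulled back
  to the template: vertices \<open>U\<close> and edges \<open>J\<close>.\<close>

definition overlaps :: "('a set \<times> 'a set set) set" where
  "overlaps = {(U, J). U \<subseteq> V \<and> J \<subseteq> E \<and> \<Union>J \<subseteq> U \<and> l + 1 \<le> card U \<and> J \<noteq> E}"

lemma finite_overlaps: "finite overlaps" and card_overlaps: "card overlaps \<le> 2 ^ v * 2 ^ e"
proof -
  have sub: "overlaps \<subseteq> Pow V \<times> Pow E" unfolding overlaps_def by blast
  have fin: "finite (Pow V \<times> Pow E)" using finV finE by simp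
  show "finite overlaps" using sub fin by (rule finite_subset)
  have "card overlaps \<le> card (Pow V \<times> Pow E)" using fin sub by (rule card_mono)
  then show "card overlaps \<le> 2 ^ v * 2 ^ e"
    by (simp only: card_cartesian_product card_Pow[OF finV] card_Pow[OF finE])
qed

end

context template
begin

text \<open>Copies are grouped by overlap. Given \<open>(U, J)\<close>, a copy has
  \<open>v - card U\<close> free vertices and \<open>e - card J\<close> new edges, and at most
  \<open>x ^ v\<close> ways of placing \<open>U\<close> in the explored part.\<close>

lemma sum_degenerate:
  fixes p \<beta> :: real
  assumes S: "finite S" "S \<subseteq> \<C>" and x: "card (\<Union>(\<Union>S)) \<le> x" "1 \<le> x" and p: "0 \<le> p"
    and \<beta>: "\<And>U J. (U, J) \<in> overlaps \<Longrightarrow> real n ^ (v - card U) * p ^ (e - card J) \<le> \<beta>"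
  shows "(\<Sum>C\<in>degenerate n S. p ^ card (C - \<Union>S)) \<le> 2 ^ v * 2 ^ e * (real x ^ v * \<beta>)"
proof -
  let ?X = "\<Union>(\<Union>S)"
  have finX: "finite ?X" using card_Union_state(4)[OF S] .
  let ?F = "\<lambda>z. {C. C \<in> (\<lambda>\<phi>. (\<lambda>a. \<phi> ` a) ` E) ` embeddings V n (fst z) ?X \<and> card (C - \<Union>S) = e - card (snd z)}"
  have sub: "degenerate n S \<subseteq> (\<Union>z\<in>overlaps. ?F z)"
  proof
    fix C assume C: "C \<in> degenerate n S"
    then have C': "C \<in> cops n" "\<not> C \<subseteq> \<Union>S" "l + 1 \<le> card (\<Union>C \<inter> ?X)" unfolding degenerate_def by auto
    have CC: "C \<in> \<C>" using C'(1) cops_subset by blast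
    obtain \<phi> where \<phi>: "inj_on \<phi> V" "\<phi> \<in> extensional V" "C = (\<lambda>a. \<phi> ` a) ` E" "\<Union>C = \<phi> ` V" "\<phi> ` V \<subseteq> {..<n}"
      using cops_embedding[OF C'(1)] .
    define U where "U = {x \<in> V. \<phi> x \<in> ?X}"
    define J where "J = {a \<in> E. \<phi> ` a \<in> \<Union>S}"
    have "\<phi> ` U = \<Union>C \<inter> ?X" unfolding U_def \<phi>(4) by auto
    moreover have "card (\<phi> ` U) = card U" unfolding U_def by (intro card_image inj_on_subset[OF \<phi>(1)]) auto
    ultimately have cU: "l + 1 \<le> card U" using C'(3) by simp
    have JU: "\<Union>J \<subseteq> U" unfolding J_def U_def using edge by blast
    have JE: "J \<noteq> E" using C'(2) \<phi>(3) unfolding J_def by blast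
    have "(\<lambda>a. \<phi> ` a) ` J = C \<inter> \<Union>S" unfolding J_def \<phi>(3) by auto
    moreover have "card ((\<lambda>a. \<phi> ` a) ` J) = card J"
      unfolding J_def by (intro card_image inj_on_subset[OF inj_on_image_edges[OF \<phi>(1) EP]]) auto
    moreover have "card (C - \<Union>S) = card C - card (C \<inter> \<Union>S)"
      using copy_facts(3)[OF CC] by (intro card_Diff_subset_Int) simp
    ultimately have "card (C - \<Union>S) = e - card J" using copy_facts(1)[OF CC] by simp
    moreover have "\<phi> \<in> embeddings V n U ?X"
      unfolding embeddings_def U_def using \<phi>(2,5) by (auto simp: PiE_def)
    ultimately have inF: "C \<in> ?F (U, J)" using \<phi>(3) by auto
    have inO: "(U, J) \<in> overlaps" unfolding overlaps_def using cU JU JE by (auto simp: U_def J_def)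
    show "C \<in> (\<Union>z\<in>overlaps. ?F z)" by (rule UN_I[OF inO], rule inF)
  qed
  have finF: "finite (?F z)" for z
  proof -
    have "?F z \<subseteq> (\<lambda>\<phi>. (\<lambda>a. \<phi> ` a) ` E) ` embeddings V n (fst z) ?X" by (rule subsetI) simp
    moreover have "finite ((\<lambda>\<phi>. (\<lambda>a. \<phi> ` a) ` E) ` embeddings V n (fst z) ?X)"
      by (rule finite_imageI[OF finite_embeddings[OF finV finX]])
    ultimately show ?thesis by (rule finite_subset)
  qed
  have F: "(\<Sum>C\<in>?F z. p ^ card (C - \<Union>S)) \<le> real x ^ v * \<beta>" if z: "z \<in> overlaps" for z
  proof -
    obtain U J where UJ: "z = (U, J)" "U \<subseteq> V" using z unfolding overlaps_def by blast
    have \<beta>z: "real n ^ (v - card U) * p ^ (e - card J) \<le> \<beta>" using \<beta> z UJ by blast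
    have "(\<Sum>C\<in>?F z. p ^ card (C - \<Union>S)) = (\<Sum>C\<in>?F z. p ^ (e - card J))"
      by (rule sum.cong[OF refl]) (simp add: UJ(1))
    also have "\<dots> = real (card (?F z)) * p ^ (e - card J)" by (rule sum_constant)
    finally have eq: "(\<Sum>C\<in>?F z. p ^ card (C - \<Union>S)) = real (card (?F z)) * p ^ (e - card J)" .
    have "card (?F z) \<le> card (embeddings V n U ?X)"
    proof -
      have "?F z \<subseteq> (\<lambda>\<phi>. (\<lambda>a. \<phi> ` a) ` E) ` embeddings V n U ?X"
        by (rule subsetI) (simp add: UJ(1))
      then have "card (?F z) \<le> card ((\<lambda>\<phi>. (\<lambda>a. \<phi> ` a) ` E) ` embeddings V n U ?X)"
        by (rule card_mono[OF finite_imageI[OF finite_embeddings[OF finV finX]]])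
      also have "\<dots> \<le> card (embeddings V n U ?X)" by (rule card_image_le[OF finite_embeddings[OF finV finX]])
      finally show ?thesis .
    qed
    then have "real (card (?F z)) * p ^ (e - card J) \<le> real (card (embeddings V n U ?X)) * p ^ (e - card J)"
      using p by (intro mult_right_mono) auto
    also have "\<dots> = real (card ?X) ^ card U * (real n ^ (v - card U) * p ^ (e - card J))"
      unfolding card_embeddings[OF finV UJ(2)] by simp
    also have "\<dots> \<le> real x ^ card U * (real n ^ (v - card U) * p ^ (e - card J))"
      using x p by (intro mult_right_mono power_mono) auto
    also have "\<dots> \<le> real x ^ v * (real n ^ (v - card U) * p ^ (e - card J))"
      using x p card_mono[OF finV UJ(2)] by (intro mult_right_mono power_increasing) auto
    also have "\<dots> \<le> real x ^ v * \<beta>" using \<beta>z by (intro mult_left_mono) auto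
    finally show ?thesis unfolding eq .
  qed
  have "(\<Sum>C\<in>degenerate n S. p ^ card (C - \<Union>S)) \<le> (\<Sum>z\<in>overlaps. \<Sum>C\<in>?F z. p ^ card (C - \<Union>S))"
    using p by (intro sum_UN_le_nonneg finite_overlaps finF sub) auto
  also have "\<dots> \<le> (\<Sum>z\<in>overlaps. real x ^ v * \<beta>)" by (rule sum_mono) (rule F)
  also have "\<dots> = real (card overlaps) * (real x ^ v * \<beta>)" by simp
  also have "\<dots> \<le> (2 ^ v * 2 ^ e) * (real x ^ v * \<beta>)"
  proof (cases "overlaps = {}")
    case False
    then obtain U J where "(U, J) \<in> overlaps" by auto
    have "0 \<le> real n ^ (v - card U) * p ^ (e - card J)" using p by simp
    also have "\<dots> \<le> \<beta>" using \<beta> \<open>(U, J) \<in> overlaps\<close> .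
    finally have "0 \<le> real x ^ v * \<beta>" by simp
    moreover have "real (card overlaps) \<le> 2 ^ v * 2 ^ e"
      using of_nat_mono[OF card_overlaps, where 'a = real] by simp
    ultimately show ?thesis by (intro mult_right_mono)
  next
    case True
    have "V \<subseteq> V \<and> {} \<subseteq> E \<and> \<Union>{} \<subseteq> V \<and> l + 1 \<le> card V \<and> {} \<noteq> E" using card_V card_E by auto
    then have "(V, {}) \<in> overlaps" unfolding overlaps_def by auto
    then show ?thesis using True by simp
  qed
  finally show ?thesis .
qed

end

lemma finite_positive_lower_bound:
  fixes f :: "'x \<Rightarrow> real"
  assumes "finite A" "\<And>x. x \<in> A \<Longrightarrow> 0 < f x"
  shows "\<exists>\<epsilon>>0. \<forall>x\<in>A. \<epsilon> \<le> f x"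
proof (intro exI conjI ballI)
  let ?M = "Min (insert 1 (f ` A))"
  show "0 < ?M" using assms by simp
  show "?M \<le> f x" if "x \<in> A" for x using assms(1) that by simp
qed

lemma polylog_less_powr:
  fixes A B :: real
  assumes "0 < g"
  shows "\<forall>\<^sub>F n in sequentially. A * (B * ln (real n) + 2 * B) ^ k \<le> real n powr g"
proof -
  \<comment> \<open>\<open>n powr g\<close> is split into \<open>k + 1\<close> equal factors, one
    for each logarithm and one for the constant \<open>A\<close>.\<close>
  define h where "h = g / (real k + 1)"
  have h: "0 < h" using assms unfolding h_def by simp
  have "(\<lambda>n. (B * ln (real n) + 2 * B) / real n powr h) \<longlonglongrightarrow> 0" "(\<lambda>n. 1 / real n powr h) \<longlonglongrightarrow> 0"
    using h by real_asymp+
  then have lim: "(\<lambda>n. A * ((B * ln (real n) + 2 * B) / real n powr h) ^ k * (1 / real n powr h)) \<longlonglongrightarrow> A * 0 ^ k * 0"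
    by (intro tendsto_intros)
  have pt: "A * ((B * ln (real n) + 2 * B) / real n powr h) ^ k * (1 / real n powr h) =
      (A * (B * ln (real n) + 2 * B) ^ k) / real n powr g" if "0 < n" for n
  proof -
    have "(real n powr h) ^ k * real n powr h = real n powr (h * real k + h)"
      using that by (simp add: powr_add powr_powr flip: powr_realpow)
    also have "h * real k + h = h * (real k + 1)" by (simp add: algebra_simps)
    also have "real k + 1 \<noteq> 0" by linarith
    then have "h * (real k + 1) = g" unfolding h_def by simp
    finally show ?thesis by (simp add: power_divide)
  qed
  have "\<forall>\<^sub>F n in sequentially. A * ((B * ln (real n) + 2 * B) / real n powr h) ^ k * (1 / real n powr h) =
      (A * (B * ln (real n) + 2 * B) ^ k) / real n powr g"
    by (rule eventually_mono[OF eventually_gt_at_top[of 0]]) (rule pt)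
  then have "(\<lambda>n. (A * (B * ln (real n) + 2 * B) ^ k) / real n powr g) \<longlonglongrightarrow> 0"
    using lim tendsto_cong by fastforce
  then have "\<forall>\<^sub>F n in sequentially. (A * (B * ln (real n) + 2 * B) ^ k) / real n powr g < 1"
    by (rule order_tendstoD(2)) simp
  moreover have "\<forall>\<^sub>F n in sequentially. 0 < n" by (rule eventually_gt_at_top)
  ultimately show ?thesis
    by eventually_elim (simp add: field_simps)
qed

section \<open>Expected number of states present in the random hypergraph\<close>

context template
begin

text \<open>A union bound for the probability that some state in \<open>Q\<close> has all its edges
  present.\<close>

definition weight :: "real \<Rightarrow> nat set set set set \<Rightarrow> real" where
  "weight p Q = (\<Sum>S\<in>Q. p ^ card (\<Union>S))"

lemma finite_states: "finite (states K n i d)"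
proof (rule finite_subset)
  show "states K n i d \<subseteq> Pow (cops n)" using states_invariant by blast
  show "finite (Pow (cops n))" using finite_cops by simp
qed

lemma card_cops: "card (cops n) \<le> n ^ v"
proof -
  have "cops n \<subseteq> (\<lambda>\<phi>. (\<lambda>a. \<phi> ` a) ` E) ` embeddings V n {} {}"
  proof
    fix C assume "C \<in> cops n"
    then obtain \<phi> where \<phi>: "inj_on \<phi> V" "\<phi> \<in> extensional V" "C = (\<lambda>a. \<phi> ` a) ` E" "\<Union>C = \<phi> ` V" "\<phi> ` V \<subseteq> {..<n}"
      using cops_embedding by metis
    have "\<phi> \<in> embeddings V n {} {}" unfolding embeddings_def using \<phi>(2,5) by (auto simp: PiE_def)
    then show "C \<in> (\<lambda>\<phi>. (\<lambda>a. \<phi> ` a) ` E) ` embeddings V n {} {}" by (intro image_eqI[where x = \<phi>]) (rule \<phi>(3))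
  qed
  then have "card (cops n) \<le> card ((\<lambda>\<phi>. (\<lambda>a. \<phi> ` a) ` E) ` embeddings V n {} {})"
    using finite_embeddings[OF finV] by (intro card_mono finite_imageI) auto
  also have "\<dots> \<le> card (embeddings V n {} {})" by (intro card_image_le finite_embeddings finV) simp
  also have "\<dots> = n ^ v" using card_embeddings[OF finV, of "{}" n "{}"] by simp
  finally show ?thesis .
qed

text \<open>The weight of \<open>insert C S\<close> factors into that of \<open>S\<close> and that
  of the new edges; a set reached in several ways is merely counted several times on the
  right.\<close>

lemma weight_extensions:
  assumes p: "0 \<le> p" and Q: "finite Q" "\<And>S. S \<in> Q \<Longrightarrow> finite S \<and> S \<subseteq> \<C>"
    and R: "\<And>S. S \<in> Q \<Longrightarrow> R S \<subseteq> cops n" "\<And>S. S \<in> Q \<Longrightarrow> (\<Sum>C\<in>R S. p ^ card (C - \<Union>S)) \<le> a"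
  shows "weight p (extensions R Q) \<le> a * weight p Q"
proof -
  have finR: "finite (R S)" if "S \<in> Q" for S using R(1)[OF that] finite_cops by (rule finite_subset)
  have eq: "extensions R Q = (\<lambda>(S, C). insert C S) ` Sigma Q R" unfolding extensions_def by auto
  have "weight p (extensions R Q) \<le> (\<Sum>z\<in>Sigma Q R. ((\<lambda>S. p ^ card (\<Union>S)) \<circ> (\<lambda>(S, C). insert C S)) z)"
    unfolding weight_def eq using Q(1) finR p by (intro sum_image_le) auto
  also have "\<dots> = (\<Sum>S\<in>Q. \<Sum>C\<in>R S. p ^ card (\<Union>(insert C S)))"
    using Q(1) finR by (subst sum.Sigma) (auto simp: case_prod_unfold)
  also have "\<dots> = (\<Sum>S\<in>Q. p ^ card (\<Union>S) * (\<Sum>C\<in>R S. p ^ card (C - \<Union>S)))"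
  proof (rule sum.cong[OF refl])
    fix S assume S: "S \<in> Q"
    have "p ^ card (\<Union>(insert C S)) = p ^ card (\<Union>S) * p ^ card (C - \<Union>S)" if "C \<in> R S" for C
    proof -
      have "C \<in> \<C>" using that R(1)[OF S] cops_subset by blast
      then have finC: "finite C" by (rule copy_facts(3))
      have finS: "finite (\<Union>S)" using card_Union_state(3) Q(2)[OF S] by blast
      have "card (\<Union>S \<union> (C - \<Union>S)) = card (\<Union>S) + card (C - \<Union>S)"
        using finC finS by (intro card_Un_disjoint) auto
      moreover have "\<Union>(insert C S) = \<Union>S \<union> (C - \<Union>S)" by auto
      ultimately have "card (\<Union>(insert C S)) = card (\<Union>S) + card (C - \<Union>S)" by simp
      then show ?thesis by (simp add: power_add)
    qed
    then show "(\<Sum>C\<in>R S. p ^ card (\<Union>(insert C S))) = p ^ card (\<Union>S) * (\<Sum>C\<in>R S. p ^ card (C - \<Union>S))"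
      by (simp add: sum_distrib_left)
  qed
  also have "\<dots> \<le> (\<Sum>S\<in>Q. p ^ card (\<Union>S) * a)"
    using R(2) p by (intro sum_mono mult_left_mono) auto
  also have "\<dots> = a * weight p Q" unfolding weight_def by (simp add: sum_distrib_left mult.commute)
  finally show ?thesis .
qed

lemma weight_Un_le: "0 \<le> p \<Longrightarrow> finite P \<Longrightarrow> finite Q \<Longrightarrow> weight p (P \<union> Q) \<le> weight p P + weight p Q"
  unfolding weight_def using sum.union_inter[of P Q "\<lambda>S. p ^ card (\<Union>S)"] sum_nonneg[of "P \<inter> Q" "\<lambda>S. p ^ card (\<Union>S)"]
  by simp

text \<open>One step must halve the bound. Regular extensions use one quarter, and since
  \<open>b * (4 * b) ^ d' = (4 * b) ^ Suc d' / 4\<close>, degenerate ones use the other.\<close>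

lemma weight_states:
  assumes p: "0 \<le> p" "p \<le> 1" and ab: "a \<le> 1 / 4" "0 < b"
    and reg: "\<And>i d S. i < T \<Longrightarrow> S \<in> states K n i d \<Longrightarrow> (\<Sum>C\<in>regular K n S. p ^ card (C - \<Union>S)) \<le> a"
    and dege: "\<And>i d S. i < T \<Longrightarrow> S \<in> states K n i d \<Longrightarrow> (\<Sum>C\<in>degenerate n S. p ^ card (C - \<Union>S)) \<le> b"
  shows "i \<le> T \<Longrightarrow> weight p (states K n i d) \<le> real n ^ v * (1 / 2) ^ i * (4 * b) ^ d"
proof (induction i arbitrary: d)
  case 0
  show ?case
  proof (cases d)
    case [simp]: 0
    have "weight p (states K n 0 0) \<le> (\<Sum>S\<in>states K n 0 0. 1)"
      unfolding weight_def using p by (intro sum_mono power_le_one)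
    also have "\<dots> = real (card ((\<lambda>C. {C}) ` cops n))"
      by (simp add: Setcompr_eq_image)
    also have "\<dots> = real (card (cops n))" by (simp add: card_image inj_on_def)
    also have "\<dots> \<le> real (n ^ v)" using card_cops by (intro of_nat_mono)
    finally show ?thesis by simp
  next
    case (Suc d')
    then show ?thesis using ab by (simp add: weight_def)
  qed
next
  case (Suc i)
  let ?w = "\<lambda>d. real n ^ v * (1 / 2) ^ i * (4 * b) ^ d"
  have IH: "weight p (states K n i d) \<le> ?w d" for d using Suc by simp
  have w0: "0 \<le> ?w d" for d using ab by simp
  have i: "i < T" using Suc.prems by simp
  have st: "finite S \<and> S \<subseteq> \<C>" if "S \<in> states K n i d" for S d
    using states_invariant[OF that] cops_subset by blast
  have wpos: "0 \<le> weight p Q" for Q unfolding weight_def using p by (intro sum_nonneg) simp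
  have r: "weight p (extensions (regular K n) (states K n i d)) \<le> 1 / 4 * ?w d" for d
  proof -
    have "weight p (extensions (regular K n) (states K n i d)) \<le> a * weight p (states K n i d)"
      using p st reg[OF i] by (intro weight_extensions[where n = n] finite_states) (auto simp: regular_def)
    also have "\<dots> \<le> 1 / 4 * ?w d" using ab(1) IH wpos by (intro mult_mono) auto
    finally show ?thesis .
  qed
  have g: "weight p (extensions (degenerate n) (states K n i d)) \<le> b * ?w d" for d
  proof -
    have "weight p (extensions (degenerate n) (states K n i d)) \<le> b * weight p (states K n i d)"
      using p st dege[OF i] by (intro weight_extensions[where n = n] finite_states) (auto simp: degenerate_def)
    also have "\<dots> \<le> b * ?w d" using ab(2) IH by (intro mult_left_mono) auto
    finally show ?thesis .
  qed
  show ?case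
  proof (cases d)
    case 0
    then have "weight p (states K n (Suc i) d) \<le> 1 / 4 * ?w 0" using r[of 0] by simp
    also have "\<dots> \<le> 1 / 2 * ?w 0" using w0[of 0] by (intro mult_right_mono) auto
    finally show ?thesis using 0 by simp
  next
    case (Suc d')
    have fin: "finite (extensions (regular K n) (states K n i d))" "finite (extensions (degenerate n) (states K n i d'))"
      using finite_states[of K n "Suc i" d] unfolding Suc by simp_all
    have "weight p (states K n (Suc i) d) \<le>
        weight p (extensions (regular K n) (states K n i d)) + weight p (extensions (degenerate n) (states K n i d'))"
      using weight_Un_le[OF p(1) fin] by (simp add: Suc)
    also have "\<dots> \<le> 1 / 4 * ?w d + b * ?w d'" using r[of d] g[of d'] by (rule add_mono)
    also have "\<dots> = 1 / 2 * ?w d" unfolding Suc by simp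
    finally show ?thesis by simp
  qed
qed

lemma sum_regular:
  assumes S: "S \<in> states K n i d" and K: "e \<le> K" and p: "0 \<le> p"
  shows "(\<Sum>C\<in>regular K n S. p ^ card (C - \<Union>S)) \<le> real (K * e * l ^ l) * (real n ^ (v - l) * p ^ (e - 1))"
proof -
  have inv: "finite S" "S \<subseteq> \<C>" using states_invariant[OF S] cops_subset by auto
  have fin: "finite (allowed K S)" using allowed_subset card_Union_state(3)[OF inv] by (rule finite_subset)
  have "card (allowed K S) \<le> K"
  proof -
    have e: "card D \<le> K" if "D \<in> S" for D using that inv(2) copy_facts(1) K by auto
    consider "\<exists>D. half_open D S" | "\<not> (\<exists>D. half_open D S)" "\<exists>D. open_copy D S" | "\<not> (\<exists>D. half_open D S)" "\<not> (\<exists>D. open_copy D S)" by blast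
    then show ?thesis
    proof cases
      case 1
      then show ?thesis by (intro e) (simp add: half_open_allowed half_openD)
    next
      case 2
      then show ?thesis by (intro e open_copy_mem open_copy_allowed)
    next
      case 3
      then show ?thesis by (simp add: allowed_no_open)
    qed
  qed
  then have cR: "card (regular K n S) \<le> K * e * (l ^ l * n ^ (v - l))" by (rule card_regular[OF fin])
  have "p ^ card (C - \<Union>S) = p ^ (e - 1)" if C: "C \<in> regular K n S" for C
  proof -
    obtain g where g: "C \<in> \<C>" "g \<in> C" "g \<in> allowed K S" "\<Union>C \<inter> \<Union>(\<Union>S) = g"
      using C cops_subset unfolding regular_def by blast
    have "C \<inter> \<Union>S = {g}" using inter_single[OF g(1,4,2)] g(3) allowed_subset by blast
    then show ?thesis using card_Diff_subset_Int[of C "\<Union>S"] copy_facts(1)[OF g(1)] by simp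
  qed
  then have "(\<Sum>C\<in>regular K n S. p ^ card (C - \<Union>S)) = real (card (regular K n S)) * p ^ (e - 1)" by simp
  also have "\<dots> \<le> real (K * e * (l ^ l * n ^ (v - l))) * p ^ (e - 1)"
    using of_nat_mono[OF cR, where 'a = real] p by (intro mult_right_mono) auto
  finally show ?thesis by (simp add: mult.assoc)
qed

text \<open>Strict balancedness over finitely many overlaps. For \<open>p = n powr (-1 / m)\<close>
  a copy glued along one edge contributes exponent 0, and the quantity bounded here is how far an
  overlap falls below that.\<close>

lemma ex_gap: "\<exists>\<epsilon>>0. \<forall>(U, J)\<in>overlaps. \<epsilon> \<le> (real (card U) - real l) - (real (card J) - 1) / m"
proof -
  have "0 < (real (card (fst z)) - real l) - (real (card (snd z)) - 1) / m" if z0: "z \<in> overlaps" for z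
  proof -
    obtain U J where z: "z = (U, J)" "U \<subseteq> V" "J \<subseteq> E" "\<Union>J \<subseteq> U" "l + 1 \<le> card U" "J \<noteq> E"
      using z0 unfolding overlaps_def by blast
    show ?thesis using balanced[OF z(2-6)] m_pos unfolding z(1) by (simp add: field_simps)
  qed
  from finite_positive_lower_bound[OF finite_overlaps this] show ?thesis by (auto simp: case_prod_unfold)
qed

lemma powr_bounds:
  assumes n: "1 \<le> n" and c: "0 < c" "c \<le> 1" and p: "0 \<le> p" "p \<le> c * real n powr (- 1 / m)"
  shows "real n ^ (v - l) * p ^ (e - 1) \<le> c"
    and "(U, J) \<in> overlaps \<Longrightarrow> \<epsilon> \<le> (real (card U) - real l) - (real (card J) - 1) / m \<Longrightarrow>
      real n ^ (v - card U) * p ^ (e - card J) \<le> real n powr (- \<epsilon>)"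
proof -
  let ?N = "real n"
  have N: "1 \<le> ?N" "0 < ?N" using n by auto
  have pw: "p ^ j \<le> c ^ j * ?N powr (- real j / m)" for j
  proof -
    have "p ^ j \<le> (c * ?N powr (- 1 / m)) ^ j" using p by (intro power_mono)
    also have "\<dots> = c ^ j * (?N powr (- 1 / m)) powr real j" using N by (simp add: power_mult_distrib powr_realpow)
    also have "\<dots> = c ^ j * ?N powr (- real j / m)" by (simp add: powr_powr)
    finally show ?thesis .
  qed
  have "?N ^ (v - l) * p ^ (e - 1) \<le> ?N ^ (v - l) * (c ^ (e - 1) * ?N powr (- real (e - 1) / m))"
    by (intro mult_left_mono pw) simp
  also have "\<dots> = c ^ (e - 1) * (?N powr real (v - l) * ?N powr (- real (e - 1) / m))"
    using N by (simp add: powr_realpow)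
  also have "real (e - 1) / m = real (v - l)"
    using m_eq m_pos card_E card_V by (simp add: of_nat_diff field_simps)
  then have "?N powr real (v - l) * ?N powr (- real (e - 1) / m) = 1"
    using N by (simp add: powr_add[symmetric])
  also have "c ^ (e - 1) * 1 \<le> c ^ 1 * 1" using c card_E by (intro mult_right_mono power_decreasing) auto
  finally show "?N ^ (v - l) * p ^ (e - 1) \<le> c" by simp
  assume UJ: "(U, J) \<in> overlaps" and \<epsilon>: "\<epsilon> \<le> (real (card U) - real l) - (real (card J) - 1) / m"
  have U: "card U \<le> v" "card J \<le> e" using UJ finV finE unfolding overlaps_def by (auto intro: card_mono)
  have "?N ^ (v - card U) * p ^ (e - card J) \<le> ?N ^ (v - card U) * (c ^ (e - card J) * ?N powr (- real (e - card J) / m))"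
    by (intro mult_left_mono pw) simp
  also have "\<dots> \<le> ?N ^ (v - card U) * (1 * ?N powr (- real (e - card J) / m))"
    using c by (intro mult_left_mono mult_right_mono power_le_one) auto
  also have "\<dots> = ?N powr (real (v - card U) + (- real (e - card J) / m))"
    unfolding powr_add powr_realpow[OF N(2)] by simp
  also have "\<dots> \<le> ?N powr (- \<epsilon>)"
  proof (rule powr_mono[OF _ N(1)])
    have "(real v - real l) - (real e - 1) / m = 0" using m_eq m_pos by (simp add: field_simps)
    moreover have "(real (card J) - real e) / m = (real (card J) - 1) / m - (real e - 1) / m"
      by (simp add: diff_divide_distrib)
    ultimately show "real (v - card U) + (- real (e - card J) / m) \<le> - \<epsilon>"
      using \<epsilon> U by (simp add: of_nat_diff)
  qed
  finally show "?N ^ (v - card U) * p ^ (e - card J) \<le> ?N powr (- \<epsilon>)" .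
qed

end

context template
begin

text \<open>A large minimal \<open>B\<close> contains a state with \<open>k\<close> degenerate
  steps, reached within \<open>T\<close> steps, or one with fewer after exactly \<open>T\<close>
  steps. Over the step number the first bound sums to a geometric series; the second carries
  \<open>(1 / 2) ^ T\<close>.\<close>

lemma prob_exploration_le:
  assumes p: "0 \<le> p" "p \<le> 1" and k: "1 \<le> k" and K: "K = e * ((2 * v + 2) * k + 1)"
    and ab: "a \<le> 1 / 4" "0 < b" "4 * b \<le> 1"
    and reg: "\<And>i d S. i < T \<Longrightarrow> S \<in> states K n i d \<Longrightarrow> (\<Sum>C\<in>regular K n S. p ^ card (C - \<Union>S)) \<le> a"
    and dege: "\<And>i d S. i < T \<Longrightarrow> S \<in> states K n i d \<Longrightarrow> (\<Sum>C\<in>degenerate n S. p ^ card (C - \<Union>S)) \<le> b"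
  shows "measure_pmf.prob (random_lgraph l n p)
      {G. \<exists>B. B \<subseteq> edges G \<and> \<Union>B \<subseteq> {..<n} \<and> minimal_uncolourable \<C> B \<and> K < card B}
    \<le> 2 * real n ^ v * (4 * b) ^ k + real k * real n ^ v * (1 / 2) ^ T"
proof -
  let ?R = "random_lgraph l n p"
  let ?E1 = "\<Union>j\<in>{..T}. \<Union>S\<in>states K n j k. {G. \<Union>S \<subseteq> edges G}"
  let ?E2 = "\<Union>d\<in>{..<k}. \<Union>S\<in>states K n T d. {G. \<Union>S \<subseteq> edges G}"
  have sub: "{G. \<exists>B. B \<subseteq> edges G \<and> \<Union>B \<subseteq> {..<n} \<and> minimal_uncolourable \<C> B \<and> K < card B} \<subseteq> ?E1 \<union> ?E2"
  proof
    fix G assume "G \<in> {G. \<exists>B. B \<subseteq> edges G \<and> \<Union>B \<subseteq> {..<n} \<and> minimal_uncolourable \<C> B \<and> K < card B}"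
    then obtain B where B: "B \<subseteq> edges G" "\<Union>B \<subseteq> {..<n}" "minimal_uncolourable \<C> B" "K < card B" by blast
    have "finite B" using B(4) by (intro card_ge_0_finite) simp
    then consider j S where "j \<le> T" "S \<in> states K n j k" "\<Union>S \<subseteq> B"
      | d S where "d < k" "S \<in> states K n T d" "\<Union>S \<subseteq> B"
      using exploration[OF B(3) _ B(2) k K, of T] B(4) by auto
    then show "G \<in> ?E1 \<union> ?E2"
    proof cases
      case 1
      then have "\<Union>S \<subseteq> edges G" using B(1) by (meson order.trans)
      then have "G \<in> ?E1" using 1(1,2) by (intro UN_I[of j] UN_I[of S]) auto
      then show ?thesis by (rule UnI1)
    next
      case 2
      then have "\<Union>S \<subseteq> edges G" using B(1) by (meson order.trans)
      then have "G \<in> ?E2" using 2(1,2) by (intro UN_I[of d] UN_I[of S]) auto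
      then show ?thesis by (rule UnI2)
    qed
  qed
  have st: "measure_pmf.prob ?R (\<Union>S\<in>states K n i d. {G. \<Union>S \<subseteq> edges G}) \<le> real n ^ v * (1 / 2) ^ i * (4 * b) ^ d"
    if i: "i \<le> T" for i d
  proof -
    have "measure_pmf.prob ?R (\<Union>S\<in>states K n i d. {G. \<Union>S \<subseteq> edges G}) \<le> weight p (states K n i d)"
      unfolding weight_def
    proof (rule prob_UN_le[OF finite_states])
      fix S assume "S \<in> states K n i d"
      then have "finite S" "S \<subseteq> \<C>" using states_invariant cops_subset by blast+
      then have "finite (\<Union>S)" by (rule card_Union_state(3))
      then show "measure_pmf.prob ?R {G. \<Union>S \<subseteq> edges G} \<le> p ^ card (\<Union>S)" by (rule prob_subset_edges[OF p])
    qed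
    also have "\<dots> \<le> real n ^ v * (1 / 2) ^ i * (4 * b) ^ d"
      by (rule weight_states[OF p ab(1,2) reg dege i])
    finally show ?thesis .
  qed
  have "measure_pmf.prob ?R {G. \<exists>B. B \<subseteq> edges G \<and> \<Union>B \<subseteq> {..<n} \<and> minimal_uncolourable \<C> B \<and> K < card B}
      \<le> measure_pmf.prob ?R (?E1 \<union> ?E2)"
    using sub by (intro measure_pmf.finite_measure_mono) auto
  also have "\<dots> \<le> measure_pmf.prob ?R ?E1 + measure_pmf.prob ?R ?E2"
    by (intro measure_Un_le) auto
  also have "measure_pmf.prob ?R ?E1 \<le> (\<Sum>j\<in>{..T}. real n ^ v * (1 / 2) ^ j * (4 * b) ^ k)"
    using st by (intro prob_UN_le) auto
  also have "\<dots> = real n ^ v * (4 * b) ^ k * (\<Sum>j\<in>{..T}. (1 / 2) ^ j)"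
    by (simp add: sum_distrib_left ac_simps)
  also have "\<dots> \<le> real n ^ v * (4 * b) ^ k * 2"
  proof (rule mult_left_mono)
    have "(\<Sum>j\<in>{..<Suc T}. (1 / 2 :: real) ^ j) \<le> 2" by (subst geometric_sum) simp_all
    then show "(\<Sum>j\<in>{..T}. (1 / 2 :: real) ^ j) \<le> 2" by (simp only: lessThan_Suc_atMost)
  qed (use ab in simp)
  also have "measure_pmf.prob ?R ?E2 \<le> (\<Sum>d\<in>{..<k}. real n ^ v * (1 / 2) ^ T * (4 * b) ^ d)"
    using st by (intro prob_UN_le) auto
  also have "\<dots> \<le> (\<Sum>d\<in>{..<k}. real n ^ v * (1 / 2) ^ T * 1)"
    using ab by (intro sum_mono mult_left_mono power_le_one) auto
  also have "\<dots> = real k * real n ^ v * (1 / 2) ^ T" by simp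
  finally show ?thesis by (simp add: ac_simps)
qed

text \<open>The constants are free of circularity: \<open>\<epsilon>\<close> depends on the template
  only, and then \<open>k\<close>, \<open>K\<close> and \<open>c\<close> are chosen in this order,
  so \<open>c\<close> may be small in terms of \<open>K\<close>.\<close>

theorem minimal_uncolourable_small:
  shows "\<exists>c K. 0 < c \<and> c \<le> 1 \<and> (\<forall>p. (\<forall>n. 0 \<le> p n \<and> p n \<le> 1) \<longrightarrow>
    (\<forall>\<^sub>F n in sequentially. p n \<le> c * real n powr (- 1 / m)) \<longrightarrow>
    (\<lambda>n. measure_pmf.prob (random_lgraph l n (p n))
      {G. \<exists>B. B \<subseteq> edges G \<and> \<Union>B \<subseteq> {..<n} \<and> minimal_uncolourable \<C> B \<and> K < card B}) \<longlonglongrightarrow> 0)"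
proof -
  obtain \<epsilon> where \<epsilon>: "0 < \<epsilon>" "\<And>U J. (U, J) \<in> overlaps \<Longrightarrow> \<epsilon> \<le> (real (card U) - real l) - (real (card J) - 1) / m"
    using ex_gap by blast
  \<comment> \<open>At a gain of \<open>n powr (-\<epsilon> / 2)\<close> each, \<open>k\<close>
    degenerate steps must beat the \<open>n ^ v\<close> starting copies by a factor
    \<open>1 / n\<close>.\<close>
  define k where "k = nat \<lceil>2 * (real v + 1) / \<epsilon>\<rceil>"
  have "2 * (real v + 1) / \<epsilon> \<le> real k" unfolding k_def by (rule real_nat_ceiling_ge)
  then have k: "2 * (real v + 1) \<le> real k * \<epsilon>" using \<epsilon>(1) by (simp add: field_simps)
  have k1: "1 \<le> k"
  proof (rule ccontr)
    assume "\<not> 1 \<le> k"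
    then have "k = 0" by simp
    then show False using k by simp
  qed
  define K where "K = e * ((2 * v + 2) * k + 1)"
  have Ke: "e \<le> K" unfolding K_def by simp
  define A where "A = real (K * e * l ^ l)"
  have A1: "1 \<le> A"
  proof -
    have "0 < K * e * l ^ l" using Ke card_E l_pos by simp
    then show ?thesis unfolding A_def by linarith
  qed
  define c where "c = 1 / (4 * A)"
  have c: "0 < c" "c \<le> 1" "A * c \<le> 1 / 4" unfolding c_def using A1 by (auto simp: field_simps)
  define D :: real where "D = 2 ^ v * 2 ^ e"
  have D0: "0 < D" unfolding D_def by simp
  \<comment> \<open>As \<open>ln 2\<close> exceeds 1/2, this makes \<open>(1 / 2) ^ T n\<close> at
    most \<open>n powr -(v + 1)\<close>.\<close>
  define T where "T = (\<lambda>n :: nat. nat \<lceil>2 * (real v + 1) * ln (real n)\<rceil>)"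
  \<comment> \<open>After at most \<open>T n\<close> steps the explored part has at most
    \<open>v * (T n + 1)\<close> vertices.\<close>
  define b where "b = (\<lambda>n :: nat. D * (real (v * (T n + 1)) ^ v * real n powr (- \<epsilon>)))"
  show ?thesis
  proof (intro exI conjI allI impI)
    show "0 < c" "c \<le> 1" using c by auto
    fix p :: "nat \<Rightarrow> real"
    assume p: "\<forall>n. 0 \<le> p n \<and> p n \<le> 1" and small: "\<forall>\<^sub>F n in sequentially. p n \<le> c * real n powr (- 1 / m)"
    let ?P = "\<lambda>n. measure_pmf.prob (random_lgraph l n (p n))
      {G. \<exists>B. B \<subseteq> edges G \<and> \<Union>B \<subseteq> {..<n} \<and> minimal_uncolourable \<C> B \<and> K < card B}"
    \<comment> \<open>Chosen so that \<open>B0 * ln n + 2 * B0\<close> bounds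
      \<open>v * (T n + 1)\<close>, rounding included.\<close>
    define B0 where "B0 = real v * (2 * (real v + 1))"
    have "\<forall>\<^sub>F n in sequentially. (4 * D) * (B0 * ln (real n) + 2 * B0) ^ v \<le> real n powr (\<epsilon> / 2)"
      using \<epsilon>(1) by (intro polylog_less_powr) simp
    with small eventually_ge_at_top[of 1]
    have ev: "\<forall>\<^sub>F n in sequentially. ?P n \<le> (2 + real k) * (1 / real n)"
    proof eventually_elim
      case (elim n)
      have n: "1 \<le> n" by fact
      have N: "1 \<le> real n" "0 < real n" using n by auto
      have ln0: "0 \<le> ln (real n)" using N by simp
      have T_le: "real (T n) \<le> 2 * (real v + 1) * ln (real n) + 1"
      proof -
        have "0 \<le> 2 * (real v + 1) * ln (real n)" using ln0 by simp
        then show ?thesis unfolding T_def by linarith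
      qed
      have T_ge: "2 * (real v + 1) * ln (real n) \<le> real (T n)" unfolding T_def by (rule real_nat_ceiling_ge)
      have v1: "1 \<le> v" using card_V by simp
      have "real (v * (T n + 1)) \<le> real v * (2 * (real v + 1) * ln (real n) + 2)"
      proof -
        have "real (v * (T n + 1)) = real v * (real (T n) + 1)" by (simp add: algebra_simps)
        also have "\<dots> \<le> real v * (2 * (real v + 1) * ln (real n) + 2)" using T_le by (intro mult_left_mono) auto
        finally show ?thesis .
      qed
      also have "\<dots> \<le> B0 * ln (real n) + 2 * B0"
      proof -
        have "real v * 2 \<le> 2 * B0" unfolding B0_def using v1 by (simp add: algebra_simps)
        then show ?thesis unfolding B0_def by (simp add: algebra_simps)
      qed
      finally have x_le: "real (v * (T n + 1)) \<le> B0 * ln (real n) + 2 * B0" .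
      have "4 * D * real (v * (T n + 1)) ^ v \<le> 4 * D * (B0 * ln (real n) + 2 * B0) ^ v"
        using x_le D0 by (intro mult_left_mono power_mono) auto
      also have "\<dots> \<le> real n powr (\<epsilon> / 2)" using elim by simp
      finally have "4 * D * real (v * (T n + 1)) ^ v * real n powr (- \<epsilon>) \<le> real n powr (\<epsilon> / 2) * real n powr (- \<epsilon>)"
        by (rule mult_right_mono) simp
      also have "\<dots> = real n powr (- (\<epsilon> / 2))" by (simp add: powr_add[symmetric])
      finally have b4: "4 * b n \<le> real n powr (- (\<epsilon> / 2))" unfolding b_def by (simp add: ac_simps)
      also have "\<dots> \<le> real n powr 0" using N \<epsilon>(1) by (intro powr_mono) auto
      finally have b41: "4 * b n \<le> 1" using N by simp
      have "0 < v * (T n + 1)" using v1 by simp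
      then have "0 < real (v * (T n + 1))" by (rule of_nat_0_less_iff[THEN iffD2])
      then have b0: "0 < b n" unfolding b_def using D0 N by (intro mult_pos_pos zero_less_power) auto
      have pn: "0 \<le> p n" "p n \<le> 1" "p n \<le> c * real n powr (- 1 / m)" using p elim by auto
      have reg: "(\<Sum>C\<in>regular K n S. p n ^ card (C - \<Union>S)) \<le> A * c" if "S \<in> states K n i d" for i d S
      proof -
        have "(\<Sum>C\<in>regular K n S. p n ^ card (C - \<Union>S)) \<le> A * (real n ^ (v - l) * p n ^ (e - 1))"
          unfolding A_def by (rule sum_regular[OF that Ke pn(1)])
        also have "\<dots> \<le> A * c" using powr_bounds(1)[OF n c(1,2) pn(1,3)] A1 by (intro mult_left_mono) auto
        finally show ?thesis .
      qed
      have dege: "(\<Sum>C\<in>degenerate n S. p n ^ card (C - \<Union>S)) \<le> b n" if i: "i < T n" and S: "S \<in> states K n i d" for i d S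
      proof -
        have inv: "finite S" "S \<subseteq> \<C>" "card S \<le> i + 1" using states_invariant[OF S] cops_subset by auto
        have "card (\<Union>(\<Union>S)) \<le> v * card S" using card_Union_state(2)[OF inv(1,2)] .
        also have "\<dots> \<le> v * (T n + 1)" using inv(3) i by (intro mult_le_mono2) simp
        finally have x: "card (\<Union>(\<Union>S)) \<le> v * (T n + 1)" .
        show ?thesis unfolding b_def D_def
          by (rule sum_degenerate[OF inv(1,2) x _ pn(1) powr_bounds(2)[OF n c(1,2) pn(1,3) _ \<epsilon>(2)]]) (use v1 in simp_all)
      qed
      have P_le: "?P n \<le> 2 * real n ^ v * (4 * b n) ^ k + real k * real n ^ v * (1 / 2) ^ T n"
        by (rule prob_exploration_le[OF pn(1,2) k1 K_def c(3) b0 b41 reg dege])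
      have "(4 * b n) ^ k \<le> real n powr (- (real v + 1))"
      proof -
        have "(4 * b n) ^ k \<le> (real n powr (- (\<epsilon> / 2))) ^ k" using b4 b0 by (intro power_mono) auto
        also have "\<dots> = real n powr (- (\<epsilon> / 2) * real k)" using N by (simp add: powr_powr flip: powr_realpow)
        also have "\<dots> \<le> real n powr (- (real v + 1))" using k N by (intro powr_mono) (auto simp: algebra_simps)
        finally show ?thesis .
      qed
      then have t1: "2 * real n ^ v * (4 * b n) ^ k \<le> 2 * real n ^ v * real n powr (- (real v + 1))"
        by (intro mult_left_mono) auto
      have half: "(1 / 2) ^ T n \<le> real n powr (- (real v + 1))"
      proof -
        have "(1 / 2 :: real) ^ T n = exp (- ln 2 * real (T n))"
          by (simp add: exp_of_nat2_mult exp_minus inverse_eq_divide power_one_over)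
        also have "\<dots> \<le> exp (- (real v + 1) * ln (real n))"
        proof -
          have "1 / 2 * real (T n) \<le> ln 2 * real (T n)" using ln2_ge_two_thirds by (intro mult_right_mono) auto
          then have "(real v + 1) * ln (real n) \<le> ln 2 * real (T n)" using T_ge by (simp add: algebra_simps)
          then show ?thesis by (simp add: algebra_simps)
        qed
        also have "\<dots> = real n powr (- (real v + 1))" using N by (simp add: powr_def)
        finally show ?thesis .
      qed
      have t2: "real k * real n ^ v * (1 / 2) ^ T n \<le> real k * real n ^ v * real n powr (- (real v + 1))"
        using half by (intro mult_left_mono) auto
      have pw: "real n ^ v * real n powr (- (real v + 1)) = 1 / real n"
      proof -
        have "real n ^ v * real n powr (- (real v + 1)) = real n powr (real v + - (real v + 1))"
          unfolding powr_add powr_realpow[OF N(2)] by simp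
        also have "\<dots> = 1 / real n" using N by (simp add: powr_minus inverse_eq_divide)
        finally show ?thesis .
      qed
      have "?P n \<le> 2 * real n ^ v * real n powr (- (real v + 1)) + real k * real n ^ v * real n powr (- (real v + 1))"
        by (rule order.trans[OF P_le add_mono[OF t1 t2]])
      also have "\<dots> = (2 + real k) * (real n ^ v * real n powr (- (real v + 1)))"
        by (simp only: distrib_right mult.assoc)
      finally show "?P n \<le> (2 + real k) * (1 / real n)" unfolding pw .
    qed
    have "(\<lambda>n. (2 + real k) * (1 / real n)) \<longlonglongrightarrow> (2 + real k) * 0"
      by (intro tendsto_intros lim_1_over_n)
    then have lim: "(\<lambda>n. (2 + real k) * (1 / real n)) \<longlonglongrightarrow> 0" by simp
    show "?P \<longlonglongrightarrow> 0"
      by (rule tendsto_sandwich[OF _ ev tendsto_const lim]) simp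
  qed
qed

end

section \<open>First moment bounds for small dense subgraphs\<close>

text \<open>Transports the edge set to an initial segment, so that union bounds run over finitely
  many patterns and the embeddings of each.\<close>

lemma ex_pattern:
  assumes D: "uniform l D" "\<Union>D \<subseteq> {..<n}"
  obtains P \<phi> where "P \<subseteq> Pow {..<card (\<Union>D)}" "card P = card D" "D = (\<lambda>a. \<phi> ` a) ` P"
    "\<phi> \<in> embeddings {..<card (\<Union>D)} n {} {}"
proof -
  let ?w = "card (\<Union>D)"
  obtain h where h: "bij_betw h {0..<?w} (\<Union>D)"
    using ex_bij_betw_nat_finite[OF uniform_finite_Union[OF D(1)]] by blast
  define \<phi> where "\<phi> = restrict h {..<?w}"
  have \<phi>: "inj_on \<phi> {..<?w}" "\<phi> ` {..<?w} = \<Union>D"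
    using h unfolding \<phi>_def bij_betw_def by (simp_all add: inj_on_restrict_eq lessThan_atLeast0)
  define P where "P = {a. a \<subseteq> {..<?w} \<and> \<phi> ` a \<in> D}"
  have P: "P \<subseteq> Pow {..<?w}" unfolding P_def by blast
  have DP: "D = (\<lambda>a. \<phi> ` a) ` P"
  proof
    show "D \<subseteq> (\<lambda>a. \<phi> ` a) ` P"
    proof
      fix f assume f: "f \<in> D"
      then have "f \<subseteq> \<phi> ` {..<?w}" using \<phi>(2) by blast
      then obtain a where "a \<subseteq> {..<?w}" "f = \<phi> ` a" by (meson subset_imageE)
      then show "f \<in> (\<lambda>a. \<phi> ` a) ` P" using f unfolding P_def by blast
    qed
  qed (auto simp: P_def)
  have "card ((\<lambda>a. \<phi> ` a) ` P) = card P" by (rule card_copy[OF \<phi>(1) P])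
  then have "card P = card D" using DP by simp
  moreover have "\<phi> \<in> embeddings {..<?w} n {} {}"
    unfolding embeddings_def using \<phi>(2) D(2) by (auto simp: PiE_def \<phi>_def)
  ultimately show thesis using that P DP by blast
qed

text \<open>\<open>R\<close> selects forbidden pairs of edge and vertex numbers. At most
  \<open>K\<close> edges leave finitely many patterns, each contributing at most
  \<open>n ^ w * p ^ s\<close>.\<close>

lemma small_subgraphs_unlikely:
  fixes p :: "nat \<Rightarrow> real"
  assumes p: "\<And>n. 0 \<le> p n \<and> p n \<le> 1"
    and lim: "\<And>s w. 1 \<le> s \<Longrightarrow> R s w \<Longrightarrow> (\<lambda>n. real n ^ w * p n ^ s) \<longlonglongrightarrow> 0"
  shows "(\<lambda>n. measure_pmf.prob (random_lgraph l n (p n)) {G. \<exists>D. D \<subseteq> edges G \<and> \<Union>D \<subseteq> {..<n} \<and> uniform l D \<and>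
    1 \<le> card D \<and> card D \<le> K \<and> R (card D) (card (\<Union>D))}) \<longlonglongrightarrow> 0"
proof -
  define Z where "Z = {z \<in> {..l * K} \<times> Pow (Pow {..<l * K}). 1 \<le> card (snd z) \<and> R (card (snd z)) (fst z)}"
  have finZ: "finite Z" unfolding Z_def by simp
  let ?A = "\<lambda>n. {G. \<exists>D. D \<subseteq> edges G \<and> \<Union>D \<subseteq> {..<n} \<and> uniform l D \<and>
    1 \<le> card D \<and> card D \<le> K \<and> R (card D) (card (\<Union>D))}"
  let ?I = "\<lambda>n z. {\<phi> \<in> embeddings {..<fst z} n {} {}. card ((\<lambda>a. \<phi> ` a) ` snd z) = card (snd z)}"
  let ?G = "\<lambda>z \<phi>. {G :: nat hgraph. (\<lambda>a. \<phi> ` a) ` snd z \<subseteq> edges G}"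
  have sub: "?A n \<subseteq> (\<Union>z\<in>Z. \<Union>\<phi>\<in>?I n z. ?G z \<phi>)" for n
  proof
    fix G assume "G \<in> ?A n"
    then obtain D where D: "D \<subseteq> edges G" "\<Union>D \<subseteq> {..<n}" "uniform l D" "1 \<le> card D" "card D \<le> K"
      "R (card D) (card (\<Union>D))" by blast
    obtain P \<phi> where P: "P \<subseteq> Pow {..<card (\<Union>D)}" "card P = card D" "D = (\<lambda>a. \<phi> ` a) ` P"
      "\<phi> \<in> embeddings {..<card (\<Union>D)} n {} {}" using ex_pattern[OF D(3,2)] .
    have "card (\<Union>D) \<le> (\<Sum>f\<in>D. card f)" using card_UN_le[of D "\<lambda>f. f"] D(3) by (simp add: uniform_def)
    also have "\<dots> = card D * l" using D(3) by (simp add: uniform_def)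
    also have "\<dots> \<le> l * K" using D(5) by simp
    finally have w: "card (\<Union>D) \<le> l * K" .
    have "Pow {..<card (\<Union>D)} \<subseteq> Pow {..<l * K}" using w by auto
    then have z: "(card (\<Union>D), P) \<in> Z" unfolding Z_def using w P(1,2) D(4,6) by auto
    have \<phi>: "\<phi> \<in> ?I n (card (\<Union>D), P)" using P by simp
    have "G \<in> ?G (card (\<Union>D), P) \<phi>" using P(3) D(1) by simp
    with z \<phi> show "G \<in> (\<Union>z\<in>Z. \<Union>\<phi>\<in>?I n z. ?G z \<phi>)" by (intro UN_I[of "(card (\<Union>D), P)"] UN_I[of \<phi>])
  qed
  have finP: "finite (snd z)" if "z \<in> Z" for z
    using that finite_subset[of "snd z" "Pow {..<l * K}"] unfolding Z_def by auto
  have le: "measure_pmf.prob (random_lgraph l n (p n)) (?A n) \<le> (\<Sum>z\<in>Z. real n ^ fst z * p n ^ card (snd z))" for n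
  proof -
    have "measure_pmf.prob (random_lgraph l n (p n)) (?A n) \<le>
        measure_pmf.prob (random_lgraph l n (p n)) (\<Union>z\<in>Z. \<Union>\<phi>\<in>?I n z. ?G z \<phi>)"
      by (intro measure_pmf.finite_measure_mono sub) simp
    also have "\<dots> \<le> (\<Sum>z\<in>Z. real n ^ fst z * p n ^ card (snd z))"
    proof (rule prob_UN_le[OF finZ])
      fix z assume z: "z \<in> Z"
      have finE: "finite (embeddings {..<fst z} n {} {})" by (rule finite_embeddings) simp_all
      have finI: "finite (?I n z)" by (rule finite_subset[OF _ finE]) blast
      have "measure_pmf.prob (random_lgraph l n (p n)) (\<Union>\<phi>\<in>?I n z. ?G z \<phi>) \<le> (\<Sum>\<phi>\<in>?I n z. p n ^ card (snd z))"
      proof (rule prob_UN_le[OF finI])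
        fix \<phi> assume \<phi>: "\<phi> \<in> ?I n z"
        have "measure_pmf.prob (random_lgraph l n (p n)) (?G z \<phi>) \<le> p n ^ card ((\<lambda>a. \<phi> ` a) ` snd z)"
          using p finP[OF z] by (intro prob_subset_edges) auto
        then show "measure_pmf.prob (random_lgraph l n (p n)) (?G z \<phi>) \<le> p n ^ card (snd z)" using \<phi> by simp
      qed
      also have "\<dots> = real (card (?I n z)) * p n ^ card (snd z)" by simp
      also have "\<dots> \<le> real (card (embeddings {..<fst z} n {} {})) * p n ^ card (snd z)"
        using p by (intro mult_right_mono of_nat_mono card_mono finE) auto
      also have "\<dots> = real n ^ fst z * p n ^ card (snd z)" by (subst card_embeddings) simp_all
      finally show "measure_pmf.prob (random_lgraph l n (p n)) (\<Union>\<phi>\<in>?I n z. ?G z \<phi>)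
        \<le> real n ^ fst z * p n ^ card (snd z)" .
    qed
    finally show ?thesis .
  qed
  have "(\<lambda>n. \<Sum>z\<in>Z. real n ^ fst z * p n ^ card (snd z)) \<longlonglongrightarrow> (\<Sum>z\<in>Z. 0)"
    by (intro tendsto_sum lim) (auto simp: Z_def)
  then have "(\<lambda>n. \<Sum>z\<in>Z. real n ^ fst z * p n ^ card (snd z)) \<longlonglongrightarrow> 0" by simp
  then show ?thesis by (rule tendsto_sandwich[OF _ _ tendsto_const, rotated 2]) (use le in auto)
qed

text \<open>The exponent \<open>w - s / m\<close> of the bound is negative.\<close>

lemma dense_limit:
  fixes p :: "nat \<Rightarrow> real"
  assumes p: "\<And>n. 0 \<le> p n" and small: "\<forall>\<^sub>F n in sequentially. p n \<le> real n powr (- 1 / m)"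
    and m: "0 < m" "m * real w < real s"
  shows "(\<lambda>n. real n ^ w * p n ^ s) \<longlonglongrightarrow> 0"
proof -
  define g where "g = real s / m - real w"
  have g: "0 < g" using m unfolding g_def by (simp add: field_simps)
  have le: "\<forall>\<^sub>F n in sequentially. real n ^ w * p n ^ s \<le> 1 / real n powr g"
    using small eventually_gt_at_top[of 0]
  proof eventually_elim
    case (elim n)
    then have N: "0 < real n" by simp
    have "real n ^ w * p n ^ s \<le> real n ^ w * (real n powr (- 1 / m)) ^ s"
      using p elim by (intro mult_left_mono power_mono) auto
    also have "\<dots> = real n powr (real w + (- 1 / m) * real s)"
      unfolding powr_add using N by (simp add: powr_powr flip: powr_realpow)
    also have "real w + (- 1 / m) * real s = - g" unfolding g_def by (simp add: field_simps)
    also have "real n powr (- g) = 1 / real n powr g" by (simp add: powr_minus inverse_eq_divide)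
    finally show ?case .
  qed
  have lim: "(\<lambda>n. 1 / real n powr g) \<longlonglongrightarrow> 0" using g by real_asymp
  show ?thesis
    by (rule tendsto_sandwich[OF _ le tendsto_const lim]) (simp add: p)
qed

text \<open>The exponent may now be 0; then the ratio of \<open>p\<close> to the threshold, raised
  to the power \<open>s \<ge> 1\<close>, provides the decay.\<close>

lemma dense_limit_smallo:
  fixes p :: "nat \<Rightarrow> real"
  assumes p: "\<And>n. 0 \<le> p n" and small: "p \<in> o(\<lambda>n. real n powr (- 1 / m))"
    and m: "0 < m" "m * real w \<le> real s" "1 \<le> s"
  shows "(\<lambda>n. real n ^ w * p n ^ s) \<longlonglongrightarrow> 0"
proof -
  define q where "q = (\<lambda>n. p n / real n powr (- 1 / m))"
  have q: "q \<longlonglongrightarrow> 0" unfolding q_def using small by (rule smalloD_tendsto)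
  have le: "\<forall>\<^sub>F n in sequentially. real n ^ w * p n ^ s \<le> q n ^ s"
    using eventually_ge_at_top[of 1]
  proof eventually_elim
    case (elim n)
    then have N: "1 \<le> real n" "0 < real n" by auto
    have pq: "p n = q n * real n powr (- 1 / m)" unfolding q_def using N by simp
    have q0: "0 \<le> q n" unfolding q_def using p by simp
    have "real n ^ w * p n ^ s = q n ^ s * (real n ^ w * (real n powr (- 1 / m)) ^ s)"
      unfolding pq power_mult_distrib by (simp add: ac_simps)
    also have "real n ^ w * (real n powr (- 1 / m)) ^ s = real n powr (real w + (- 1 / m) * real s)"
      unfolding powr_add using N by (simp add: powr_powr flip: powr_realpow)
    also have "\<dots> \<le> real n powr 0"
    proof (rule powr_mono[OF _ N(1)])
      show "real w + (- 1 / m) * real s \<le> 0" using m by (simp add: field_simps)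
    qed
    also have "\<dots> = 1" using N by simp
    finally show ?case using q0 by (simp add: mult_left_mono)
  qed
  have "(\<lambda>n. q n ^ s) \<longlonglongrightarrow> 0 ^ s" by (intro tendsto_power q)
  then have lim: "(\<lambda>n. q n ^ s) \<longlonglongrightarrow> 0" using m(3) by (simp add: zero_power)
  show ?thesis
    by (rule tendsto_sandwich[OF _ le tendsto_const lim]) (simp add: p)
qed

lemma set_pmf_random_lgraph:
  assumes "G \<in> set_pmf (random_lgraph l n p)"
  shows "\<Union>(edges G) \<subseteq> {..<n}" "uniform l (edges G)"
proof -
  obtain f where G: "G = HGraph {..<n} {e \<in> edges (complete_lgraph l n). f e}"
    using assms unfolding random_lgraph_def by auto
  have sub: "edges G \<subseteq> {e. e \<subseteq> {..<n} \<and> card e = l}" unfolding G complete_lgraph_def by auto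
  then show "\<Union>(edges G) \<subseteq> {..<n}" by auto
  have "finite {e. e \<subseteq> {..<n} \<and> card e = l}" by simp
  then have "finite (edges G)" using sub finite_subset by blast
  then show "uniform l (edges G)" unfolding uniform_def using sub finite_subset[of _ "{..<n}"] by blast
qed

section \<open>From sparse hypergraphs to the random hypergraph\<close>

context template
begin

text \<open>An uncolourable outcome contains a minimal uncolourable \<open>B\<close>. Either
  \<open>B\<close> has more than \<open>K\<close> edges, or by \<open>col\<close> some part of it
  with at most \<open>K\<close> edges has forbidden density.\<close>

lemma whp_colourable:
  fixes p :: "nat \<Rightarrow> real"
  assumes col: "\<And>B :: nat set set. uniform l B \<Longrightarrow> (\<And>D. D \<subseteq> B \<Longrightarrow> D \<noteq> {} \<Longrightarrow> \<not> R (card D) (card (\<Union>D))) \<Longrightarrow> colourable \<C> B"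
    and p: "\<And>n. 0 \<le> p n \<and> p n \<le> 1"
    and big: "(\<lambda>n. measure_pmf.prob (random_lgraph l n (p n))
      {G. \<exists>B. B \<subseteq> edges G \<and> \<Union>B \<subseteq> {..<n} \<and> minimal_uncolourable \<C> B \<and> K < card B}) \<longlonglongrightarrow> 0"
    and lim: "\<And>s w. 1 \<le> s \<Longrightarrow> R s w \<Longrightarrow> (\<lambda>n. real n ^ w * p n ^ s) \<longlonglongrightarrow> 0"
  shows "whp (\<lambda>n. random_lgraph l n (p n)) (\<lambda>G. colourable \<C> (edges G))"
proof (rule whpI)
  let ?R = "\<lambda>n. random_lgraph l n (p n)"
  let ?A = "\<lambda>n. {G. \<exists>B. B \<subseteq> edges G \<and> \<Union>B \<subseteq> {..<n} \<and> minimal_uncolourable \<C> B \<and> K < card B}"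
  let ?D = "\<lambda>n. {G. \<exists>D. D \<subseteq> edges G \<and> \<Union>D \<subseteq> {..<n} \<and> uniform l D \<and>
    1 \<le> card D \<and> card D \<le> K \<and> R (card D) (card (\<Union>D))}"
  let ?N = "{G :: nat hgraph. \<not> colourable \<C> (edges G)}"
  have le: "measure_pmf.prob (?R n) ?N \<le> measure_pmf.prob (?R n) (?A n) + measure_pmf.prob (?R n) (?D n)" for n
  proof -
    have "?N \<inter> set_pmf (?R n) \<subseteq> ?A n \<union> ?D n"
    proof
      fix G assume G: "G \<in> ?N \<inter> set_pmf (?R n)"
      then have Gs: "G \<in> set_pmf (?R n)" by blast
      have sup: "\<Union>(edges G) \<subseteq> {..<n}" "uniform l (edges G)" using set_pmf_random_lgraph[OF Gs] .
      have "finite (edges G)" using sup(2) by (simp add: uniform_def)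
      moreover have "\<not> colourable \<C> (edges G)" using G by simp
      ultimately obtain B where B: "B \<subseteq> edges G" "minimal_uncolourable \<C> B"
        by (rule ex_minimal_uncolourable)
      have uB: "uniform l B" by (rule uniform_subset[OF sup(2) B(1)])
      have BV: "\<Union>B \<subseteq> {..<n}" using B(1) sup(1) by blast
      show "G \<in> ?A n \<union> ?D n"
      proof (cases "K < card B")
        case True
        then have "G \<in> ?A n" using B BV by blast
        then show ?thesis by (rule UnI1)
      next
        case False
        have "\<not> colourable \<C> B" using B(2) by (simp add: minimal_uncolourable_def)
        then obtain D where D: "D \<subseteq> B" "D \<noteq> {}" "R (card D) (card (\<Union>D))" using col[OF uB] by meson
        have uD: "uniform l D" by (rule uniform_subset[OF uB D(1)])
        then have "1 \<le> card D" using D(2) by (simp add: uniform_def Suc_le_eq card_gt_0_iff)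
        moreover have "card D \<le> card B" using D(1) uB by (intro card_mono) (auto simp: uniform_def)
        then have "card D \<le> K" using False by simp
        moreover have "D \<subseteq> edges G" "\<Union>D \<subseteq> {..<n}" using D(1) B(1) BV by auto
        ultimately have "G \<in> ?D n" using uD D(3) by (intro CollectI exI[of _ D] conjI)
        then show ?thesis by (rule UnI2)
      qed
    qed
    then have "measure_pmf.prob (?R n) (?N \<inter> set_pmf (?R n)) \<le> measure_pmf.prob (?R n) (?A n \<union> ?D n)"
      by (rule measure_pmf.finite_measure_mono) simp
    also have "\<dots> \<le> measure_pmf.prob (?R n) (?A n) + measure_pmf.prob (?R n) (?D n)"
      by (intro measure_Un_le) auto
    finally show ?thesis by (simp add: measure_Int_set_pmf)
  qed
  have "(\<lambda>n. measure_pmf.prob (?R n) (?D n)) \<longlonglongrightarrow> 0"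
    by (rule small_subgraphs_unlikely[OF p lim])
  then have "(\<lambda>n. measure_pmf.prob (?R n) (?A n) + measure_pmf.prob (?R n) (?D n)) \<longlonglongrightarrow> 0 + 0"
    by (intro tendsto_add big)
  then have lim0: "(\<lambda>n. measure_pmf.prob (?R n) (?A n) + measure_pmf.prob (?R n) (?D n)) \<longlonglongrightarrow> 0" by simp
  show "(\<lambda>n. measure_pmf.prob (?R n) ?N) \<longlonglongrightarrow> 0"
    by (rule tendsto_sandwich[OF _ _ tendsto_const lim0]) (use le in auto)
qed

text \<open>Every copy of \<open>F\<close> contains a copy of the template, which already repeats a
  colour.\<close>

lemma colourable_rainbow_free:
  assumes F: "V \<subseteq> verts F" "E \<subseteq> edges F" and G: "colourable \<C> (edges G)" "finite (edges G)"
  shows "has_rainbow_free_colouring F (G :: nat hgraph)"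
proof -
  obtain col :: "nat set \<Rightarrow> nat" where col: "bounded_col (edges G) col" "\<And>C. C \<in> \<C> \<Longrightarrow> C \<subseteq> edges G \<Longrightarrow> \<not> inj_on col C"
    using G(1) unfolding colourable_def by blast
  have "card {e \<in> edges G. col e = k} \<le> 2" for k
  proof (cases "\<exists>e\<in>edges G. col e = k")
    case True
    then show ?thesis using col(1) unfolding bounded_col_def by blast
  next
    case False
    then have none: "{e \<in> edges G. col e = k} = {}" by blast
    show ?thesis unfolding none by simp
  qed
  moreover have False if H: "is_copy F G H" "rainbow H col" for H
  proof -
    obtain f where f: "bij_betw f (verts F) (verts H)" "edges H = (\<lambda>e. f ` e) ` edges F"
      using H(1) unfolding is_copy_def isomorphic_def by blast
    let ?C = "(\<lambda>e. f ` e) ` E"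
    have "inj_on f V" using f(1) F(1) by (meson bij_betw_imp_inj_on inj_on_subset)
    then have "?C \<in> \<C>" unfolding \<C>_def copies_def by blast
    moreover have sub: "?C \<subseteq> edges H" using f(2) F(2) by blast
    moreover have "edges H \<subseteq> edges G" using H(1) unfolding is_copy_def subgraph_def by blast
    moreover have "inj_on col ?C" using H(2) sub unfolding rainbow_def by (rule inj_on_subset)
    ultimately show False using col(2)[of ?C] by blast
  qed
  ultimately show ?thesis unfolding has_rainbow_free_colouring_def two_bounded_def by blast
qed

lemma whp_rainbow_free:
  fixes p :: "nat \<Rightarrow> real"
  assumes F: "V \<subseteq> verts F" "E \<subseteq> edges F"
    and whp: "whp (\<lambda>n. random_lgraph l n (p n)) (\<lambda>G. colourable \<C> (edges G))"
  shows "whp (\<lambda>n. random_lgraph l n (p n)) (has_rainbow_free_colouring F)"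
  unfolding whp_def
proof (rule tendsto_sandwich[OF _ _ whp[unfolded whp_def] tendsto_const])
  let ?R = "\<lambda>n. random_lgraph l n (p n)"
  show "\<forall>\<^sub>F n in sequentially. measure_pmf.prob (?R n) {G. colourable \<C> (edges G)}
      \<le> measure_pmf.prob (?R n) {G. has_rainbow_free_colouring F G}"
  proof (rule always_eventually, rule allI)
    fix n
    have "{G. colourable \<C> (edges G)} \<inter> set_pmf (?R n) \<subseteq> {G. has_rainbow_free_colouring F G}"
    proof
      fix G assume G: "G \<in> {G. colourable \<C> (edges G)} \<inter> set_pmf (?R n)"
      then have "G \<in> set_pmf (?R n)" by blast
      from set_pmf_random_lgraph(2)[OF this] have "finite (edges G)" by (simp add: uniform_def)
      then show "G \<in> {G. has_rainbow_free_colouring F G}" using colourable_rainbow_free[OF F] G by simp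
    qed
    then have "measure_pmf.prob (?R n) ({G. colourable \<C> (edges G)} \<inter> set_pmf (?R n))
        \<le> measure_pmf.prob (?R n) {G. has_rainbow_free_colouring F G}"
      by (rule measure_pmf.finite_measure_mono) simp
    then show "measure_pmf.prob (?R n) {G. colourable \<C> (edges G)}
        \<le> measure_pmf.prob (?R n) {G. has_rainbow_free_colouring F G}"
      by (simp add: measure_Int_set_pmf)
  qed
qed simp

lemma density_condition_whp:
  assumes F: "V \<subseteq> verts F" "E \<subseteq> edges F"
    and col: "\<And>B :: nat set set. uniform l B \<Longrightarrow> (\<And>D. D \<subseteq> B \<Longrightarrow> real (card D) \<le> m * real (card (\<Union>D))) \<Longrightarrow> colourable \<C> B"
  shows "\<exists>c>0. \<forall>p. (\<forall>n. 0 \<le> p n \<and> p n \<le> 1) \<longrightarrow> (\<forall>\<^sub>F n in sequentially. p n \<le> c * real n powr (- 1 / m)) \<longrightarrow>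
    whp (\<lambda>n. random_lgraph l n (p n)) (has_rainbow_free_colouring F)"
proof -
  obtain c K where c: "0 < c" "c \<le> 1" and big: "\<And>p. (\<forall>n. 0 \<le> p n \<and> p n \<le> 1) \<Longrightarrow>
    (\<forall>\<^sub>F n in sequentially. p n \<le> c * real n powr (- 1 / m)) \<Longrightarrow>
    (\<lambda>n. measure_pmf.prob (random_lgraph l n (p n))
      {G. \<exists>B. B \<subseteq> edges G \<and> \<Union>B \<subseteq> {..<n} \<and> minimal_uncolourable \<C> B \<and> K < card B}) \<longlonglongrightarrow> 0"
    using minimal_uncolourable_small by blast
  show ?thesis
  proof (intro exI conjI allI impI)
    show "0 < c" by fact
    fix p :: "nat \<Rightarrow> real"
    assume p: "\<forall>n. 0 \<le> p n \<and> p n \<le> 1" and small: "\<forall>\<^sub>F n in sequentially. p n \<le> c * real n powr (- 1 / m)"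
    have small1: "\<forall>\<^sub>F n in sequentially. p n \<le> real n powr (- 1 / m)"
      using small
    proof eventually_elim
      case (elim n)
      have "c * real n powr (- 1 / m) \<le> 1 * real n powr (- 1 / m)" using c by (intro mult_right_mono) auto
      then show ?case using elim by simp
    qed
    have "whp (\<lambda>n. random_lgraph l n (p n)) (\<lambda>G. colourable \<C> (edges G))"
    proof (rule whp_colourable[where R = "\<lambda>s w. m * real w < real s" and K = K])
      fix B :: "nat set set"
      assume B: "uniform l B" and R: "\<And>D. D \<subseteq> B \<Longrightarrow> D \<noteq> {} \<Longrightarrow> \<not> m * real (card (\<Union>D)) < real (card D)"
      show "colourable \<C> B"
      proof (rule col[OF B])
        fix D assume "D \<subseteq> B"
        then show "real (card D) \<le> m * real (card (\<Union>D))" using R[of D] by (cases "D = {}") auto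
      qed
    next
      show "\<And>n. 0 \<le> p n \<and> p n \<le> 1" using p by blast
      show "(\<lambda>n. measure_pmf.prob (random_lgraph l n (p n))
        {G. \<exists>B. B \<subseteq> edges G \<and> \<Union>B \<subseteq> {..<n} \<and> minimal_uncolourable \<C> B \<and> K < card B}) \<longlonglongrightarrow> 0"
        by (rule big[OF p small])
      show "(\<lambda>n. real n ^ w * p n ^ s) \<longlonglongrightarrow> 0" if "1 \<le> s" "m * real w < real s" for s w
        using p by (intro dense_limit[OF _ small1 m_pos that(2)]) blast
    qed
    then show "whp (\<lambda>n. random_lgraph l n (p n)) (has_rainbow_free_colouring F)"
      by (rule whp_rainbow_free[OF F])
  qed
qed

text \<open>For \<open>p\<close> of smaller order, subgraphs with exactly \<open>m\<close> edges per
  vertex disappear too, so the colouring step may assume strict sparsity.\<close>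

lemma strict_density_condition_whp:
  fixes p :: "nat \<Rightarrow> real"
  assumes F: "V \<subseteq> verts F" "E \<subseteq> edges F"
    and col: "\<And>B :: nat set set. uniform l B \<Longrightarrow> (\<And>D. D \<subseteq> B \<Longrightarrow> D \<noteq> {} \<Longrightarrow> real (card D) < m * real (card (\<Union>D))) \<Longrightarrow> colourable \<C> B"
    and p: "\<forall>n. 0 \<le> p n \<and> p n \<le> 1" and small: "p \<in> o(\<lambda>n. real n powr (- 1 / m))"
  shows "whp (\<lambda>n. random_lgraph l n (p n)) (has_rainbow_free_colouring F)"
proof -
  obtain c K where c: "0 < c" "c \<le> 1" and big: "\<And>p. (\<forall>n. 0 \<le> p n \<and> p n \<le> 1) \<Longrightarrow>
    (\<forall>\<^sub>F n in sequentially. p n \<le> c * real n powr (- 1 / m)) \<Longrightarrow>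
    (\<lambda>n. measure_pmf.prob (random_lgraph l n (p n))
      {G. \<exists>B. B \<subseteq> edges G \<and> \<Union>B \<subseteq> {..<n} \<and> minimal_uncolourable \<C> B \<and> K < card B}) \<longlonglongrightarrow> 0"
    using minimal_uncolourable_small by blast
  have "\<forall>\<^sub>F n in sequentially. norm (p n) \<le> c * norm (real n powr (- 1 / m))"
    by (rule landau_o.smallD[OF small c(1)])
  then have small_c: "\<forall>\<^sub>F n in sequentially. p n \<le> c * real n powr (- 1 / m)"
    by eventually_elim simp
  have "whp (\<lambda>n. random_lgraph l n (p n)) (\<lambda>G. colourable \<C> (edges G))"
  proof (rule whp_colourable[where R = "\<lambda>s w. m * real w \<le> real s" and K = K])
    fix B :: "nat set set"
    assume B: "uniform l B" and R: "\<And>D. D \<subseteq> B \<Longrightarrow> D \<noteq> {} \<Longrightarrow> \<not> m * real (card (\<Union>D)) \<le> real (card D)"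
    show "colourable \<C> B"
    proof (rule col[OF B])
      fix D assume "D \<subseteq> B" "D \<noteq> {}"
      then show "real (card D) < m * real (card (\<Union>D))" using R[of D] by simp
    qed
  next
    show "\<And>n. 0 \<le> p n \<and> p n \<le> 1" using p by blast
    show "(\<lambda>n. measure_pmf.prob (random_lgraph l n (p n))
      {G. \<exists>B. B \<subseteq> edges G \<and> \<Union>B \<subseteq> {..<n} \<and> minimal_uncolourable \<C> B \<and> K < card B}) \<longlonglongrightarrow> 0"
      by (rule big[OF p small_c])
    show "(\<lambda>n. real n ^ w * p n ^ s) \<longlonglongrightarrow> 0" if "1 \<le> s" "m * real w \<le> real s" for s w
      using p by (intro dense_limit_smallo[OF _ small m_pos that(2,1)]) blast
  qed
  then show ?thesis by (rule whp_rainbow_free[OF F])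
qed

end

section \<open>The three cases\<close>

lemma copies_complete:
  assumes "C \<in> copies V {e. e \<subseteq> V \<and> card e = l}"
  obtains W where "card W = card V" "C = {e. e \<subseteq> W \<and> card e = l}"
proof -
  obtain \<phi> where \<phi>: "inj_on \<phi> V" "C = (\<lambda>a. \<phi> ` a) ` {e. e \<subseteq> V \<and> card e = l}"
    using assms by (rule copiesE)
  have ci: "card (\<phi> ` a) = card a" if "a \<subseteq> V" for a using card_image[OF inj_on_subset[OF \<phi>(1) that]] .
  have "C = {e. e \<subseteq> \<phi> ` V \<and> card e = l}"
  proof
    show "C \<subseteq> {e. e \<subseteq> \<phi> ` V \<and> card e = l}"
    proof
      fix f assume "f \<in> C"
      then obtain a where a: "a \<subseteq> V" "card a = l" "f = \<phi> ` a" unfolding \<phi>(2) by blast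
      show "f \<in> {e. e \<subseteq> \<phi> ` V \<and> card e = l}" using ci[OF a(1)] a(2) image_mono[OF a(1)] a(3) by simp
    qed
    show "{e. e \<subseteq> \<phi> ` V \<and> card e = l} \<subseteq> C"
    proof
      fix f assume f: "f \<in> {e. e \<subseteq> \<phi> ` V \<and> card e = l}"
      then have "f \<subseteq> \<phi> ` V" by simp
      then obtain a where a: "a \<subseteq> V" "f = \<phi> ` a" by (rule subset_imageE)
      then have "a \<in> {e. e \<subseteq> V \<and> card e = l}" using f ci by simp
      then show "f \<in> C" unfolding \<phi>(2) a(2) by (rule imageI)
    qed
  qed
  then show thesis using ci[OF subset_refl] by (rule that[rotated])
qed

text \<open>By Hall's theorem every clique gets two edges of its own, which receive the same colour.\<close>

lemma complete_colourable:
  fixes V :: "'a set" and B :: "nat set set"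
  assumes lr: "3 \<le> l" "l + 1 \<le> r" "(l, r) \<noteq> (3, 4)" "card V = r" and B: "uniform l B"
    and dens: "\<And>D. D \<subseteq> B \<Longrightarrow> (r - l) * card D + card (\<Union>D) \<le> (r choose l) * card (\<Union>D)"
  shows "colourable (copies V {e. e \<subseteq> V \<and> card e = l}) B"
proof -
  have finB: "finite B" using B by (simp add: uniform_def)
  let ?Q = "cliques l r B"
  define A where "A = (\<lambda>z :: nat set \<times> bool. {e. e \<subseteq> fst z \<and> card e = l})"
  have finQ: "finite ?Q" by (rule finite_cliques[OF B])
  have AB: "A z \<subseteq> B" if "fst z \<in> ?Q" for z using that unfolding A_def cliques_def by blast
  have "\<exists>R. inj_on R (?Q \<times> UNIV) \<and> (\<forall>z\<in>?Q \<times> UNIV. R z \<in> A z)"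
  proof (rule hall_sdr)
    show "finite (?Q \<times> (UNIV :: bool set))" using finQ by simp
    show "finite (A z)" if "z \<in> ?Q \<times> UNIV" for z
      using AB[of z] that finB finite_subset by auto
    fix J assume J: "J \<subseteq> ?Q \<times> (UNIV :: bool set)"
    let ?D = "\<Union>(A ` J)"
    have DB: "?D \<subseteq> B"
    proof
      fix x assume "x \<in> ?D"
      then obtain z where z: "z \<in> J" "x \<in> A z" by blast
      then have "fst z \<in> ?Q" using J by auto
      then show "x \<in> B" using AB z(2) by blast
    qed
    have uD: "uniform l ?D" by (rule uniform_subset[OF B DB])
    have "fst ` J \<subseteq> cliques l r ?D"
    proof
      fix W assume "W \<in> fst ` J"
      then obtain z where z: "z \<in> J" "W = fst z" by blast
      then have W: "W \<in> ?Q" using J by auto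
      then have cW: "card W = r" unfolding cliques_def by simp
      have mem: "f \<in> ?D" if "f \<subseteq> W" "card f = l" for f using that z unfolding A_def by blast
      show "W \<in> cliques l r ?D" by (rule cliquesI[OF cW _ _ mem]) (use lr in auto)
    qed
    then have c1: "card (fst ` J) \<le> card (cliques l r ?D)" by (rule card_mono[OF finite_cliques[OF uD]])
    \<comment> \<open>Hall's condition: \<open>J\<close> contains each clique at most twice, and all
      cliques involved are cliques of the union \<open>?D\<close>, whose edges are at least twice as
      many.\<close>
    have "2 * card (cliques l r ?D) \<le> card ?D"
      using lr DB by (intro card_cliques_le uD dens) auto
    moreover have finJ: "finite J" using J by (rule finite_subset) (simp add: finQ)
    have "J \<subseteq> fst ` J \<times> UNIV" by force
    then have "card J \<le> card (fst ` J \<times> (UNIV :: bool set))"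
      by (rule card_mono[rotated]) (simp add: finJ)
    then have "card J \<le> 2 * card (fst ` J)" by (simp add: card_cartesian_product)
    ultimately show "card J \<le> card ?D" using c1 by linarith
  qed
  then obtain R where R: "inj_on R (?Q \<times> UNIV)" "\<forall>z\<in>?Q \<times> UNIV. R z \<in> A z" by (elim exE conjE)
  \<comment> \<open>Both edges chosen for a clique are coloured by its vertex set; every other edge
    gets a colour of its own.\<close>
  define col where "col = (\<lambda>e. if \<exists>z\<in>?Q \<times> UNIV. R z = e then Inl (fst (SOME z. z \<in> ?Q \<times> UNIV \<and> R z = e)) else Inr e)"
  have colR: "col (R z) = Inl (fst z)" if zQ: "z \<in> ?Q \<times> UNIV" for z
  proof -
    have some: "(SOME z'. z' \<in> ?Q \<times> UNIV \<and> R z' = R z) = z"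
    proof (rule some_equality)
      show "z \<in> ?Q \<times> UNIV \<and> R z = R z" using zQ by (rule conjI[OF _ refl])
      show "z' = z" if z': "z' \<in> ?Q \<times> UNIV \<and> R z' = R z" for z'
        by (rule inj_onD[OF R(1) conjunct2[OF z'] conjunct1[OF z'] zQ])
    qed
    have "\<exists>z'\<in>?Q \<times> UNIV. R z' = R z" using refl zQ by (rule bexI)
    then show ?thesis unfolding col_def by (simp only: if_True some)
  qed
  have colN: "col e = Inr e" if "\<not> (\<exists>z\<in>?Q \<times> UNIV. R z = e)" for e
    unfolding col_def using that by (simp only: if_False)
  show ?thesis
  proof (rule colourableI[OF finB])
    show "bounded_col B col"
      unfolding bounded_col_def
    proof
      fix e assume "e \<in> B"
      show "card {e' \<in> B. col e' = col e} \<le> 2"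
      proof (cases "\<exists>z\<in>?Q \<times> UNIV. R z = e")
        case True
        then obtain z where z: "z \<in> ?Q \<times> UNIV" "R z = e" by blast
        have "{e' \<in> B. col e' = col e} \<subseteq> {R (fst z, True), R (fst z, False)}"
        proof
          fix e' assume e': "e' \<in> {e' \<in> B. col e' = col e}"
          then have ce: "col e' = Inl (fst z)" using colR[OF z(1)] z(2) by simp
          have "\<exists>z'\<in>?Q \<times> UNIV. R z' = e'"
          proof (rule ccontr)
            assume "\<not> ?thesis"
            then show False using colN ce by simp
          qed
          then obtain z' where z': "z' \<in> ?Q \<times> UNIV" "R z' = e'" by blast
          then have "fst z' = fst z" using colR[OF z'(1)] ce by simp
          then have "z' = (fst z, True) \<or> z' = (fst z, False)" by (cases z') auto
          then show "e' \<in> {R (fst z, True), R (fst z, False)}" using z'(2) by auto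
        qed
        then have "card {e' \<in> B. col e' = col e} \<le> card {R (fst z, True), R (fst z, False)}" by (intro card_mono) auto
        also have "\<dots> \<le> 2" by (simp add: card_insert_if)
        finally show ?thesis .
      next
        case False
        have "{e' \<in> B. col e' = col e} \<subseteq> {e}"
        proof
          fix e' assume e': "e' \<in> {e' \<in> B. col e' = col e}"
          then have ce: "col e' = Inr e" using colN[OF False] by simp
          have "\<not> (\<exists>z'\<in>?Q \<times> UNIV. R z' = e')"
          proof
            assume "\<exists>z'\<in>?Q \<times> UNIV. R z' = e'"
            then obtain z' where "z' \<in> ?Q \<times> UNIV" "R z' = e'" by blast
            then show False using colR[of z'] ce by simp
          qed
          then show "e' \<in> {e}" using colN[of e'] ce by simp
        qed
        then have "card {e' \<in> B. col e' = col e} \<le> card {e}" by (intro card_mono) auto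
        then show ?thesis by simp
      qed
    qed
    fix C assume C: "C \<in> copies V {e. e \<subseteq> V \<and> card e = l}" "C \<subseteq> B"
    obtain W where W: "card W = card V" "C = {e. e \<subseteq> W \<and> card e = l}" using copies_complete[OF C(1)] .
    have cW: "card W = r" using W(1) lr(4) by simp
    have mem: "f \<in> B" if "f \<subseteq> W" "card f = l" for f
    proof -
      have "f \<in> C" unfolding W(2) using that by simp
      then show ?thesis by (rule subsetD[OF C(2)])
    qed
    have WQ: "W \<in> ?Q" by (rule cliquesI[OF cW _ _ mem]) (use lr in auto)
    have WU: "(W, b) \<in> ?Q \<times> UNIV" for b :: bool using WQ by simp
    have RC: "R (W, b) \<in> C" for b using bspec[OF R(2) WU[of b]] unfolding W(2) A_def fst_conv .
    show "\<not> inj_on col C"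
    proof
      assume "inj_on col C"
      moreover have "col (R (W, True)) = col (R (W, False))" unfolding colR[OF WU] fst_conv ..
      ultimately have "R (W, True) = R (W, False)" using RC RC by (rule inj_onD)
      with R(1) have "(W, True) = (W, False)" using WU WU by (rule inj_onD)
      then show False by simp
    qed
  qed
qed

section \<open>Isomorphism, densities and cycles\<close>

lemma isomorphic_sym:
  assumes G: "\<And>e. e \<in> edges G \<Longrightarrow> e \<subseteq> verts G" and iso: "isomorphic G H"
  shows "isomorphic H G"
proof -
  obtain f where f: "bij_betw f (verts G) (verts H)" "edges H = (\<lambda>e. f ` e) ` edges G"
    using iso unfolding isomorphic_def by blast
  let ?g = "inv_into (verts G) f"
  have "?g ` f ` e = e" if "e \<in> edges G" for e
    using inv_into_image_cancel[OF bij_betw_imp_inj_on[OF f(1)] G[OF that]] .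
  then have "(\<lambda>e. ?g ` f ` e) ` edges G = (\<lambda>e. e) ` edges G" by (rule image_cong[OF refl])
  then have "edges G = (\<lambda>e. ?g ` e) ` edges H" unfolding f(2) image_image[of "\<lambda>e. ?g ` e"] by simp
  with bij_betw_inv_into[OF f(1)] show ?thesis
    unfolding isomorphic_def by (intro exI[of _ ?g] conjI)
qed

lemma densities_isomorphic_subset:
  assumes G: "\<And>e. e \<in> edges G \<Longrightarrow> e \<subseteq> verts G" and iso: "isomorphic G H"
  shows "density l ` {J. subgraph J G \<and> l + 1 \<le> card (verts J)} \<subseteq> density l ` {J. subgraph J H \<and> l + 1 \<le> card (verts J)}"
proof
  fix x assume "x \<in> density l ` {J. subgraph J G \<and> l + 1 \<le> card (verts J)}"
  then obtain J where J: "subgraph J G" "l + 1 \<le> card (verts J)" "x = density l J" by blast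
  obtain f where f: "bij_betw f (verts G) (verts H)" "edges H = (\<lambda>e. f ` e) ` edges G"
    using iso unfolding isomorphic_def by blast
  have inj: "inj_on f (verts G)" using f(1) by (rule bij_betw_imp_inj_on)
  have sub: "verts J \<subseteq> verts G" "edges J \<subseteq> edges G" "\<And>e. e \<in> edges J \<Longrightarrow> e \<subseteq> verts J"
    using J(1) unfolding subgraph_def by auto
  let ?J = "HGraph (f ` verts J) ((\<lambda>e. f ` e) ` edges J)"
  have cv: "card (verts ?J) = card (verts J)" using card_image[OF inj_on_subset[OF inj sub(1)]] by simp
  have "edges J \<subseteq> Pow (verts G)" using sub by blast
  then have ce: "card (edges ?J) = card (edges J)" using card_copy[OF inj] by simp
  have "density l ?J = x" unfolding J(3) density_def cv ce ..
  moreover have "f ` verts J \<subseteq> verts H" using sub(1) f(1) by (auto simp: bij_betw_def)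
  moreover have "(\<lambda>e. f ` e) ` edges J \<subseteq> edges H" unfolding f(2) using sub(2) by (rule image_mono)
  moreover have "\<forall>d\<in>(\<lambda>e. f ` e) ` edges J. d \<subseteq> f ` verts J"
    using image_mono[OF sub(3), of _ f] by simp
  ultimately have "subgraph ?J H" unfolding subgraph_def by simp
  then show "x \<in> density l ` {J. subgraph J H \<and> l + 1 \<le> card (verts J)}"
    using \<open>density l ?J = x\<close>[symmetric] J(2) cv by (intro image_eqI[of _ _ ?J] CollectI conjI) simp_all
qed

lemma max_density_isomorphic:
  assumes G: "\<And>e. e \<in> edges G \<Longrightarrow> e \<subseteq> verts G" and iso: "isomorphic G H"
  shows "max_density l G = max_density l H"
proof -
  obtain f where f: "bij_betw f (verts G) (verts H)" "edges H = (\<lambda>e. f ` e) ` edges G"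
    using iso unfolding isomorphic_def by blast
  have H: "e \<subseteq> verts H" if e: "e \<in> edges H" for e
  proof -
    obtain d where "d \<in> edges G" "e = f ` d" using e f(2) by blast
    then show ?thesis using G[of d] f(1) by (auto simp: bij_betw_def)
  qed
  have "density l ` {J. subgraph J G \<and> l + 1 \<le> card (verts J)} = density l ` {J. subgraph J H \<and> l + 1 \<le> card (verts J)}"
    by (rule subset_antisym[OF densities_isomorphic_subset[OF G iso]
        densities_isomorphic_subset[OF H isomorphic_sym[OF G iso]]])
  then show ?thesis unfolding max_density_def by (rule arg_cong)
qed

lemma isomorphic_complete:
  assumes V: "finite (verts G)" "card (verts G) = r" and E: "edges G = {e. e \<subseteq> verts G \<and> card e = l}"
  shows "isomorphic G (complete_lgraph l r)"
proof -
  obtain h where h: "bij_betw h (verts G) {0..<r}" using ex_bij_betw_finite_nat[OF V(1)] V(2) by auto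
  have inj: "inj_on h (verts G)" and im: "h ` verts G = {..<r}"
    using h unfolding bij_betw_def by (auto simp: lessThan_atLeast0)
  have ci: "card (h ` a) = card a" if "a \<subseteq> verts G" for a using card_image[OF inj_on_subset[OF inj that]] .
  have "{e. e \<subseteq> {..<r} \<and> card e = l} = (\<lambda>e. h ` e) ` {e. e \<subseteq> verts G \<and> card e = l}"
  proof
    show "{e. e \<subseteq> {..<r} \<and> card e = l} \<subseteq> (\<lambda>e. h ` e) ` {e. e \<subseteq> verts G \<and> card e = l}"
    proof
      fix f assume f: "f \<in> {e. e \<subseteq> {..<r} \<and> card e = l}"
      then have "f \<subseteq> h ` verts G" using im by simp
      then obtain a where a: "a \<subseteq> verts G" "f = h ` a" by (elim subset_imageE)
      then have "a \<in> {e. e \<subseteq> verts G \<and> card e = l}" using f ci by simp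
      then show "f \<in> (\<lambda>e. h ` e) ` {e. e \<subseteq> verts G \<and> card e = l}" unfolding a(2) by (rule imageI)
    qed
    show "(\<lambda>e. h ` e) ` {e. e \<subseteq> verts G \<and> card e = l} \<subseteq> {e. e \<subseteq> {..<r} \<and> card e = l}"
    proof
      fix f assume "f \<in> (\<lambda>e. h ` e) ` {e. e \<subseteq> verts G \<and> card e = l}"
      then obtain a where a: "a \<subseteq> verts G" "card a = l" "f = h ` a" by blast
      show "f \<in> {e. e \<subseteq> {..<r} \<and> card e = l}" using ci[OF a(1)] a(2) image_mono[OF a(1), of h] im a(3) by simp
    qed
  qed
  then show ?thesis unfolding isomorphic_def complete_lgraph_def
    by (intro exI[of _ h] conjI) (use h in \<open>simp_all add: E lessThan_atLeast0\<close>)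
qed

lemma complete_of_isomorphic:
  assumes G: "finite (verts G)" "\<And>e. e \<in> edges G \<Longrightarrow> e \<subseteq> verts G \<and> card e = l" and iso: "isomorphic G (complete_lgraph l r)"
  shows "card (verts G) = r" "edges G = {e. e \<subseteq> verts G \<and> card e = l}"
proof -
  obtain f where f: "bij_betw f (verts G) {..<r}" "{e. e \<subseteq> {..<r} \<and> card e = l} = (\<lambda>e. f ` e) ` edges G"
    using iso unfolding isomorphic_def complete_lgraph_def by auto
  have inj: "inj_on f (verts G)" and im: "f ` verts G = {..<r}" using f(1) unfolding bij_betw_def by auto
  show "card (verts G) = r" using card_image[OF inj] im by simp
  show "edges G = {e. e \<subseteq> verts G \<and> card e = l}"
  proof
    show "{e. e \<subseteq> verts G \<and> card e = l} \<subseteq> edges G"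
    proof
      fix a assume a: "a \<in> {e. e \<subseteq> verts G \<and> card e = l}"
      then have "f ` a \<in> {e. e \<subseteq> {..<r} \<and> card e = l}"
        using card_image[OF inj_on_subset[OF inj, of a]] im by auto
      then obtain d where d: "d \<in> edges G" "f ` a = f ` d" using f(2) by auto
      then have "a = d" using inj_on_image_eq_iff[OF inj, of a d] a G(2)[OF d(1)] by simp
      then show "a \<in> edges G" using d(1) by simp
    qed
  qed (use G(2) in blast)
qed

text \<open>If two indices gave the same edge, each would be the successor of the other modulo
  \<open>k\<close>, impossible for \<open>k \<ge> 3\<close>.\<close>

lemma card_edges_cycle_graph: "3 \<le> k \<Longrightarrow> card (edges (cycle_graph k)) = k"
proof -
  assume k: "3 \<le> k"
  have s: "Suc i mod k = (if Suc i = k then 0 else Suc i)" if "i < k" for i using that by auto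
  have "inj_on (\<lambda>i. {i, Suc i mod k}) {..<k}"
  proof (rule inj_onI)
    fix i j assume ij: "i \<in> {..<k}" "j \<in> {..<k}" "{i, Suc i mod k} = {j, Suc j mod k}"
    show "i = j"
    proof (rule ccontr)
      assume "i \<noteq> j"
      have "i = j \<and> Suc i mod k = Suc j mod k \<or> i = Suc j mod k \<and> Suc i mod k = j"
        using ij(3) unfolding doubleton_eq_iff .
      then have mods: "i = Suc j mod k \<and> Suc i mod k = j"
      proof (rule disjE)
        assume "i = j \<and> Suc i mod k = Suc j mod k"
        then have "i = j" by (rule conjunct1)
        with \<open>i \<noteq> j\<close> show ?thesis by (rule notE)
      qed
      have ik: "i < k" "j < k" using ij(1,2) by simp_all
      have i: "i = (if Suc j = k then 0 else Suc j)" using conjunct1[OF mods] unfolding s[OF ik(2)] .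
      have j: "(if Suc i = k then 0 else Suc i) = j" using conjunct2[OF mods] unfolding s[OF ik(1)] .
      show False
      proof (cases "Suc j = k")
        case True
        then have "i = 0" using i by presburger
        then show False using j True k by presburger
      next
        case False
        then have "i = Suc j" using i by presburger
        then show False using j k by presburger
      qed
    qed
  qed
  then show ?thesis unfolding cycle_graph_def by (simp add: card_image)
qed

text \<open>Equally many edges and vertices is all that is needed of the cycle; it forces
  \<open>1 < m\<close>.\<close>

lemma cycle_subgraph:
  assumes "contains_cycle G"
  obtains J where "subgraph J G" "3 \<le> card (verts J)" "card (edges J) = card (verts J)"
proof -
  obtain k H where k: "3 \<le> k" and H: "subgraph H G" "isomorphic (cycle_graph k) H"
    using assms unfolding contains_cycle_def is_copy_def by blast
  obtain f where f: "bij_betw f (verts (cycle_graph k)) (verts H)" "edges H = (\<lambda>e. f ` e) ` edges (cycle_graph k)"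
    using H(2) unfolding isomorphic_def by blast
  have "card (verts H) = k" using bij_betw_same_card[OF f(1)] unfolding cycle_graph_def by simp
  moreover have "edges (cycle_graph k) \<subseteq> Pow (verts (cycle_graph k))"
    unfolding cycle_graph_def using k by auto
  then have "card (edges H) = k"
    unfolding f(2) using card_copy[OF bij_betw_imp_inj_on[OF f(1)]] card_edges_cycle_graph[OF k] by simp
  ultimately show thesis by (intro that[of H] H(1)) (use k in simp_all)
qed

context template
begin

text \<open>Degree 2 in the copies gives degree at least 3 in a minimal uncolourable graph, hence at
  least 3/2 edges per vertex. This serves \<open>C_4\<close>, where \<open>m = 3/2\<close>.\<close>

lemma sparse_colourable:
  fixes B :: "nat set set"
  assumes l2: "l = 2" and m: "m \<le> 3 / 2" and B: "uniform l B"
    and dens: "\<And>D. D \<subseteq> B \<Longrightarrow> D \<noteq> {} \<Longrightarrow> real (card D) < m * real (card (\<Union>D))"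
  shows "colourable \<C> B"
proof (rule ccontr)
  assume bad: "\<not> colourable \<C> B"
  have finB: "finite B" using B by (simp add: uniform_def)
  obtain B0 where B0: "B0 \<subseteq> B" "minimal_uncolourable \<C> B0" using ex_minimal_uncolourable[OF finB bad] .
  have u0: "uniform l B0" by (rule uniform_subset[OF B B0(1)])
  then have fin0: "finite B0" by (simp add: uniform_def)
  obtain C where "C \<in> \<C>" "C \<subseteq> B0" using minimal_uncolourable_has_copy[OF B0(2) fin0] by blast
  then have ne: "B0 \<noteq> {}" using copy_facts(1)[of C] card_E by auto
  have degC: "2 \<le> deg x C" if C: "C \<in> \<C>" "C \<subseteq> B0" "x \<in> \<Union>C" for C x
  proof -
    obtain \<phi> u where "u \<in> V" "deg x C = deg u E"
      using copy_degree[OF C(1)[unfolded \<C>_def] EP C(3)] by metis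
    then show ?thesis using deg2 by simp
  qed
  have "2 * 2 \<le> deg x B0 + 1" if x: "x \<in> \<Union>B0" for x
    by (rule minimal_uncolourable_deg[OF B0(2) fin0 x degC])
  then have "3 \<le> deg x B0" if "x \<in> \<Union>B0" for x using that by fastforce
  then have "(\<Sum>x\<in>\<Union>B0. 3) \<le> (\<Sum>x\<in>\<Union>B0. deg x B0)" by (intro sum_mono)
  then have "3 * card (\<Union>B0) \<le> 2 * card B0" using sum_deg_uniform[OF u0] l2 by simp
  then have "3 / 2 * real (card (\<Union>B0)) \<le> real (card B0)" by linarith
  also have "\<dots> < m * real (card (\<Union>B0))" by (rule dens[OF B0(1) ne])
  also have "\<dots> \<le> 3 / 2 * real (card (\<Union>B0))" using m by (intro mult_right_mono) auto
  finally show False by simp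
qed

end

text \<open>Pascal's rule, since the edges avoiding \<open>u\<close> form the complete hypergraph on
  the other vertices.\<close>

lemma deg_complete:
  assumes V: "finite V" "card V = Suc r" and l: "1 \<le> l" and u: "u \<in> V"
  shows "deg u {e. e \<subseteq> V \<and> card e = l} = r choose (l - 1)"
proof -
  let ?E = "{e. e \<subseteq> V \<and> card e = l}"
  have finE: "finite ?E" using V(1) by simp
  have "card ?E = Suc r choose l" using n_subsets[OF V(1), of l] V(2) by simp
  moreover have "{e \<in> ?E. u \<notin> e} = {e. e \<subseteq> V - {u} \<and> card e = l}" by blast
  then have "card {e \<in> ?E. u \<notin> e} = r choose l"
    using n_subsets[of "V - {u}" l] V card_Diff_singleton[OF u] by simp
  moreover have "Suc r choose l = (r choose l) + (r choose (l - 1))" using l by (cases l) auto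
  ultimately show ?thesis using card_delete[OF finE, of u] by simp
qed

text \<open>The constant has to be fixed before \<open>p\<close>, so the proof splits by the shape
  of \<open>F'\<close> alone. One case serves both graph conditions, because \<open>C_4\<close>
  contains a cycle and is not a triangle.\<close>

theorem theorem5:
  fixes l :: nat and F F' :: "'a hgraph"
  assumes "l \<ge> 2"
    and "lgraph l F"
    and "subgraph F' F"
    and "strictly_balanced l F'"
    and "max_density l F' = max_density l F"
  shows "\<exists>c>0. \<forall>p :: nat \<Rightarrow> real. (\<forall>n. 0 \<le> p n \<and> p n \<le> 1) \<longrightarrow>
     (l = 2 \<and> contains_cycle F' \<and>
        \<not> isomorphic F' (complete_lgraph 2 3) \<and> \<not> isomorphic F' (cycle_graph 4) \<and>
        (\<forall>\<^sub>F n in sequentially. p n \<le> c * real n powr (- 1 / max_density 2 F))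
      \<or> l = 2 \<and> isomorphic F' (cycle_graph 4) \<and>
        p \<in> o(\<lambda>n. real n powr (- 1 / max_density 2 (cycle_graph 4)))
      \<or> (\<exists>r. l \<ge> 3 \<and> r \<ge> l + 1 \<and> (l, r) \<noteq> (3, 4) \<and>
           isomorphic F' (complete_lgraph l r) \<and>
           (\<forall>\<^sub>F n in sequentially.
              p n \<le> c * real n powr (- 1 / max_density l (complete_lgraph l r))))) \<longrightarrow>
     whp (\<lambda>n. random_lgraph l n (p n)) (has_rainbow_free_colouring F)"
    (is "\<exists>c>0. \<forall>p. ?P p \<longrightarrow> ?I c p \<or> ?II p \<or> ?III c p \<longrightarrow> ?whp p")
proof -
  define V where "V = verts F'"
  define E where "E = edges F'"
  define m where "m = max_density l F'"
  have F'_eq: "F' = HGraph V E" unfolding V_def E_def by simp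
  have sub: "V \<subseteq> verts F" "E \<subseteq> edges F" using assms(3) unfolding subgraph_def V_def E_def by auto
  have finV: "finite V" using sub(1) assms(2) finite_subset unfolding lgraph_def by blast
  have edge: "e \<subseteq> V \<and> card e = l" if "e \<in> E" for e
    using that assms(2,3) sub(2) unfolding subgraph_def lgraph_def V_def E_def by blast
  have edge': "e \<subseteq> verts F'" if "e \<in> edges F'" for e using edge that unfolding V_def E_def by blast
  have cV: "l + 1 \<le> card V" using assms(4) unfolding strictly_balanced_def V_def by blast
  have m_dens: "m = density l F'" using assms(4) unfolding strictly_balanced_def m_def by blast
  have m_eq: "real (card E) - 1 = m * (real (card V) - real l)"
    unfolding m_dens density_def V_def[symmetric] E_def[symmetric] using cV by simp
  have strict: "\<forall>J. subgraph J F' \<and> J \<noteq> F' \<and> l + 1 \<le> card (verts J) \<longrightarrow> density l J < max_density l F'"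
    using assms(4) unfolding strictly_balanced_def by blast
  have bal: "real (card J) - 1 < m * (real (card U) - real l)"
    if UJ: "U \<subseteq> V" "J \<subseteq> E" "\<Union>J \<subseteq> U" "l + 1 \<le> card U" "(U, J) \<noteq> (V, E)" for U J
  proof -
    have "subgraph (HGraph U J) F'" unfolding subgraph_def F'_eq using UJ by auto
    moreover have "HGraph U J \<noteq> F'" unfolding F'_eq using UJ(5) by simp
    ultimately have "density l (HGraph U J) < m"
      using spec[OF strict, of "HGraph U J"] UJ(4) unfolding m_def by simp
    then show ?thesis unfolding density_def using UJ(4) by (simp add: field_simps)
  qed
  have balE: "real (card J) - 1 < m * (real (card U) - real l)"
    if "U \<subseteq> V" "J \<subseteq> E" "\<Union>J \<subseteq> U" "l + 1 \<le> card U" "J \<noteq> E" for U J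
    using that by (intro bal) auto
  have template: "template V E l m" if "4 \<le> card E" "\<And>u. u \<in> V \<Longrightarrow> 2 \<le> deg u E"
    using finV edge assms(1) cV that m_eq balE by unfold_locales auto
  have C4: "contains_cycle F'" "\<not> isomorphic F' (complete_lgraph 2 3)" "card V = 4" "card E = 4"
    "max_density l F' = max_density l (cycle_graph 4)"
    if iso: "isomorphic F' (cycle_graph 4)" and l2: "l = 2"
  proof -
    have "isomorphic (cycle_graph 4) F'" by (rule isomorphic_sym[OF edge' iso])
    moreover have "subgraph F' F'" unfolding subgraph_def using edge' by blast
    ultimately show "contains_cycle F'" unfolding contains_cycle_def is_copy_def
      by (intro exI[of _ 4] conjI exI[of _ F']) auto
    obtain f where f: "bij_betw f V (verts (cycle_graph 4))" "edges (cycle_graph 4) = (\<lambda>e. f ` e) ` E"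
      using iso unfolding isomorphic_def V_def E_def by blast
    show v4: "card V = 4" using bij_betw_same_card[OF f(1)] unfolding cycle_graph_def by simp
    have "E \<subseteq> Pow V" using edge by blast
    then show "card E = 4"
      using card_copy[OF bij_betw_imp_inj_on[OF f(1)]] card_edges_cycle_graph[of 4] f(2) by simp
    show "\<not> isomorphic F' (complete_lgraph 2 3)"
      using complete_of_isomorphic(1)[of F' 2 3] edge finV v4 l2 unfolding V_def E_def by auto
    show "max_density l F' = max_density l (cycle_graph 4)" by (rule max_density_isomorphic[OF edge' iso])
  qed
  consider (graph) "l = 2" "contains_cycle F'" "\<not> isomorphic F' (complete_lgraph 2 3)"
    | (complete) r where "l \<ge> 3" "r \<ge> l + 1" "(l, r) \<noteq> (3, 4)" "isomorphic F' (complete_lgraph l r)"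
    | (none) "\<not> (l = 2 \<and> contains_cycle F' \<and> \<not> isomorphic F' (complete_lgraph 2 3))"
        "\<not> (\<exists>r. l \<ge> 3 \<and> r \<ge> l + 1 \<and> (l, r) \<noteq> (3, 4) \<and> isomorphic F' (complete_lgraph l r))"
    by blast
  then show ?thesis
  proof cases
    \<comment> \<open>No condition can hold for this \<open>F'\<close>, so any positive constant
      serves.\<close>
    case none
    have "\<not> (l = 2 \<and> isomorphic F' (cycle_graph 4))" using none(1) C4(1,2) by blast
    then show ?thesis using none by (intro exI[of _ 1]) auto
  next
    case graph
    note l2 = graph(1)
    obtain J where J: "subgraph J F'" "3 \<le> card (verts J)" "card (edges J) = card (verts J)"
      using cycle_subgraph[OF graph(2)] .
    have JV: "verts J \<subseteq> V" "edges J \<subseteq> E" "\<Union>(edges J) \<subseteq> verts J"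
      using J(1) unfolding subgraph_def V_def E_def by auto
    have finE: "finite E" using edge finV by (intro finite_subset[of E "Pow V"]) auto
    have v4: "4 \<le> card V"
    proof (rule ccontr)
      assume "\<not> 4 \<le> card V"
      then have v3: "card V = 3" using cV l2 by simp
      have all3: "card {e. e \<subseteq> V \<and> card e = 2} = 3" using n_subsets[OF finV, of 2] v3 by (simp add: choose_two)
      have "3 \<le> card E" using card_mono[OF finE JV(2)] J(2,3) by simp
      then have "E = {e. e \<subseteq> V \<and> card e = 2}"
        using edge l2 finV all3 by (intro card_seteq) auto
      then have "isomorphic F' (complete_lgraph 2 3)"
        using v3 finV unfolding V_def E_def by (intro isomorphic_complete)
      then show False using graph(3) by blast
    qed
    \<comment> \<open>A cycle on \<open>w\<close> vertices gives
      \<open>w - 1 \<le> m * (w - 2)\<close>.\<close>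
    have m1: "1 < m"
    proof -
      have "real (card (edges J)) - 1 \<le> m * (real (card (verts J)) - 2)"
      proof (cases "(verts J, edges J) = (V, E)")
        case True
        then show ?thesis using m_eq l2 by simp
      next
        case False
        have "real (card (edges J)) - 1 < m * (real (card (verts J)) - real l)"
          using J(2) l2 False JV by (intro bal) auto
        then show ?thesis using l2 by simp
      qed
      then have "real (card (verts J)) - 1 \<le> m * (real (card (verts J)) - 2)" using J(3) by simp
      then have "1 \<le> (m - 1) * (real (card (verts J)) - 2)" by (simp add: algebra_simps)
      moreover have "(m - 1) * (real (card (verts J)) - 2) \<le> 0" if "m \<le> 1"
        using that J(2) by (intro mult_nonpos_nonneg) auto
      ultimately show ?thesis by fastforce
    qed
    have lV: "l + 2 \<le> card V" using v4 l2 by simp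
    have deg2: "2 \<le> deg u E" if u: "u \<in> V" for u
      using deg_gt_balanced[OF finV edge lV m_eq bal u] m1 by simp
    have uE: "uniform 2 E" unfolding uniform_def using finE edge l2 finV finite_subset by blast
    have "(\<Sum>u\<in>V. 2) \<le> (\<Sum>u\<in>V. deg u E)" by (rule sum_mono) (rule deg2)
    also have "\<dots> = 2 * card E" using edge l2 by (intro sum_deg finV finE) simp
    finally have e4: "4 \<le> card E" using v4 by simp
    interpret template V E l m by (rule template[OF e4 deg2])
    show ?thesis
    proof (cases "isomorphic F' (cycle_graph 4)")
      case True
      have m32: "m \<le> 3 / 2" using m_eq C4(3,4)[OF True l2] l2 by simp
      have mC4: "max_density 2 (cycle_graph 4) = m" using C4(5)[OF True l2] l2 unfolding m_def by simp
      show ?thesis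
      proof (intro exI[of _ 1] conjI allI impI)
        fix p :: "nat \<Rightarrow> real"
        assume p: "?P p" and c: "?I 1 p \<or> ?II p \<or> ?III 1 p"
        then have small: "p \<in> o(\<lambda>n. real n powr (- 1 / m))" using True l2 mC4 by auto
        show "?whp p"
          by (rule strict_density_condition_whp[OF sub sparse_colourable[OF l2 m32] p small])
      qed simp
    next
      case False
      have mF: "max_density 2 F = m" using assms(5) l2 unfolding m_def by simp
      have "colourable \<C> B"
        if B: "uniform l B" "\<And>D. D \<subseteq> B \<Longrightarrow> real (card D) \<le> m * real (card (\<Union>D))" for B :: "nat set set"
        unfolding \<C>_def
      proof (rule graph_colourable[OF finV _ v4 _ m1])
        show "e \<subseteq> V \<and> card e = 2" if "e \<in> E" for e using edge[OF that] l2 by simp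
        show "m = (real (card E) - 1) / (real (card V) - 2)" using m_eq v4 l2 by simp
        show "real (card J) - 1 < m * (real (card U) - 2)"
          if "U \<subseteq> V" "J \<subseteq> E" "\<Union>J \<subseteq> U" "3 \<le> card U" "(U, J) \<noteq> (V, E)" for U J
          using bal[OF that(1,2,3) _ that(5)] that(4) l2 by simp
        show "\<not> isomorphic (HGraph V E) (cycle_graph 4)" using False unfolding F'_eq .
        show "uniform 2 B" using B(1) l2 by simp
      qed (rule B(2))
      from density_condition_whp[OF sub this] obtain c where c: "0 < c"
        "\<forall>p. ?P p \<longrightarrow> (\<forall>\<^sub>F n in sequentially. p n \<le> c * real n powr (- 1 / m)) \<longrightarrow> ?whp p" by blast
      show ?thesis
      proof (intro exI[of _ c] conjI allI impI)
        fix p :: "nat \<Rightarrow> real"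
        assume p: "?P p" and "?I c p \<or> ?II p \<or> ?III c p"
        then have "\<forall>\<^sub>F n in sequentially. p n \<le> c * real n powr (- 1 / m)" using False l2 mF by auto
        then show "?whp p" using c(2) p by blast
      qed (rule c(1))
    qed
  next
    case (complete r)
    have comp: "card V = r" "E = {e. e \<subseteq> V \<and> card e = l}"
      using complete_of_isomorphic[of F' l r] edge finV complete(4) unfolding V_def E_def by auto
    obtain s where s: "r = Suc s" "l \<le> s" using complete(2) by (cases r) auto
    \<comment> \<open>With \<open>l \<ge> 3\<close> already the smallest clique has
      \<open>l + 1 \<ge> 4\<close> edges, and its degrees are \<open>l\<close>.\<close>
    have "l + 1 choose l = l + 1" using binomial_symmetric[of 1 "l + 1"] by simp
    moreover have "l + 1 choose l \<le> r choose l" using complete(2) by (rule binomial_right_mono)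
    ultimately have e4: "4 \<le> card E" using complete(1) n_subsets[OF finV, of l] comp by simp
    have deg2: "2 \<le> deg u E" if u: "u \<in> V" for u
    proof -
      have "deg u E = s choose (l - 1)" unfolding comp(2) using deg_complete[OF finV _ _ u, of s l] comp(1) s(1) complete(1) by simp
      moreover have "l choose (l - 1) \<le> s choose (l - 1)" using s(2) by (rule binomial_right_mono)
      moreover have "l choose (l - 1) = l" using binomial_symmetric[of 1 l] complete(1) by simp
      ultimately show ?thesis using complete(1) by simp
    qed
    interpret template V E l m by (rule template[OF e4 deg2])
    have "colourable \<C> B"
      if B: "uniform l B" "\<And>D. D \<subseteq> B \<Longrightarrow> real (card D) \<le> m * real (card (\<Union>D))" for B :: "nat set set"
    proof -
      have "colourable (copies V {e. e \<subseteq> V \<and> card e = l}) B"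
    proof (rule complete_colourable[OF complete(1,2,3) comp(1) B(1)])
      fix D assume "D \<subseteq> B"
      then have "real (card D) \<le> m * real (card (\<Union>D))" by (rule B(2))
      then have "(real r - real l) * real (card D) \<le> (real r - real l) * (m * real (card (\<Union>D)))"
        using complete(2) by (intro mult_left_mono) auto
      also have "\<dots> = (real (card E) - 1) * real (card (\<Union>D))" unfolding m_eq comp(1) by simp
      also have "card E = r choose l" using n_subsets[OF finV, of l] comp by simp
      finally have le: "(real r - real l) * real (card D) \<le> (real (r choose l) - 1) * real (card (\<Union>D))" .
      have rl: "real (r - l) = real r - real l" using complete(2) by (simp add: of_nat_diff)
      have "real ((r - l) * card D + card (\<Union>D)) \<le> real ((r choose l) * card (\<Union>D))"
        unfolding of_nat_add of_nat_mult rl using le by (simp add: algebra_simps)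
      then show "(r - l) * card D + card (\<Union>D) \<le> (r choose l) * card (\<Union>D)" by (simp only: of_nat_le_iff)
    qed
      then show ?thesis unfolding \<C>_def comp(2)[symmetric] .
    qed
    from density_condition_whp[OF sub this] obtain c where c: "0 < c"
      "\<forall>p. ?P p \<longrightarrow> (\<forall>\<^sub>F n in sequentially. p n \<le> c * real n powr (- 1 / m)) \<longrightarrow> ?whp p" by blast
    show ?thesis
    proof (intro exI[of _ c] conjI allI impI)
      fix p :: "nat \<Rightarrow> real"
      assume p: "?P p" and "?I c p \<or> ?II p \<or> ?III c p"
      \<comment> \<open>The condition brings its own \<open>r'\<close>; its density is still
        \<open>m\<close>, because \<open>F'\<close> is isomorphic to that complete hypergraph as
        well.\<close>
      then obtain r' where r': "isomorphic F' (complete_lgraph l r')"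
        "\<forall>\<^sub>F n in sequentially. p n \<le> c * real n powr (- 1 / max_density l (complete_lgraph l r'))"
        using complete(1) by auto
      have "max_density l (complete_lgraph l r') = m"
        unfolding m_def using max_density_isomorphic[OF edge' r'(1)] by simp
      then show "?whp p" using c(2) p r'(2) by simp
    qed (rule c(1))
  qed
qed

end
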